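(* Let $V$ be a finite-dimensional real or complex vector space and $\mu$ a probability measure on $\mathrm{GL}(V)$ with finite first moment, with Furstenberg--Kifer--Hennion filtration $V=F_1\supsetneq F_2\supsetneq\cdots\supsetneq F_k\supsetneq F_{k+1}=\{0\}$. Then for every $\mu$-stationary ergodic probability measure $\nu$ on $P(V)$ there exists $i=i_\nu\in\{1,\dots,k\}$ such that $\nu$ is the unique lift on $P(F_{i_\nu})\setminus P(F_{i_\nu+1})$ of an ergodic $\mu$-stationary probability measure on $P(F_{i_\nu}/F_{i_\nu+1})$.
   Context: Measures are Borel; fix any norm on $V$. $\mu$ has finite first moment if $\int \log\max\{\|g\|,\|g^{-1}\|\}\,d\mu(g)<\infty$. $\Gamma_\mu$ is the semigroup generated by the support of $\mu$; a subspace is $\mu$-invariant if it is $\Gamma_\mu$-invariant. A probability measure $\nu$ is $\mu$-stationary if $\mu*\nu=\nu$, where $\int f\,d(\mu*\nu)=\iint f(gx)\,d\mu(g)\,d\nu(x)$, and ergodic if it is extremal among $\mu$-stationary probability measures. The cocycle average of $\nu$ on $P(V)$ is $\alpha(\nu)=\iint\log\frac{\|gv\|}{\|v\|}\,d\mu(g)\,d\nu([v])$. The top Lyapunov exponent $\lambda_1$ is the a.s. limit of $\frac1n\log\|L_n\|$, $L_n=X_n\cdots X_1$ with $X_i$ iid of law $\mu$. Furstenberg--Kifer--Hennion (FKH) exponents and spaces: as $\nu$ ranges over ergodic $\mu$-stationary probability measures on $P(V)$, $\alpha(\nu)$ takes finitely many values $\beta_1>\beta_2>\cdots>\beta_k>-\infty$,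 the FKH exponents. The $i$-th FKH space $F_i$ is the $\mu$-invariant subspace maximal for the property that the top Lyapunov exponent of $\mu$ on $F_i$ is $\beta_i$. One has $V=F_1\supsetneq\cdots\supsetneq F_k\supsetneq F_{k+1}:=\{0\}$, and for $v\in F_i\setminus F_{i+1}$, $\frac1n\log\|L_nv\|\to\beta_i$ almost surely. By convention $\beta_{k+1}=-\infty$. For $\mu$-invariant subspaces $W\subset V'$, a lift on $P(V')\setminus P(W)$ of a $\mu$-stationary probability measure $\overline\nu$ on $P(V'/W)$ is a $\mu$-stationary probability measure on $P(V')\setminus P(W)$ whose push-forward to $P(V'/W)$ under the natural map is $\overline\nu$. *)

theory Defs
  imports "HOL-Probability.Probability"
begin

text \<open>
  The scalar field is a type \<open>'k\<close> of class \<open>{real_normed_field, euclidean_space}\<close>, that is, a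
  finite-dimensional real normed field. Both \<open>real\<close> and \<open>complex\<close> are instances, and by
  Frobenius' theorem there are no others up to isomorphism. The space \<open>V\<close> is \<open>'k ^ 'n\<close>, with its
  Euclidean norm, and linear maps are matrices. Subspaces and spans are taken over \<open>'k\<close>
  (\<open>vec.subspace\<close>, \<open>vec.span\<close>), not over the reals.
\<close>

subsection \<open>Projective spaces and their Borel structure\<close>

definition quotient_topology :: "'a topology \<Rightarrow> ('a \<Rightarrow> 'b) \<Rightarrow> 'b topology" where
  "quotient_topology X q =
     topology (\<lambda>U. U \<subseteq> q ` topspace X \<and> openin X {x \<in> topspace X. q x \<in> U})"

lemma openin_quotient_topology:
  "openin (quotient_topology X q) U \<longleftrightarrow>
     U \<subseteq> q ` topspace X \<and> openin X {x \<in> topspace X. q x \<in> U}"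
proof -
  have "istopology (\<lambda>U. U \<subseteq> q ` topspace X \<and> openin X {x \<in> topspace X. q x \<in> U})"
    unfolding istopology_def
  proof (intro conjI allI impI)
    fix S T assume "S \<subseteq> q ` topspace X \<and> openin X {x \<in> topspace X. q x \<in> S}"
      and "T \<subseteq> q ` topspace X \<and> openin X {x \<in> topspace X. q x \<in> T}"
    moreover have "{x \<in> topspace X. q x \<in> S \<inter> T} =
        {x \<in> topspace X. q x \<in> S} \<inter> {x \<in> topspace X. q x \<in> T}" by auto
    ultimately show "S \<inter> T \<subseteq> q ` topspace X" "openin X {x \<in> topspace X. q x \<in> S \<inter> T}"
      by auto
  next
    fix K assume K: "\<forall>S\<in>K. S \<subseteq> q ` topspace X \<and> openin X {x \<in> topspace X. q x \<in> S}"
    have "{x \<in> topspace X. q x \<in> \<Union>K} = (\<Union>S\<in>K. {x \<in> topspace X. q x \<in> S})" by auto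
    with K show "\<Union>K \<subseteq> q ` topspace X" "openin X {x \<in> topspace X. q x \<in> \<Union>K}" by auto
  qed
  then show ?thesis
    by (simp add: quotient_topology_def)
qed

definition borel_of :: "'a topology \<Rightarrow> 'a measure" where
  "borel_of X = sigma (topspace X) {U. openin X U}"

definition line :: "'k::field ^ 'n \<Rightarrow> ('k ^ 'n) set" where
  "line v = vec.span {v}"

definition proj :: "('k::field ^ 'n) set \<Rightarrow> ('k ^ 'n) set set" where
  "proj W = line ` (W - {0})"

definition proj_borel :: "('k::{real_normed_field, euclidean_space} ^ 'n) set measure" where
  "proj_borel = borel_of (quotient_topology (top_of_set (- {0})) line)"

text \<open>
  Vectors of \<open>V'/W\<close> are cosets of \<open>W\<close>, so a point of \<open>P(V'/W)\<close> is a set of cosets. It carries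
  the quotient topology from \<open>V' \<setminus> W\<close>.
\<close>

definition coset :: "('k::field ^ 'n) set \<Rightarrow> 'k ^ 'n \<Rightarrow> ('k ^ 'n) set" where
  "coset W v = (\<lambda>w. v + w) ` W"

definition quot_line :: "('k::field ^ 'n) set \<Rightarrow> 'k ^ 'n \<Rightarrow> ('k ^ 'n) set set" where
  "quot_line W v = coset W ` line v"

definition quot_proj_borel ::
    "('k::{real_normed_field, euclidean_space} ^ 'n) set \<Rightarrow> ('k ^ 'n) set \<Rightarrow>
     ('k ^ 'n) set set measure" where
  "quot_proj_borel V' W = borel_of (quotient_topology (top_of_set (V' - W)) (quot_line W))"

definition proj_act :: "'k::field ^ 'n ^ 'n \<Rightarrow> ('k ^ 'n) set \<Rightarrow> ('k ^ 'n) set" where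
  "proj_act g L = (\<lambda>v. g *v v) ` L"

definition quot_proj_act :: "'k::field ^ 'n ^ 'n \<Rightarrow> ('k ^ 'n) set set \<Rightarrow> ('k ^ 'n) set set" where
  "quot_proj_act g l = proj_act g ` l"

subsection \<open>Probability measures on the general linear group\<close>

definition GL :: "('k::field ^ 'n ^ 'n) set" where
  "GL = {g. invertible g}"

definition finite_first_moment ::
    "('k::{real_normed_field, euclidean_space} ^ 'n ^ 'n) measure \<Rightarrow> bool" where
  "finite_first_moment \<mu> \<longleftrightarrow>
     integrable \<mu> (\<lambda>g. ln (max (onorm (\<lambda>v. g *v v)) (onorm (\<lambda>v. matrix_inv g *v v))))"

definition msupport :: "('a::topological_space) measure \<Rightarrow> 'a set" where
  "msupport \<mu> = {g \<in> space \<mu>. \<forall>U. open U \<and> g \<in> U \<longrightarrow> emeasure \<mu> (U \<inter> space \<mu>) > 0}"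

inductive_set gen_semigroup ::
    "('k::{real_normed_field, euclidean_space} ^ 'n ^ 'n) measure \<Rightarrow> ('k ^ 'n ^ 'n) set"
  for \<mu> where
    base: "g \<in> msupport \<mu> \<Longrightarrow> g \<in> gen_semigroup \<mu>"
  | mult: "g \<in> gen_semigroup \<mu> \<Longrightarrow> h \<in> gen_semigroup \<mu> \<Longrightarrow> g ** h \<in> gen_semigroup \<mu>"

definition invariant_subspace ::
    "('k::{real_normed_field, euclidean_space} ^ 'n ^ 'n) measure \<Rightarrow> ('k ^ 'n) set \<Rightarrow> bool" where
  "invariant_subspace \<mu> W \<longleftrightarrow>
     vec.subspace W \<and> (\<forall>g \<in> gen_semigroup \<mu>. (\<lambda>v. g *v v) ` W \<subseteq> W)"

subsection \<open>Stationary and ergodic measures\<close>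

text \<open>
  Here \<open>act\<close> is the action and \<open>X\<close> provides the Borel space on which the measures live.
  The integral identity, for all nonnegative Borel \<open>f\<close>, is \<open>\<mu> * \<nu> = \<nu>\<close>. The action
  need only be defined on \<open>X\<close> for \<open>\<mu>\<close>-almost every \<open>g\<close>.
\<close>

definition stationary_measures ::
    "'g measure \<Rightarrow> ('g \<Rightarrow> 'p \<Rightarrow> 'p) \<Rightarrow> 'p measure \<Rightarrow> 'p measure set" where
  "stationary_measures \<mu> act X =
     {\<nu>. prob_space \<nu> \<and> sets \<nu> = sets X \<and>
         (\<forall>f :: 'p \<Rightarrow> ennreal. f \<in> borel_measurable X \<longrightarrow>
            (\<integral>\<^sup>+ x. (\<integral>\<^sup>+ g. f (act g x) \<partial>\<mu>) \<partial>\<nu>) = (\<integral>\<^sup>+ x. f x \<partial>\<nu>))}"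

definition ergodic_measures ::
    "'g measure \<Rightarrow> ('g \<Rightarrow> 'p \<Rightarrow> 'p) \<Rightarrow> 'p measure \<Rightarrow> 'p measure set" where
  "ergodic_measures \<mu> act X =
     {\<nu> \<in> stationary_measures \<mu> act X.
        \<forall>\<nu>1 \<in> stationary_measures \<mu> act X. \<forall>\<nu>2 \<in> stationary_measures \<mu> act X.
        \<forall>t :: real. 0 < t \<and> t < 1 \<and>
          (\<forall>A \<in> sets X. measure \<nu> A = t * measure \<nu>1 A + (1 - t) * measure \<nu>2 A)
          \<longrightarrow> \<nu>1 = \<nu> \<and> \<nu>2 = \<nu>}"

subsection \<open>Lyapunov exponents and the Furstenberg--Kifer--Hennion filtration\<close>

text \<open>The value does not depend on the nonzero vector chosen on the line.\<close>

definition log_expansion ::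
    "'k::{real_normed_field, euclidean_space} ^ 'n ^ 'n \<Rightarrow> ('k ^ 'n) set \<Rightarrow> real" where
  "log_expansion g L = (let v = SOME v. v \<in> L \<and> v \<noteq> 0 in ln (norm (g *v v) / norm v))"

lemma log_expansion_line:
  assumes "v \<noteq> 0"
  shows "log_expansion g (line v) = ln (norm (g *v v) / norm v)"
proof -
  define u where "u = (SOME u. u \<in> line v \<and> u \<noteq> 0)"
  have "v \<in> line v \<and> v \<noteq> 0"
    using assms by (simp add: line_def vec.span_base)
  then have u: "u \<in> line v \<and> u \<noteq> 0"
    unfolding u_def by (rule someI)
  then obtain c where c: "u = c *s v"
    by (auto simp: line_def vec.span_singleton)
  with u have "c \<noteq> 0" by auto
  have nrm: "norm (c *s w) = norm c * norm w" for w :: "'a ^ 'b"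
    by (simp add: norm_vec_def norm_mult L2_set_right_distrib)
  have "g *v u = c *s (g *v v)"
    by (simp add: c vec.scale)
  then show ?thesis
    using \<open>c \<noteq> 0\<close> unfolding log_expansion_def u_def[symmetric] Let_def
    by (simp add: c nrm)
qed

definition cocycle_average ::
    "('k::{real_normed_field, euclidean_space} ^ 'n ^ 'n) measure \<Rightarrow> ('k ^ 'n) set measure \<Rightarrow>
     real" where
  "cocycle_average \<mu> \<nu> = (\<integral> L. (\<integral> g. log_expansion g L \<partial>\<mu>) \<partial>\<nu>)"

text \<open>The left random walk \<open>L\<^sub>n = X\<^sub>n \<cdots> X\<^sub>1\<close>, where \<open>X\<^sub>n\<^sub>+\<^sub>1\<close> is \<open>x n\<close>.\<close>

primrec left_walk :: "(nat \<Rightarrow> 'k::field ^ 'n ^ 'n) \<Rightarrow> nat \<Rightarrow> 'k ^ 'n ^ 'n" where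
  "left_walk x 0 = mat 1"
| "left_walk x (Suc n) = x n ** left_walk x n"

definition onorm_on ::
    "('k::{real_normed_field, euclidean_space} ^ 'n) set \<Rightarrow> 'k ^ 'n ^ 'n \<Rightarrow> real" where
  "onorm_on W g = (SUP v \<in> W - {0}. norm (g *v v) / norm v)"

text \<open>
  The zero subspace is excluded since its top exponent is \<open>-\<infinity>\<close>, never a real number, whereas
  \<open>ln 0 = 0\<close> in HOL.
\<close>

definition has_top_lyapunov ::
    "('k::{real_normed_field, euclidean_space} ^ 'n ^ 'n) measure \<Rightarrow> ('k ^ 'n) set \<Rightarrow>
     real \<Rightarrow> bool" where
  "has_top_lyapunov \<mu> W l \<longleftrightarrow> W \<noteq> {0} \<and>
     (AE x in PiM UNIV (\<lambda>_::nat. \<mu>).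
        (\<lambda>n. ln (onorm_on W (left_walk x n)) / real n) \<longlonglongrightarrow> l)"

definition fkh_exponents ::
    "('k::{real_normed_field, euclidean_space} ^ 'n ^ 'n) measure \<Rightarrow> real set" where
  "fkh_exponents \<mu> = cocycle_average \<mu> ` ergodic_measures \<mu> proj_act proj_borel"

definition fkh_number ::
    "('k::{real_normed_field, euclidean_space} ^ 'n ^ 'n) measure \<Rightarrow> nat" where
  "fkh_number \<mu> = card (fkh_exponents \<mu>)"

text \<open>The \<open>i\<close>-th largest exponent, for \<open>1 \<le> i \<le> fkh_number \<mu>\<close>.\<close>

definition fkh_exponent ::
    "('k::{real_normed_field, euclidean_space} ^ 'n ^ 'n) measure \<Rightarrow> nat \<Rightarrow> real" where
  "fkh_exponent \<mu> i = rev (sorted_list_of_set (fkh_exponents \<mu>)) ! (i - 1)"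

definition fkh_space ::
    "('k::{real_normed_field, euclidean_space} ^ 'n ^ 'n) measure \<Rightarrow> nat \<Rightarrow> ('k ^ 'n) set" where
  "fkh_space \<mu> i =
     (if i \<in> {1..fkh_number \<mu>}
      then GREATEST W. invariant_subspace \<mu> W \<and> has_top_lyapunov \<mu> W (fkh_exponent \<mu> i)
      else {0})"

subsection \<open>Lifts\<close>

definition lifts ::
    "('k::{real_normed_field, euclidean_space} ^ 'n ^ 'n) measure \<Rightarrow> ('k ^ 'n) set \<Rightarrow>
     ('k ^ 'n) set \<Rightarrow> ('k ^ 'n) set set measure \<Rightarrow> ('k ^ 'n) set measure set" where
  "lifts \<mu> V' W \<nu>bar =
     {\<nu> \<in> stationary_measures \<mu> proj_act (restrict_space proj_borel (proj V' - proj W)).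
        distr \<nu> (quot_proj_borel V' W) (\<lambda>L. coset W ` L) = \<nu>bar}"

end

theory Submission
  imports Defs
begin

text \<open>
  Let \<open>slow b\<close> be the set of vectors \<open>v\<close> with \<open>limsup (1/n) ln |L\<^sub>n v| \<le> b\<close> almost surely. These sets
  are invariant subspaces, and they increase with \<open>b\<close>, so they jump at no more than \<open>dim V\<close> values of
  \<open>b\<close>. The whole filtration is read off from them.

  Let \<open>\<nu>\<close> be ergodic with cocycle average \<open>a\<close>. The skew product
  \<open>(x, \<omega>) \<mapsto> (\<omega>\<^sub>0 x, shift \<omega>)\<close> is ergodic for \<open>\<nu> \<otimes> \<mu>\<^sup>\<nat>\<close> because \<open>\<nu>\<close> is extremal (\<open>skew_ergodic\<close>), and
  \<open>ln |L\<^sub>n v|\<close> is, up to a constant, a Birkhoff sum over it. Hence almost every line \<open>[v]\<close> satisfies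
  \<open>(1/n) ln |L\<^sub>n v| \<longlonglongrightarrow> a\<close> (\<open>ergodic_growth\<close>), so \<open>v\<close> lies in \<open>slow a\<close> and in no \<open>slow b\<close> with
  \<open>b < a\<close>. Three conclusions follow. Every exponent is a jump of \<open>slow\<close>, so there are finitely
  many (\<open>finite_exponents\<close>). If \<open>b\<close> is an exponent, vectors that grow at the exact rate \<open>b\<close> exist, so
  the norm of \<open>L\<^sub>n\<close> on \<open>slow b\<close> grows at the rate \<open>b\<close> and \<open>slow b\<close> is the largest invariant subspace with
  that property; the \<open>i\<close>-th FKH space is \<open>slow \<beta>\<^sub>i\<close> (\<open>fkh_space_eq_slow\<close>). And \<open>\<nu>\<close> is carried by
  \<open>P(F\<^sub>i) \<setminus> P(F\<^sub>i\<^sub>+\<^sub>1)\<close> for the index \<open>i\<close> with \<open>\<beta>\<^sub>i = a\<close>.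

  Uniqueness of the lift (\<open>lift_unique\<close>) is a contraction argument. Vectors with the same image in
  \<open>P(F\<^sub>i/F\<^sub>i\<^sub>+\<^sub>1)\<close> differ, up to a scalar, by some \<open>w\<close> in \<open>F\<^sub>i\<^sub>+\<^sub>1\<close>. Under the walk \<open>w\<close> grows at a rate below \<open>a\<close>
  while the vectors grow at the rate \<open>a\<close>, so the two directions merge. By stationarity
  \<open>\<integral>f d\<nu> = \<integral>E f(L\<^sub>n x) d\<nu>(x)\<close> for every \<open>n\<close>; in the limit \<open>x\<close> can be replaced by the projection of \<open>x\<close>
  to a complement of \<open>F\<^sub>i\<^sub>+\<^sub>1\<close>, which is a function of the image of \<open>x\<close> in the quotient. So \<open>\<nu>\<close> is determined by its
  image.

  The image is ergodic (\<open>factor_ergodic\<close>): a stationary measure bounded by a multiple of it has a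
  density \<open>h\<close>, stationarity forces \<open>h(g y) = h(y)\<close> almost everywhere, and the pullback of \<open>h\<close> is an invariant
  function for \<open>\<nu>\<close>, hence constant.
\<close>

section \<open>Birkhoff's theorem for an ergodic transformation\<close>

definition birkhoff_sum :: "('a \<Rightarrow> 'a) \<Rightarrow> ('a \<Rightarrow> real) \<Rightarrow> nat \<Rightarrow> 'a \<Rightarrow> real" where
  "birkhoff_sum T f n z = (\<Sum>k<n. f ((T ^^ k) z))"

lemma birkhoff_sum_0 [simp]: "birkhoff_sum T f 0 z = 0"
  by (simp add: birkhoff_sum_def)

lemma birkhoff_sum_Suc: "birkhoff_sum T f (Suc n) z = f z + birkhoff_sum T f n (T z)"
  unfolding birkhoff_sum_def
  by (subst sum.lessThan_Suc_shift) (simp add: funpow_swap1)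

text \<open>The maximum of the Birkhoff sums \<open>S\<^sub>0, \<dots>, S\<^sub>n\<close>. The recursive form shows that
  \<open>M\<^sub>n\<^sub>+\<^sub>1 - M\<^sub>n \<circ> T = max (- M\<^sub>n \<circ> T) f\<close>, the identity on which the ergodic theorem rests.\<close>

primrec birkhoff_max :: "('a \<Rightarrow> 'a) \<Rightarrow> ('a \<Rightarrow> real) \<Rightarrow> nat \<Rightarrow> 'a \<Rightarrow> real" where
  "birkhoff_max T f 0 z = 0"
| "birkhoff_max T f (Suc n) z = max 0 (f z + birkhoff_max T f n (T z))"

lemma birkhoff_max_nonneg: "0 \<le> birkhoff_max T f n z"
  by (cases n) auto

lemma birkhoff_max_mono: "birkhoff_max T f n z \<le> birkhoff_max T f (Suc n) z"
proof (induction n arbitrary: z)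
  case (Suc n)
  from Suc[of "T z"] show ?case by auto
qed simp

lemma birkhoff_sum_le_max: "k \<le> n \<Longrightarrow> birkhoff_sum T f k z \<le> birkhoff_max T f n z"
proof (induction n arbitrary: z k)
  case (Suc n)
  show ?case
  proof (cases k)
    case (Suc j)
    then show ?thesis
      using Suc.IH[of j "T z"] Suc.prems by (auto simp: birkhoff_sum_Suc)
  qed simp
qed simp

text \<open>The points with unbounded sums form an invariant set. If it had full measure, then
  \<open>max (- M\<^sub>n \<circ> T) f\<close> would converge to \<open>f\<close> almost everywhere, dominated by \<open>|f|\<close>. But
  \<open>M\<^sub>n\<^sub>+\<^sub>1 - M\<^sub>n \<circ> T\<close> has nonnegative integral, since \<open>T\<close> preserves the measure and \<open>M\<^sub>n\<close> increases,
  whereas \<open>f\<close> has negative integral.\<close>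

lemma (in prob_space) birkhoff_sum_bounded_above:
  fixes f :: "'a \<Rightarrow> real"
  assumes T [measurable]: "T \<in> measurable M M" and T_inv: "distr M M T = M"
    and erg: "\<And>A. A \<in> sets M \<Longrightarrow> T -` A \<inter> space M = A \<Longrightarrow> prob A = 0 \<or> prob A = 1"
    and f: "integrable M f" and neg: "expectation f < 0"
  shows "AE z in M. \<exists>C. \<forall>n. birkhoff_sum T f n z \<le> C"
proof -
  have [measurable]: "f \<in> borel_measurable M" using f by simp
  have [measurable]: "(\<lambda>z. birkhoff_sum T f n z) \<in> borel_measurable M" for n
    by (induction n) (simp_all add: birkhoff_sum_Suc[abs_def])
  have [measurable]: "(\<lambda>z. birkhoff_max T f n z) \<in> borel_measurable M" for n
    by (induction n) simp_all
  have int_T: "integrable M (\<lambda>z. h (T z)) \<longleftrightarrow> integrable M h"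
    and integral_T: "expectation (\<lambda>z. h (T z)) = expectation h"
    if [measurable]: "h \<in> borel_measurable M" for h :: "'a \<Rightarrow> real"
    using integrable_distr_eq[OF T, of h] integral_distr[OF T, of h] T_inv by auto
  have int_max: "integrable M (birkhoff_max T f n)" for n
  proof (induction n)
    case (Suc n)
    have "integrable M (\<lambda>z. max 0 (f z + birkhoff_max T f n (T z)))"
      using Suc by (intro integrable_max Bochner_Integration.integrable_add f integrable_zero)
        (simp add: int_T)
    then show ?case by simp
  qed simp
  define A where "A = {z \<in> space M. \<forall>C::nat. \<exists>n. real C < birkhoff_sum T f n z}"
  have unbounded_iff: "(\<forall>C::nat. \<exists>n. real C < s n) \<longleftrightarrow> \<not> (\<exists>C. \<forall>n. s n \<le> C)" for s :: "nat \<Rightarrow> real"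
    by (meson linorder_not_le order_trans reals_Archimedean2 less_imp_le)
  have A_sets: "A \<in> sets M" unfolding A_def by measurable
  have bounded_T: "(\<exists>C. \<forall>n. birkhoff_sum T f n (T z) \<le> C) \<longleftrightarrow> (\<exists>C. \<forall>n. birkhoff_sum T f n z \<le> C)" for z
  proof
    assume "\<exists>C. \<forall>n. birkhoff_sum T f n (T z) \<le> C"
    then obtain C where C: "\<And>n. birkhoff_sum T f n (T z) \<le> C" by auto
    have "birkhoff_sum T f n z \<le> max 0 (f z + C)" for n
      using C by (cases n) (auto simp: birkhoff_sum_Suc le_max_iff_disj)
    then show "\<exists>C. \<forall>n. birkhoff_sum T f n z \<le> C" by blast
  next
    assume "\<exists>C. \<forall>n. birkhoff_sum T f n z \<le> C"
    then obtain C where C: "\<And>n. birkhoff_sum T f n z \<le> C" by auto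
    have "birkhoff_sum T f n (T z) \<le> C - f z" for n
      using C[of "Suc n"] by (auto simp: birkhoff_sum_Suc)
    then show "\<exists>C. \<forall>n. birkhoff_sum T f n (T z) \<le> C" by blast
  qed
  have "T z \<in> A \<longleftrightarrow> z \<in> A" if "z \<in> space M" for z
    using measurable_space[OF T that] that by (simp only: A_def unbounded_iff bounded_T mem_Collect_eq)
  then have "T -` A \<inter> space M = A"
    using sets.sets_into_space[OF A_sets] by auto
  then consider "prob A = 0" | "prob A = 1" using erg A_sets by blast
  then show ?thesis
  proof cases
    case 1
    then have "AE z in M. z \<notin> A"
      using A_sets by (simp add: prob_eq_0)
    then show ?thesis
      by (rule AE_mp) (auto simp: A_def unbounded_iff)
  next
    case 2
    define D where "D n z = birkhoff_max T f (Suc n) z - birkhoff_max T f n (T z)" for n z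
    have D_eq: "D n z = max (- birkhoff_max T f n (T z)) (f z)" for n z
      by (auto simp: D_def)
    have "AE z in M. z \<in> A" using 2 A_sets by (simp add: prob_eq_1)
    then have lim: "AE z in M. (\<lambda>n. D n z) \<longlonglongrightarrow> f z"
    proof (rule AE_mp, intro AE_I2 impI)
      fix z assume "z \<in> space M" "z \<in> A"
      then have "T z \<in> A" using \<open>T -` A \<inter> space M = A\<close> by auto
      obtain C :: nat where C: "\<bar>f z\<bar> < real C" using reals_Archimedean2 by blast
      obtain N where "real C < birkhoff_sum T f N (T z)"
        using \<open>T z \<in> A\<close> unfolding A_def by blast
      with C have N: "\<bar>f z\<bar> < birkhoff_sum T f N (T z)" by simp
      have "D n z = f z" if "N \<le> n" for n
        using N birkhoff_sum_le_max[OF that, of T f "T z"] unfolding D_eq by linarith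
      then show "(\<lambda>n. D n z) \<longlonglongrightarrow> f z"
        by (intro tendsto_eventually) (auto simp: eventually_sequentially)
    qed
    have "(\<lambda>n. expectation (D n)) \<longlonglongrightarrow> expectation f"
    proof (rule integral_dominated_convergence[where w = "\<lambda>z. \<bar>f z\<bar>"])
      show "D n \<in> borel_measurable M" for n unfolding D_def by measurable
      show "AE z in M. norm (D n z) \<le> \<bar>f z\<bar>" for n
      proof (rule AE_I2)
        fix z show "norm (D n z) \<le> \<bar>f z\<bar>"
          using birkhoff_max_nonneg[of T f n "T z"] unfolding D_eq by (simp add: max_def abs_if)
      qed
    qed (use f lim in auto)
    moreover have "0 \<le> expectation (D n)" for n
    proof -
      have "expectation (D n) =
          expectation (birkhoff_max T f (Suc n)) - expectation (\<lambda>z. birkhoff_max T f n (T z))"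
        unfolding D_def using int_max[of "Suc n"] int_max[of n] int_T[of "birkhoff_max T f n"]
        by (intro Bochner_Integration.integral_diff) (simp_all del: birkhoff_max.simps)
      also have "\<dots> = expectation (birkhoff_max T f (Suc n)) - expectation (birkhoff_max T f n)"
        by (simp add: integral_T)
      also have "\<dots> \<ge> 0"
        using integral_mono[OF int_max[of n] int_max[of "Suc n"] birkhoff_max_mono]
        by (simp del: birkhoff_max.simps)
      finally show ?thesis .
    qed
    ultimately have "0 \<le> expectation f"
      by (intro LIMSEQ_le_const) auto
    with neg show ?thesis by simp
  qed
qed

lemma birkhoff_sum_add_const:
  "birkhoff_sum T (\<lambda>z. f z + c) n z = birkhoff_sum T f n z + real n * c"
  by (simp add: birkhoff_sum_def sum.distrib)

lemma birkhoff_sum_minus: "birkhoff_sum T (\<lambda>z. - f z) n z = - birkhoff_sum T f n z"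
  by (simp add: birkhoff_sum_def sum_negf)

text \<open>Subtracting from \<open>f\<close> a constant \<open>b\<close> strictly between its mean and \<open>a\<close> makes the mean negative, so
  the sums of \<open>f\<close> stay below \<open>n b\<close> up to a constant.\<close>

lemma (in prob_space) birkhoff_average_eventually_less:
  fixes f :: "'a \<Rightarrow> real"
  assumes T: "T \<in> measurable M M" "distr M M T = M"
    and erg: "\<And>A. A \<in> sets M \<Longrightarrow> T -` A \<inter> space M = A \<Longrightarrow> prob A = 0 \<or> prob A = 1"
    and f: "integrable M f" and a: "expectation f < a"
  shows "AE z in M. \<forall>\<^sub>F n in sequentially. birkhoff_sum T f n z / n < a"
proof -
  define b where "b = (expectation f + a) / 2"
  have b: "expectation f < b" "b < a" using a by (auto simp: b_def)
  have "AE z in M. \<exists>C. \<forall>n. birkhoff_sum T (\<lambda>z. f z + - b) n z \<le> C"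
    using f b by (intro birkhoff_sum_bounded_above T erg) (auto simp: prob_space)
  then show ?thesis
  proof (rule AE_mp, intro AE_I2 impI)
    fix z assume "\<exists>C. \<forall>n. birkhoff_sum T (\<lambda>z. f z + - b) n z \<le> C"
    then obtain C where C: "\<And>n. birkhoff_sum T f n z \<le> C + real n * b"
      unfolding birkhoff_sum_add_const by (metis add_uminus_conv_diff diff_le_eq mult_minus_right)
    obtain N :: nat where N: "\<bar>C\<bar> / (a - b) < real N" using reals_Archimedean2 by blast
    have "birkhoff_sum T f n z / n < a" if "n > N" for n
    proof -
      have "\<bar>C\<bar> / (a - b) < real n" using N that by (meson less_trans of_nat_less_iff)
      then have "\<bar>C\<bar> < real n * (a - b)" using b by (simp add: pos_divide_less_eq)
      then have "birkhoff_sum T f n z < real n * a" using C[of n] by (simp add: algebra_simps)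
      then show ?thesis using that by (simp add: pos_divide_less_eq mult.commute)
    qed
    then show "\<forall>\<^sub>F n in sequentially. birkhoff_sum T f n z / n < a"
      by (auto simp: eventually_sequentially intro!: exI[of _ "Suc N"])
  qed
qed

lemma (in prob_space) birkhoff_ergodic:
  fixes f :: "'a \<Rightarrow> real"
  assumes T: "T \<in> measurable M M" "distr M M T = M"
    and erg: "\<And>A. A \<in> sets M \<Longrightarrow> T -` A \<inter> space M = A \<Longrightarrow> prob A = 0 \<or> prob A = 1"
    and f: "integrable M f"
  shows "AE z in M. (\<lambda>n. birkhoff_sum T f n z / n) \<longlonglongrightarrow> expectation f"
proof -
  let ?e = "\<lambda>m::nat. 1 / real (Suc m)"
  have "AE z in M. \<forall>m. (\<forall>\<^sub>F n in sequentially. birkhoff_sum T f n z / n < expectation f + ?e m) \<and>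
      (\<forall>\<^sub>F n in sequentially. birkhoff_sum T (\<lambda>z. - f z) n z / n < - expectation f + ?e m)"
    unfolding AE_all_countable
    using f by (intro allI AE_conjI birkhoff_average_eventually_less T erg) auto
  then show ?thesis
  proof (rule AE_mp, intro AE_I2 impI)
    fix z
    assume *: "\<forall>m. (\<forall>\<^sub>F n in sequentially. birkhoff_sum T f n z / n < expectation f + ?e m) \<and>
      (\<forall>\<^sub>F n in sequentially. birkhoff_sum T (\<lambda>z. - f z) n z / n < - expectation f + ?e m)"
    show "(\<lambda>n. birkhoff_sum T f n z / n) \<longlonglongrightarrow> expectation f"
    proof (rule tendstoI)
      fix r :: real assume "0 < r"
      then obtain m where m: "?e m < r" using nat_approx_posE by metis
      have "\<forall>\<^sub>F n in sequentially. birkhoff_sum T f n z / n < expectation f + ?e m"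
        "\<forall>\<^sub>F n in sequentially. birkhoff_sum T (\<lambda>z. - f z) n z / n < - expectation f + ?e m"
        using * by auto
      then show "\<forall>\<^sub>F n in sequentially. dist (birkhoff_sum T f n z / n) (expectation f) < r"
        by eventually_elim (use m in \<open>auto simp: birkhoff_sum_minus dist_real_def abs_if\<close>)
    qed
  qed
qed

section \<open>Stationary measures and the skew product\<close>

locale random_action = prob_space \<mu> for \<mu> :: "'g measure" +
  fixes X :: "'p measure" and act :: "'g \<Rightarrow> 'p \<Rightarrow> 'p"
  assumes act_measurable: "(\<lambda>(x, g). act g x) \<in> X \<Otimes>\<^sub>M \<mu> \<rightarrow>\<^sub>M X"
begin

lemma act_measurable_compose [measurable (raw)]:
  assumes "a \<in> N \<rightarrow>\<^sub>M X" "g \<in> N \<rightarrow>\<^sub>M \<mu>"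
  shows "(\<lambda>z. act (g z) (a z)) \<in> N \<rightarrow>\<^sub>M X"
  using measurable_compose[OF measurable_Pair[OF assms] act_measurable] by simp

abbreviation increments :: "(nat \<Rightarrow> 'g) measure" where
  "increments \<equiv> PiM UNIV (\<lambda>_::nat. \<mu>)"

sublocale increments: sequence_space \<mu> ..

sublocale increments: prob_space increments
  by (intro prob_space_PiM prob_space_axioms)

lemma space_increments: "\<omega> \<in> space increments \<longleftrightarrow> (\<forall>n. \<omega> n \<in> space \<mu>)"
  by (auto simp: space_PiM PiE_iff)

lemma shift_measurable [measurable]: "(\<lambda>\<omega> n. \<omega> (Suc n)) \<in> increments \<rightarrow>\<^sub>M increments"
  by (rule measurable_PiM_single') (auto simp: space_PiM PiE_iff)

text \<open>The first increment and the following ones are independent, and the latter are again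
  distributed as the whole sequence.\<close>

lemma nn_integral_increments:
  assumes [measurable]: "f \<in> borel_measurable increments"
  shows "(\<integral>\<^sup>+\<omega>. f \<omega> \<partial>increments) = (\<integral>\<^sup>+g. \<integral>\<^sup>+\<omega>. f (case_nat g \<omega>) \<partial>increments \<partial>\<mu>)"
proof -
  have "(\<integral>\<^sup>+\<omega>. f \<omega> \<partial>increments) =
      (\<integral>\<^sup>+\<omega>. f \<omega> \<partial>distr (\<mu> \<Otimes>\<^sub>M increments) increments (\<lambda>(g, \<omega>). case_nat g \<omega>))"
    by (subst increments.PiM_iter) simp
  also have "\<dots> = (\<integral>\<^sup>+(g, \<omega>). f (case_nat g \<omega>) \<partial>(\<mu> \<Otimes>\<^sub>M increments))"
    by (subst nn_integral_distr) (auto simp: split_beta')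
  also have "\<dots> = (\<integral>\<^sup>+g. \<integral>\<^sup>+\<omega>. f (case_nat g \<omega>) \<partial>increments \<partial>\<mu>)"
    by (subst increments.nn_integral_fst[symmetric]) auto
  finally show ?thesis .
qed

lemma AE_increments_case_nat:
  assumes "AE \<omega> in increments. P \<omega>"
  shows "AE g in \<mu>. AE \<omega> in increments. P (case_nat g \<omega>)"
proof -
  interpret pair_sigma_finite \<mu> increments ..
  have "AE \<omega> in distr (\<mu> \<Otimes>\<^sub>M increments) increments (\<lambda>(g, \<omega>). case_nat g \<omega>). P \<omega>"
    using assms by (subst increments.PiM_iter)
  then have "AE z in \<mu> \<Otimes>\<^sub>M increments. P (case z of (g, \<omega>) \<Rightarrow> case_nat g \<omega>)"
    by (rule AE_distrD[rotated]) measurable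
  from AE_pair[OF this] show ?thesis by simp
qed

abbreviation stationary :: "'p measure \<Rightarrow> bool" where
  "stationary \<nu> \<equiv> \<nu> \<in> stationary_measures \<mu> act X"

lemma stationaryD:
  assumes "stationary \<nu>"
  shows "prob_space \<nu>" "sets \<nu> = sets X" "space \<nu> = space X"
    and "\<And>f :: _ \<Rightarrow> ennreal. f \<in> borel_measurable X \<Longrightarrow>
      (\<integral>\<^sup>+ x. \<integral>\<^sup>+ g. f (act g x) \<partial>\<mu> \<partial>\<nu>) = (\<integral>\<^sup>+ x. f x \<partial>\<nu>)"
  using assms sets_eq_imp_space_eq[of \<nu> X] by (auto simp: stationary_measures_def)

lemma distr_stationary:
  assumes "stationary \<nu>"
  shows "distr (\<nu> \<Otimes>\<^sub>M \<mu>) \<nu> (\<lambda>(x, g). act g x) = \<nu>"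
proof (rule measure_eqI)
  note \<nu> = stationaryD[OF assms]
  have [measurable_cong]: "sets \<nu> = sets X" by fact
  fix A assume "A \<in> sets (distr (\<nu> \<Otimes>\<^sub>M \<mu>) \<nu> (\<lambda>(x, g). act g x))"
  then have [measurable]: "A \<in> sets X" using \<nu> by simp
  have "emeasure (distr (\<nu> \<Otimes>\<^sub>M \<mu>) \<nu> (\<lambda>(x, g). act g x)) A =
      (\<integral>\<^sup>+y. indicator A y \<partial>distr (\<nu> \<Otimes>\<^sub>M \<mu>) \<nu> (\<lambda>(x, g). act g x))"
    using \<nu> by simp
  also have "\<dots> = (\<integral>\<^sup>+(x, g). indicator A (act g x) \<partial>(\<nu> \<Otimes>\<^sub>M \<mu>))"
    by (subst nn_integral_distr) (auto simp: split_beta')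
  also have "\<dots> = (\<integral>\<^sup>+x. \<integral>\<^sup>+g. indicator A (act g x) \<partial>\<mu> \<partial>\<nu>)"
    by (subst nn_integral_fst[symmetric]) auto
  also have "\<dots> = emeasure \<nu> A"
    using \<nu> by simp
  finally show "emeasure (distr (\<nu> \<Otimes>\<^sub>M \<mu>) \<nu> (\<lambda>(x, g). act g x)) A = emeasure \<nu> A" .
qed simp

lemma AE_stationary_act:
  assumes "stationary \<nu>" "AE x in \<nu>. P x"
  shows "AE x in \<nu>. AE g in \<mu>. P (act g x)"
proof -
  note \<nu> = stationaryD[OF assms(1)]
  have [measurable_cong]: "sets \<nu> = sets X" by fact
  interpret \<nu>: prob_space \<nu> by fact
  interpret pair_sigma_finite \<nu> \<mu> ..
  have "AE x in distr (\<nu> \<Otimes>\<^sub>M \<mu>) \<nu> (\<lambda>(x, g). act g x). P x"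
    using assms by (subst distr_stationary) auto
  then have "AE z in \<nu> \<Otimes>\<^sub>M \<mu>. P (case z of (x, g) \<Rightarrow> act g x)"
    by (rule AE_distrD[rotated]) measurable
  from AE_pair[OF this] show ?thesis by simp
qed

text \<open>Expand the square: by stationarity \<open>\<integral>\<integral>(h(g x) - h(x))\<^sup>2\<close> equals \<open>2\<integral>h\<^sup>2\<close> minus twice the
  correlation. This is how both harmonic functions and stationary densities are shown to be
  invariant.\<close>

lemma invariant_of_correlation:
  fixes h :: "'p \<Rightarrow> real"
  assumes "stationary \<nu>" and h [measurable]: "h \<in> borel_measurable X"
    and h01: "\<And>x. 0 \<le> h x" "\<And>x. h x \<le> 1"
    and corr: "(\<integral>\<^sup>+x. \<integral>\<^sup>+g. ennreal (h x * h (act g x)) \<partial>\<mu> \<partial>\<nu>) = (\<integral>\<^sup>+x. ennreal ((h x)\<^sup>2) \<partial>\<nu>)"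
  shows "AE x in \<nu>. AE g in \<mu>. h (act g x) = h x"
proof -
  note \<nu> = stationaryD[OF assms(1)]
  have [measurable_cong]: "sets \<nu> = sets X" by fact
  interpret \<nu>: prob_space \<nu> by fact
  interpret P: pair_prob_space \<nu> \<mu> ..
  let ?N = "\<nu> \<Otimes>\<^sub>M \<mu>"
  let ?a = "(\<integral>\<^sup>+x. ennreal ((h x)\<^sup>2) \<partial>\<nu>)"
  have a_fin: "?a < \<top>"
  proof -
    have "?a \<le> (\<integral>\<^sup>+x. 1 \<partial>\<nu>)"
      using h01 by (intro nn_integral_mono) (simp add: power_le_one)
    then show ?thesis by (simp add: \<nu>.emeasure_space_1 le_less_trans)
  qed
  have fst: "(\<integral>\<^sup>+z. k z \<partial>?N) = (\<integral>\<^sup>+x. \<integral>\<^sup>+g. k (x, g) \<partial>\<mu> \<partial>\<nu>)"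
    if "k \<in> borel_measurable ?N" for k
    using nn_integral_fst[OF that] by simp
  have corr2: "(\<integral>\<^sup>+x. \<integral>\<^sup>+g. 2 * ennreal (h x * h (act g x)) \<partial>\<mu> \<partial>\<nu>) = 2 * ?a"
  proof -
    have "(\<integral>\<^sup>+x. \<integral>\<^sup>+g. 2 * ennreal (h x * h (act g x)) \<partial>\<mu> \<partial>\<nu>) =
        (\<integral>\<^sup>+x. 2 * (\<integral>\<^sup>+g. ennreal (h x * h (act g x)) \<partial>\<mu>) \<partial>\<nu>)"
    proof (rule nn_integral_cong)
      fix x assume "x \<in> space \<nu>"
      then have [measurable]: "x \<in> space X" using \<nu> by simp
      show "(\<integral>\<^sup>+g. 2 * ennreal (h x * h (act g x)) \<partial>\<mu>) = 2 * (\<integral>\<^sup>+g. ennreal (h x * h (act g x)) \<partial>\<mu>)"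
        by (rule nn_integral_cmult) measurable
    qed
    also have "\<dots> = 2 * (\<integral>\<^sup>+x. \<integral>\<^sup>+g. ennreal (h x * h (act g x)) \<partial>\<mu> \<partial>\<nu>)"
      by (rule nn_integral_cmult) measurable
    finally show ?thesis by (simp add: corr)
  qed
  \<comment> \<open>The square is expanded in the extended nonnegative reals, so the cross term is moved to the left.\<close>
  have sq: "(\<integral>\<^sup>+(x, g). ennreal ((h (act g x) - h x)\<^sup>2) \<partial>?N) + 2 * ?a = 2 * ?a"
  proof -
    have "(\<integral>\<^sup>+(x, g). ennreal ((h (act g x) - h x)\<^sup>2) \<partial>?N) + 2 * ?a =
        (\<integral>\<^sup>+(x, g). ennreal ((h (act g x) - h x)\<^sup>2) \<partial>?N) +
        (\<integral>\<^sup>+(x, g). 2 * ennreal (h x * h (act g x)) \<partial>?N)"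
      by (simp add: fst case_prod_beta corr2)
    also have "\<dots> = (\<integral>\<^sup>+(x, g). ennreal ((h (act g x) - h x)\<^sup>2) + 2 * ennreal (h x * h (act g x)) \<partial>?N)"
      unfolding case_prod_beta by (subst nn_integral_add) auto
    also have "\<dots> = (\<integral>\<^sup>+(x, g). ennreal ((h (act g x))\<^sup>2) + ennreal ((h x)\<^sup>2) \<partial>?N)"
    proof (rule nn_integral_cong, clarify)
      fix x g
      have "ennreal ((h (act g x) - h x)\<^sup>2) + 2 * ennreal (h x * h (act g x)) =
          ennreal ((h (act g x) - h x)\<^sup>2) + ennreal (2 * (h x * h (act g x)))"
        using h01 by (simp add: ennreal_mult)
      also have "\<dots> = ennreal ((h (act g x) - h x)\<^sup>2 + 2 * (h x * h (act g x)))"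
        using h01 by (intro ennreal_plus[symmetric]) auto
      also have "(h (act g x) - h x)\<^sup>2 + 2 * (h x * h (act g x)) = (h (act g x))\<^sup>2 + (h x)\<^sup>2"
        by (simp add: power2_eq_square algebra_simps)
      finally show "ennreal ((h (act g x) - h x)\<^sup>2) + 2 * ennreal (h x * h (act g x)) =
          ennreal ((h (act g x))\<^sup>2) + ennreal ((h x)\<^sup>2)" by simp
    qed
    also have "\<dots> = (\<integral>\<^sup>+x. \<integral>\<^sup>+g. ennreal ((h (act g x))\<^sup>2) \<partial>\<mu> \<partial>\<nu>) + ?a"
      unfolding case_prod_beta by (subst nn_integral_add) (auto simp: fst emeasure_space_1 P.emeasure_space_1)
    also have "\<dots> = ?a + ?a" by (subst \<nu>(4)[of "\<lambda>x. ennreal ((h x)\<^sup>2)"]) auto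
    finally show ?thesis by (simp add: mult_2)
  qed
  have "(\<integral>\<^sup>+(x, g). ennreal ((h (act g x) - h x)\<^sup>2) \<partial>?N) = 0"
  proof -
    have "2 * ?a \<noteq> \<top>" using a_fin by (simp add: ennreal_mult_eq_top_iff)
    moreover have "2 * ?a + (\<integral>\<^sup>+(x, g). ennreal ((h (act g x) - h x)\<^sup>2) \<partial>?N) = 2 * ?a + 0"
      using sq by (simp add: add.commute)
    ultimately show ?thesis by (simp only: ennreal_add_left_cancel infinity_ennreal_def simp_thms)
  qed
  then have "AE z in ?N. h (act (snd z) (fst z)) = h (fst z)"
    by (subst (asm) nn_integral_0_iff_AE) (auto simp: case_prod_beta ennreal_eq_0_iff)
  from P.AE_pair[OF this] show ?thesis by simp
qed

text \<open>An invariant factor \<open>k(x)\<close> may be replaced by \<open>k(g x)\<close> inside the inner integral, where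
  stationarity of \<open>\<nu>\<close> applies to the product \<open>k f\<close>.\<close>

lemma stationary_density:
  fixes k :: "'p \<Rightarrow> real"
  assumes "stationary \<nu>" and k [measurable]: "k \<in> borel_measurable X"
    and nonneg: "\<And>x. 0 \<le> k x" and one: "(\<integral>\<^sup>+x. k x \<partial>\<nu>) = 1"
    and inv: "AE x in \<nu>. AE g in \<mu>. k (act g x) = k x"
  shows "stationary (density \<nu> k)"
proof -
  note \<nu> = stationaryD[OF assms(1)]
  have [measurable_cong]: "sets \<nu> = sets X" by fact
  have "(\<integral>\<^sup>+ x. \<integral>\<^sup>+ g. f (act g x) \<partial>\<mu> \<partial>density \<nu> k) = (\<integral>\<^sup>+ x. f x \<partial>density \<nu> k)"
    if [measurable]: "f \<in> borel_measurable X" for f :: "'p \<Rightarrow> ennreal"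
  proof -
    have "(\<integral>\<^sup>+ x. \<integral>\<^sup>+ g. f (act g x) \<partial>\<mu> \<partial>density \<nu> k) =
        (\<integral>\<^sup>+ x. ennreal (k x) * (\<integral>\<^sup>+ g. f (act g x) \<partial>\<mu>) \<partial>\<nu>)"
      by (rule nn_integral_density) measurable
    also have "\<dots> = (\<integral>\<^sup>+ x. \<integral>\<^sup>+ g. ennreal (k (act g x)) * f (act g x) \<partial>\<mu> \<partial>\<nu>)"
    proof (rule nn_integral_cong_AE, use inv AE_space[of \<nu>] in eventually_elim)
      case (elim x)
      then have [measurable]: "x \<in> space X" using \<nu>(3) by simp
      have "ennreal (k x) * (\<integral>\<^sup>+ g. f (act g x) \<partial>\<mu>) = (\<integral>\<^sup>+ g. ennreal (k x) * f (act g x) \<partial>\<mu>)"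
        by (rule nn_integral_cmult[symmetric]) measurable
      also have "\<dots> = (\<integral>\<^sup>+ g. ennreal (k (act g x)) * f (act g x) \<partial>\<mu>)"
        by (rule nn_integral_cong_AE, use elim(1) in eventually_elim) simp
      finally show ?case .
    qed
    also have "\<dots> = (\<integral>\<^sup>+ x. ennreal (k x) * f x \<partial>\<nu>)"
      by (rule \<nu>(4)) measurable
    also have "\<dots> = (\<integral>\<^sup>+ x. f x \<partial>density \<nu> k)"
      by (rule nn_integral_density[symmetric]) measurable
    finally show ?thesis .
  qed
  moreover have "prob_space (density \<nu> k)"
    using one by (intro prob_spaceI) (simp add: emeasure_density cong: nn_integral_cong_simp)
  ultimately show ?thesis
    using \<nu> by (simp add: stationary_measures_def)
qed

text \<open>If the mean \<open>c\<close> of \<open>h\<close> is neither 0 nor 1, then \<open>\<nu>\<close> is the convex combination, with weights \<open>c\<close> and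
  \<open>1 - c\<close>, of the stationary measures with densities \<open>h / c\<close> and \<open>(1 - h) / (1 - c)\<close>. Extremality
  makes the densities constant.\<close>

lemma ergodic_invariant_AE_const:
  fixes h :: "'p \<Rightarrow> real"
  assumes erg: "\<nu> \<in> ergodic_measures \<mu> act X" and h [measurable]: "h \<in> borel_measurable X"
    and h01: "\<And>x. 0 \<le> h x" "\<And>x. h x \<le> 1"
    and inv: "AE x in \<nu>. AE g in \<mu>. h (act g x) = h x"
  shows "\<exists>c\<in>{0..1}. AE x in \<nu>. h x = c"
proof -
  have stat: "stationary \<nu>" using erg by (simp add: ergodic_measures_def)
  note \<nu> = stationaryD[OF stat]
  have [measurable_cong]: "sets \<nu> = sets X" by fact
  interpret \<nu>: prob_space \<nu> by fact
  define c where "c = \<nu>.expectation h"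
  have int: "integrable \<nu> h"
    by (rule \<nu>.integrable_const_bound[where B = 1]) (use h01 in auto)
  have nn: "(\<integral>\<^sup>+x. ennreal (h x) \<partial>\<nu>) = ennreal c"
    unfolding c_def using h01 int by (intro nn_integral_eq_integral) auto
  have nn': "(\<integral>\<^sup>+x. ennreal (1 - h x) \<partial>\<nu>) = ennreal (1 - c)"
    unfolding c_def using h01 int by (subst nn_integral_eq_integral) (auto simp: \<nu>.prob_space)
  have c01: "0 \<le> c" "c \<le> 1"
    unfolding c_def using h01 int \<nu>.integral_le_const[OF int, of 1] by (auto intro: integral_nonneg)
  consider "c = 0" | "c = 1" | "0 < c" "c < 1" using c01 by linarith
  then show ?thesis
  proof cases
    case 1
    then have "AE x in \<nu>. h x = 0"
      using nn h01 by (auto simp: nn_integral_0_iff_AE ennreal_eq_0_iff antisym)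
    then show ?thesis by force
  next
    case 2
    then have "AE x in \<nu>. 1 - h x \<le> 0"
      using nn' by (auto simp: nn_integral_0_iff_AE ennreal_eq_0_iff)
    then have "AE x in \<nu>. h x = 1" by eventually_elim (use h01 in \<open>auto intro: antisym\<close>)
    then show ?thesis by force
  next
    case 3
    define k1 where "k1 x = h x / c" for x
    define k2 where "k2 x = (1 - h x) / (1 - c)" for x
    have [measurable]: "k1 \<in> borel_measurable X" "k2 \<in> borel_measurable X"
      unfolding k1_def k2_def by measurable
    have k_nn: "0 \<le> k1 x" "0 \<le> k2 x" for x using 3 h01[of x] by (auto simp: k1_def k2_def)
    have "(\<integral>\<^sup>+x. ennreal (k1 x) \<partial>\<nu>) = (\<integral>\<^sup>+x. ennreal (h x) \<partial>\<nu>) / ennreal c"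
      using 3 h01 by (simp add: k1_def divide_ennreal[symmetric] nn_integral_divide)
    then have one1: "(\<integral>\<^sup>+x. ennreal (k1 x) \<partial>\<nu>) = 1"
      using 3 by (simp add: nn divide_ennreal)
    have "(\<integral>\<^sup>+x. ennreal (k2 x) \<partial>\<nu>) = (\<integral>\<^sup>+x. ennreal (1 - h x) \<partial>\<nu>) / ennreal (1 - c)"
      using 3 h01 by (simp add: k2_def divide_ennreal[symmetric] nn_integral_divide)
    then have one2: "(\<integral>\<^sup>+x. ennreal (k2 x) \<partial>\<nu>) = 1"
      using 3 by (simp add: nn' divide_ennreal)
    have "AE x in \<nu>. AE g in \<mu>. k1 (act g x) = k1 x" "AE x in \<nu>. AE g in \<mu>. k2 (act g x) = k2 x"
      unfolding k1_def k2_def using inv by (auto elim!: eventually_mono)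
    then have s1: "stationary (density \<nu> k1)" and s2: "stationary (density \<nu> k2)"
      using one1 one2 k_nn by (auto intro!: stationary_density stat)
    have "measure \<nu> A = c * measure (density \<nu> k1) A + (1 - c) * measure (density \<nu> k2) A"
      if "A \<in> sets X" for A
    proof -
      have [measurable]: "A \<in> sets \<nu>" using that \<nu> by simp
      have "ennreal c * emeasure (density \<nu> k1) A + ennreal (1 - c) * emeasure (density \<nu> k2) A =
         (\<integral>\<^sup>+x. ennreal c * (ennreal (k1 x) * indicator A x) +
            ennreal (1 - c) * (ennreal (k2 x) * indicator A x) \<partial>\<nu>)"
        using 3 by (subst nn_integral_add) (auto simp: emeasure_density nn_integral_cmult)
      also have "\<dots> = (\<integral>\<^sup>+x. indicator A x \<partial>\<nu>)"
      proof (intro nn_integral_cong)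
        fix x
        have "ennreal c * ennreal (k1 x) + ennreal (1 - c) * ennreal (k2 x) =
            ennreal (c * k1 x + (1 - c) * k2 x)"
          using 3 k_nn[of x] by (simp add: ennreal_mult'[symmetric] ennreal_plus[symmetric] del: ennreal_plus)
        also have "c * k1 x + (1 - c) * k2 x = 1" using 3 by (simp add: k1_def k2_def)
        finally show "ennreal c * (ennreal (k1 x) * indicator A x) +
            ennreal (1 - c) * (ennreal (k2 x) * indicator A x) = indicator A x"
          by (auto split: split_indicator)
      qed
      also have "\<dots> = emeasure \<nu> A" by simp
      finally have *: "ennreal c * emeasure (density \<nu> k1) A + ennreal (1 - c) * emeasure (density \<nu> k2) A
         = emeasure \<nu> A" .
      interpret d1: prob_space "density \<nu> k1" using s1 by (rule stationaryD)
      interpret d2: prob_space "density \<nu> k2" using s2 by (rule stationaryD)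
      from * show ?thesis
        using 3 by (simp add: d1.emeasure_eq_measure d2.emeasure_eq_measure \<nu>.emeasure_eq_measure
          ennreal_mult'[symmetric] ennreal_plus[symmetric] del: ennreal_plus)
    qed
    then have "density \<nu> k1 = \<nu>"
      using erg s1 s2 3 unfolding ergodic_measures_def by blast
    then have "density \<nu> k1 = density \<nu> (\<lambda>x. 1)" by (simp add: density_1)
    then have "AE x in \<nu>. ennreal (k1 x) = 1"
      by (subst (asm) \<nu>.density_unique_iff) auto
    then have "AE x in \<nu>. h x = c"
      by eventually_elim (use 3 in \<open>auto simp: k1_def\<close>)
    then show ?thesis using c01 by auto
  qed
qed

text \<open>One step of the walk started at a point, recorded together with the increments still to come.\<close>

definition skew :: "'p \<times> (nat \<Rightarrow> 'g) \<Rightarrow> 'p \<times> (nat \<Rightarrow> 'g)" where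
  "skew z = (act (snd z 0) (fst z), \<lambda>n. snd z (Suc n))"

lemma skew_measurable [measurable]: "skew \<in> X \<Otimes>\<^sub>M increments \<rightarrow>\<^sub>M X \<Otimes>\<^sub>M increments"
  unfolding skew_def by measurable

lemma skew_case_nat: "skew (x, case_nat g \<omega>) = (act g x, \<omega>)"
  by (simp add: skew_def)

lemma nn_integral_skew:
  assumes x: "x \<in> space X" and [measurable]: "F \<in> borel_measurable (X \<Otimes>\<^sub>M increments)"
  shows "(\<integral>\<^sup>+\<omega>. F (skew (x, \<omega>)) \<partial>increments) = (\<integral>\<^sup>+g. \<integral>\<^sup>+\<omega>. F (act g x, \<omega>) \<partial>increments \<partial>\<mu>)"
  using x by (subst nn_integral_increments) (simp_all add: skew_case_nat)

lemma distr_skew: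
  assumes "stationary \<nu>"
  shows "distr (\<nu> \<Otimes>\<^sub>M increments) (\<nu> \<Otimes>\<^sub>M increments) skew = \<nu> \<Otimes>\<^sub>M increments"
proof (rule measure_eqI)
  note \<nu> = stationaryD[OF assms]
  have [measurable_cong]: "sets \<nu> = sets X" by fact
  fix A assume "A \<in> sets (distr (\<nu> \<Otimes>\<^sub>M increments) (\<nu> \<Otimes>\<^sub>M increments) skew)"
  then have A: "A \<in> sets (\<nu> \<Otimes>\<^sub>M increments)" by simp
  also have "sets (\<nu> \<Otimes>\<^sub>M increments) = sets (X \<Otimes>\<^sub>M increments)"
    by (rule sets_pair_measure_cong) (simp_all add: \<nu>)
  finally have [measurable]: "A \<in> sets (X \<Otimes>\<^sub>M increments)" .
  have "emeasure (distr (\<nu> \<Otimes>\<^sub>M increments) (\<nu> \<Otimes>\<^sub>M increments) skew) A =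
      (\<integral>\<^sup>+y. indicator A y \<partial>distr (\<nu> \<Otimes>\<^sub>M increments) (\<nu> \<Otimes>\<^sub>M increments) skew)"
    using A by simp
  also have "\<dots> = (\<integral>\<^sup>+z. indicator A (skew z) \<partial>(\<nu> \<Otimes>\<^sub>M increments))"
    by (subst nn_integral_distr) auto
  also have "\<dots> = (\<integral>\<^sup>+x. \<integral>\<^sup>+\<omega>. indicator A (skew (x, \<omega>)) \<partial>increments \<partial>\<nu>)"
    by (subst increments.nn_integral_fst[symmetric]) auto
  also have "\<dots> = (\<integral>\<^sup>+x. \<integral>\<^sup>+g. \<integral>\<^sup>+\<omega>. indicator A (act g x, \<omega>) \<partial>increments \<partial>\<mu> \<partial>\<nu>)"
    using \<nu>(3) by (intro nn_integral_cong nn_integral_skew) auto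
  also have "\<dots> = (\<integral>\<^sup>+x. \<integral>\<^sup>+\<omega>. indicator A (x, \<omega>) \<partial>increments \<partial>\<nu>)"
    by (rule \<nu>(4)[of "\<lambda>x. \<integral>\<^sup>+\<omega>. indicator A (x, \<omega>) \<partial>increments"]) measurable
  also have "\<dots> = (\<integral>\<^sup>+z. indicator A z \<partial>(\<nu> \<Otimes>\<^sub>M increments))"
    by (subst increments.nn_integral_fst[symmetric]) auto
  also have "\<dots> = emeasure (\<nu> \<Otimes>\<^sub>M increments) A" using A by simp
  finally show "emeasure (distr (\<nu> \<Otimes>\<^sub>M increments) (\<nu> \<Otimes>\<^sub>M increments) skew) A =
    emeasure (\<nu> \<Otimes>\<^sub>M increments) A" .
qed simp

text \<open>A skew-invariant event is independent of the first \<open>n\<close> increments. After them the event occurs if and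
  only if it occurs for the point reached and the remaining increments, and for almost every point
  reached its conditional probability is again \<open>c\<close>.\<close>

lemma skew_invariant_cylinder:
  assumes "stationary \<nu>" and [measurable]: "A \<in> sets (X \<Otimes>\<^sub>M increments)"
    and inv: "\<And>z. z \<in> space (X \<Otimes>\<^sub>M increments) \<Longrightarrow> skew z \<in> A \<longleftrightarrow> z \<in> A"
    and c: "AE x in \<nu>. emeasure increments {\<omega> \<in> space increments. (x, \<omega>) \<in> A} = c"
    and B: "\<And>i. B i \<in> sets \<mu>"
  shows "AE x in \<nu>. emeasure increments {\<omega> \<in> space increments. (x, \<omega>) \<in> A \<and> (\<forall>i<n. \<omega> i \<in> B i)} =
      c * (\<Prod>i<n. emeasure \<mu> (B i))"
  using B
proof (induction n arbitrary: B)
  case 0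
  then show ?case using c by simp
next
  case (Suc n)
  note \<nu> = stationaryD[OF assms(1)]
  have [measurable]: "\<And>i. B i \<in> sets \<mu>" by fact
  have "AE x in \<nu>. AE g in \<mu>. emeasure increments
      {\<omega> \<in> space increments. (act g x, \<omega>) \<in> A \<and> (\<forall>i<n. \<omega> i \<in> B (Suc i))} =
      c * (\<Prod>i<n. emeasure \<mu> (B (Suc i)))"
    using Suc by (intro AE_stationary_act assms(1)) auto
  with AE_space[of \<nu>] show ?case
  proof eventually_elim
    case (elim x)
    then have x [measurable]: "x \<in> space X" using \<nu> by simp
    let ?F = "\<lambda>z. indicator A z * indicator {\<omega> \<in> space increments. \<forall>i<n. \<omega> i \<in> B (Suc i)} (snd z) :: ennreal"
    have "emeasure increments {\<omega> \<in> space increments. (x, \<omega>) \<in> A \<and> (\<forall>i<Suc n. \<omega> i \<in> B i)} =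
        (\<integral>\<^sup>+\<omega>. indicator {\<omega> \<in> space increments. (x, \<omega>) \<in> A \<and> (\<forall>i<Suc n. \<omega> i \<in> B i)} \<omega> \<partial>increments)"
      by (rule nn_integral_indicator[symmetric]) measurable
    also have "\<dots> = (\<integral>\<^sup>+\<omega>. indicator (B 0) (\<omega> 0) * ?F (skew (x, \<omega>)) \<partial>increments)"
    proof (rule nn_integral_cong)
      fix \<omega> assume \<omega>: "\<omega> \<in> space increments"
      then have "skew (x, \<omega>) \<in> A \<longleftrightarrow> (x, \<omega>) \<in> A"
        by (intro inv) (simp add: space_pair_measure x)
      then show "indicator {\<omega> \<in> space increments. (x, \<omega>) \<in> A \<and> (\<forall>i<Suc n. \<omega> i \<in> B i)} \<omega> =
          indicator (B 0) (\<omega> 0) * ?F (skew (x, \<omega>))"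
        using \<omega> measurable_space[OF shift_measurable \<omega>]
        by (auto simp: indicator_def less_Suc_eq_0_disj) (auto simp: skew_def)
    qed
    also have "\<dots> = (\<integral>\<^sup>+g. \<integral>\<^sup>+\<omega>. indicator (B 0) g * ?F (act g x, \<omega>) \<partial>increments \<partial>\<mu>)"
      by (subst nn_integral_increments) (simp_all add: skew_case_nat)
    also have "\<dots> = (\<integral>\<^sup>+g. indicator (B 0) g * (c * (\<Prod>i<n. emeasure \<mu> (B (Suc i)))) \<partial>\<mu>)"
    proof (rule nn_integral_cong_AE, use elim(2) AE_space[of \<mu>] in eventually_elim)
      case (elim g)
      then have [measurable]: "act g x \<in> space X"
        using x measurable_space[OF act_measurable, of "(x, g)"] by (simp add: space_pair_measure)
      have "(\<integral>\<^sup>+\<omega>. indicator (B 0) g * ?F (act g x, \<omega>) \<partial>increments) =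
          indicator (B 0) g * (\<integral>\<^sup>+\<omega>. ?F (act g x, \<omega>) \<partial>increments)"
        by (rule nn_integral_cmult) measurable
      also have "(\<integral>\<^sup>+\<omega>. ?F (act g x, \<omega>) \<partial>increments) = (\<integral>\<^sup>+\<omega>. indicator
        {\<omega> \<in> space increments. (act g x, \<omega>) \<in> A \<and> (\<forall>i<n. \<omega> i \<in> B (Suc i))} \<omega> \<partial>increments)"
        by (rule nn_integral_cong) (auto simp: indicator_def)
      also have "\<dots> = c * (\<Prod>i<n. emeasure \<mu> (B (Suc i)))"
        by (subst nn_integral_indicator) (use elim in auto)
      finally show ?case .
    qed
    also have "\<dots> = c * (\<Prod>i<Suc n. emeasure \<mu> (B i))"
      by (subst nn_integral_multc) (simp_all add: prod.lessThan_Suc_shift ac_simps del: prod.lessThan_Suc)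
    finally show ?case .
  qed
qed

text \<open>The conditional probability \<open>h(x)\<close> of an invariant event given the starting point is harmonic,
  hence invariant, hence a constant \<open>c\<close>. The event is then independent of all cylinders, so
  of itself, which leaves only \<open>c = 0\<close> and \<open>c = 1\<close>.\<close>

lemma skew_ergodic:
  assumes erg: "\<nu> \<in> ergodic_measures \<mu> act X" and A: "A \<in> sets (\<nu> \<Otimes>\<^sub>M increments)"
    and inv: "skew -` A \<inter> space (\<nu> \<Otimes>\<^sub>M increments) = A"
  shows "measure (\<nu> \<Otimes>\<^sub>M increments) A = 0 \<or> measure (\<nu> \<Otimes>\<^sub>M increments) A = 1"
proof -
  have stat: "stationary \<nu>" using erg by (simp add: ergodic_measures_def)
  note \<nu> = stationaryD[OF stat]
  have [measurable_cong]: "sets \<nu> = sets X" by fact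
  interpret \<nu>: prob_space \<nu> by fact
  interpret N: pair_prob_space \<nu> increments ..
  let ?N = "\<nu> \<Otimes>\<^sub>M increments"
  have sets_N: "sets ?N = sets (X \<Otimes>\<^sub>M increments)"
    by (rule sets_pair_measure_cong) (simp_all add: \<nu>)
  with A have [measurable]: "A \<in> sets (X \<Otimes>\<^sub>M increments)" by simp
  have inv': "skew z \<in> A \<longleftrightarrow> z \<in> A" if "z \<in> space (X \<Otimes>\<^sub>M increments)" for z
    using inv that sets_eq_imp_space_eq[OF sets_N] by auto
  define h where "h x = measure increments {\<omega> \<in> space increments. (x, \<omega>) \<in> A}" for x
  have h_emeasure: "ennreal (h x) = emeasure increments {\<omega> \<in> space increments. (x, \<omega>) \<in> A}" for x
    by (simp add: h_def increments.emeasure_eq_measure)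
  have slice: "ennreal (h x) = (\<integral>\<^sup>+\<omega>. indicator A (x, \<omega>) \<partial>increments)" if [measurable]: "x \<in> space X" for x
  proof -
    have "ennreal (h x) = (\<integral>\<^sup>+\<omega>. indicator {\<omega> \<in> space increments. (x, \<omega>) \<in> A} \<omega> \<partial>increments)"
      unfolding h_emeasure by (rule nn_integral_indicator[symmetric]) measurable
    also have "\<dots> = (\<integral>\<^sup>+\<omega>. indicator A (x, \<omega>) \<partial>increments)"
      by (rule nn_integral_cong) (auto simp: indicator_def)
    finally show ?thesis .
  qed
  have h_meas [measurable]: "h \<in> borel_measurable X"
    unfolding h_def by measurable
  have h01: "0 \<le> h x" "h x \<le> 1" for x by (auto simp: h_def)
  have harmonic: "(\<integral>\<^sup>+g. ennreal (h (act g x)) \<partial>\<mu>) = ennreal (h x)" if x: "x \<in> space X" for x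
  proof -
    have act_x: "act g x \<in> space X" if "g \<in> space \<mu>" for g
      using x that measurable_space[OF act_measurable, of "(x, g)"] by (simp add: space_pair_measure)
    have "ennreal (h x) = (\<integral>\<^sup>+\<omega>. indicator A (skew (x, \<omega>)) \<partial>increments)"
      unfolding slice[OF x] using x
      by (intro nn_integral_cong) (simp add: indicator_def inv' space_pair_measure)
    also have "\<dots> = (\<integral>\<^sup>+g. \<integral>\<^sup>+\<omega>. indicator A (act g x, \<omega>) \<partial>increments \<partial>\<mu>)"
      using x by (intro nn_integral_skew) auto
    also have "\<dots> = (\<integral>\<^sup>+g. ennreal (h (act g x)) \<partial>\<mu>)"
      by (intro nn_integral_cong) (simp add: slice act_x)
    finally show ?thesis by simp
  qed
  have "AE x in \<nu>. AE g in \<mu>. h (act g x) = h x"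
  proof (rule invariant_of_correlation[OF stat h_meas h01])
    have "(\<integral>\<^sup>+g. ennreal (h x * h (act g x)) \<partial>\<mu>) = ennreal ((h x)\<^sup>2)" if [measurable]: "x \<in> space X" for x
      using h01 by (simp add: ennreal_mult nn_integral_cmult harmonic that power2_eq_square)
    then show "(\<integral>\<^sup>+x. \<integral>\<^sup>+g. ennreal (h x * h (act g x)) \<partial>\<mu> \<partial>\<nu>) = (\<integral>\<^sup>+x. ennreal ((h x)\<^sup>2) \<partial>\<nu>)"
      using \<nu>(3) by (intro nn_integral_cong) simp
  qed
  then obtain c where c: "0 \<le> c" "c \<le> 1" and h_c: "AE x in \<nu>. h x = c"
    using ergodic_invariant_AE_const[OF erg h_meas h01] by auto
  \<comment> \<open>For a fixed set \<open>C\<close> of starting points both sides are finite measures in \<open>D\<close> that agree on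
    cylinders.\<close>
  have rect: "emeasure ?N (A \<inter> (C \<times> D)) = ennreal c * (emeasure \<nu> C * emeasure increments D)"
    if [measurable]: "C \<in> sets X" and D: "D \<in> sets increments" for C D
  proof -
    let ?P = "distr (density ?N (indicator (A \<inter> (C \<times> space increments)))) increments snd"
    let ?Q = "scale_measure (ennreal c * emeasure \<nu> C) increments"
    have P_eq: "emeasure ?P E = (\<integral>\<^sup>+x. indicator C x * emeasure increments {\<omega> \<in> space increments. (x, \<omega>) \<in> A \<and> \<omega> \<in> E} \<partial>\<nu>)"
      if [measurable]: "E \<in> sets increments" for E
    proof -
      have "emeasure ?P E = emeasure (density ?N (indicator (A \<inter> (C \<times> space increments)))) (snd -` E \<inter> space ?N)"
        by (subst emeasure_distr) auto
      also have "\<dots> = (\<integral>\<^sup>+z. indicator (A \<inter> (C \<times> space increments)) z * indicator (snd -` E \<inter> space ?N) z \<partial>?N)"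
        by (rule emeasure_density) measurable
      also have "\<dots> = (\<integral>\<^sup>+x. \<integral>\<^sup>+\<omega>. indicator (A \<inter> (C \<times> space increments)) (x, \<omega>) *
          indicator (snd -` E \<inter> space ?N) (x, \<omega>) \<partial>increments \<partial>\<nu>)"
        by (subst increments.nn_integral_fst[symmetric]) auto
      also have "\<dots> = (\<integral>\<^sup>+x. \<integral>\<^sup>+\<omega>. indicator C x *
          indicator {\<omega> \<in> space increments. (x, \<omega>) \<in> A \<and> \<omega> \<in> E} \<omega> \<partial>increments \<partial>\<nu>)"
        by (intro nn_integral_cong) (auto simp: indicator_def space_pair_measure)
      also have "\<dots> = (\<integral>\<^sup>+x. indicator C x * emeasure increments {\<omega> \<in> space increments. (x, \<omega>) \<in> A \<and> \<omega> \<in> E} \<partial>\<nu>)"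
      proof (intro nn_integral_cong)
        fix x assume "x \<in> space \<nu>"
        then have [measurable]: "x \<in> space X" using \<nu> by simp
        show "(\<integral>\<^sup>+\<omega>. indicator C x * indicator {\<omega> \<in> space increments. (x, \<omega>) \<in> A \<and> \<omega> \<in> E} \<omega> \<partial>increments) =
            indicator C x * emeasure increments {\<omega> \<in> space increments. (x, \<omega>) \<in> A \<and> \<omega> \<in> E}"
          by (rule nn_integral_cmult_indicator) measurable
      qed
      finally show ?thesis .
    qed
    have "?P = ?Q"
    proof (rule measure_eqI_PiM_infinite)
      show "finite_measure ?P"
      proof (rule finite_measureI)
        have "emeasure ?P (space increments) \<le> (\<integral>\<^sup>+x. 1 \<partial>\<nu>)"
          unfolding P_eq[OF sets.top]
          by (intro nn_integral_mono) (auto simp: indicator_def intro!: increments.emeasure_le_1)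
        then show "emeasure ?P (space ?P) \<noteq> \<infinity>"
          by (auto simp: \<nu>.emeasure_space_1 top_unique)
      qed
      fix J :: "nat set" and B assume J: "finite J" and B: "\<And>i. i \<in> J \<Longrightarrow> B i \<in> sets \<mu>"
      let ?B = "\<lambda>i. if i \<in> J then B i else space \<mu>"
      obtain n where n: "J \<subseteq> {..<n}" using J finite_nat_iff_bounded by blast
      have emb: "prod_emb UNIV (\<lambda>_. \<mu>) J (Pi\<^sub>E J B) = {\<omega> \<in> space increments. \<forall>i<n. \<omega> i \<in> ?B i}"
        using n B[THEN sets.sets_into_space] by (auto simp: prod_emb_def space_PiM PiE_iff subset_eq split: if_splits)
      have prod: "(\<Prod>i<n. emeasure \<mu> (?B i)) = (\<Prod>i\<in>J. emeasure \<mu> (B i))"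
        using n by (intro prod.mono_neutral_cong_right) (auto simp: emeasure_space_1)
      have "emeasure ?P (prod_emb UNIV (\<lambda>_. \<mu>) J (Pi\<^sub>E J B)) = (\<integral>\<^sup>+x. indicator C x *
          emeasure increments {\<omega> \<in> space increments. (x, \<omega>) \<in> A \<and> \<omega> \<in> prod_emb UNIV (\<lambda>_. \<mu>) J (Pi\<^sub>E J B)} \<partial>\<nu>)"
        using J B by (intro P_eq sets_PiM_I) auto
      also have "\<dots> = (\<integral>\<^sup>+x. indicator C x * (ennreal c * (\<Prod>i<n. emeasure \<mu> (?B i))) \<partial>\<nu>)"
      proof (rule nn_integral_cong_AE)
        have "AE x in \<nu>. emeasure increments {\<omega> \<in> space increments. (x, \<omega>) \<in> A \<and> (\<forall>i<n. \<omega> i \<in> ?B i)} =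
            ennreal c * (\<Prod>i<n. emeasure \<mu> (?B i))"
        proof (rule skew_invariant_cylinder[OF stat _ inv'])
          show "AE x in \<nu>. emeasure increments {\<omega> \<in> space increments. (x, \<omega>) \<in> A} = ennreal c"
            using h_c by eventually_elim (simp add: h_emeasure[symmetric])
        qed (use B in auto)
        then show "AE x in \<nu>. indicator C x * emeasure increments
            {\<omega> \<in> space increments. (x, \<omega>) \<in> A \<and> \<omega> \<in> prod_emb UNIV (\<lambda>_. \<mu>) J (Pi\<^sub>E J B)} =
            indicator C x * (ennreal c * (\<Prod>i<n. emeasure \<mu> (?B i)))"
          unfolding emb by eventually_elim (simp add: conj_ac)
      qed
      also have "\<dots> = emeasure \<nu> C * (ennreal c * (\<Prod>i\<in>J. emeasure \<mu> (B i)))"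
        by (subst nn_integral_multc) (auto simp: prod)
      also have "(\<Prod>i\<in>J. emeasure \<mu> (B i)) = emeasure increments (prod_emb UNIV (\<lambda>_. \<mu>) J (Pi\<^sub>E J B))"
        using J B by (intro increments.emeasure_PiM_emb[symmetric]) auto
      finally show "emeasure ?P (prod_emb UNIV (\<lambda>_. \<mu>) J (Pi\<^sub>E J B)) =
          emeasure ?Q (prod_emb UNIV (\<lambda>_. \<mu>) J (Pi\<^sub>E J B))"
        by (simp add: ac_simps)
    qed simp_all
    then have "emeasure ?P D = emeasure ?Q D" by simp
    moreover have "emeasure ?P D = emeasure ?N (A \<inter> (C \<times> D))"
    proof -
      have "emeasure ?N (A \<inter> (C \<times> D)) = (\<integral>\<^sup>+x. emeasure increments (Pair x -` (A \<inter> (C \<times> D))) \<partial>\<nu>)"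
        using D by (intro increments.emeasure_pair_measure_alt) measurable
      also have "\<dots> = emeasure ?P D"
        unfolding P_eq[OF D] using sets.sets_into_space[OF D]
        by (intro nn_integral_cong) (auto simp: indicator_def intro!: arg_cong[where f = "emeasure increments"])
      finally show ?thesis by simp
    qed
    ultimately show ?thesis by (simp add: ac_simps)
  qed
  have "emeasure ?N A = ennreal c"
    using rect[OF sets.top sets.top] sets.sets_into_space[OF A] \<nu>
    by (simp add: space_pair_measure Int_absorb2 increments.emeasure_space_1
        \<nu>.emeasure_space_1[unfolded \<nu>(3)])
  then have meas: "measure ?N A = c"
    using c by (simp add: measure_def)
  show ?thesis
  proof (cases "c = 0")
    case False
    then have "0 < c" using c by simp
    \<comment> \<open>Independence says that conditioning on \<open>A\<close> does not change the product measure.\<close>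
    let ?D = "density ?N (\<lambda>z. ennreal (1 / c) * indicator A z)"
    have "?N = ?D"
    proof (rule pair_measure_eqI)
      fix C D assume CD: "C \<in> sets \<nu>" "D \<in> sets increments"
      then have [measurable]: "C \<in> sets X" "D \<in> sets increments" using \<nu> by auto
      have "emeasure ?D (C \<times> D) = (\<integral>\<^sup>+z. ennreal (1 / c) * indicator A z * indicator (C \<times> D) z \<partial>?N)"
        using CD by (intro emeasure_density) auto
      also have "\<dots> = (\<integral>\<^sup>+z. ennreal (1 / c) * indicator (A \<inter> (C \<times> D)) z \<partial>?N)"
        by (intro nn_integral_cong) (auto simp: indicator_def)
      also have "\<dots> = ennreal (1 / c) * emeasure ?N (A \<inter> (C \<times> D))"
        by (intro nn_integral_cmult_indicator) measurable
      also have "\<dots> = (ennreal (1 / c) * ennreal c) * (emeasure \<nu> C * emeasure increments D)"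
        using CD by (subst rect) (auto simp: mult.assoc)
      also have "ennreal (1 / c) * ennreal c = 1"
        using \<open>0 < c\<close> by (simp add: ennreal_mult[symmetric])
      finally show "emeasure \<nu> C * emeasure increments D = emeasure ?D (C \<times> D)" by simp
    qed (auto intro: \<nu>.sigma_finite_measure_axioms increments.sigma_finite_measure_axioms)
    then have "emeasure ?N (space ?N - A) = emeasure ?D (space ?N - A)" by simp
    also have "\<dots> = (\<integral>\<^sup>+z. ennreal (1 / c) * indicator A z * indicator (space ?N - A) z \<partial>?N)"
      using A by (intro emeasure_density) auto
    also have "\<dots> = (\<integral>\<^sup>+z. 0 \<partial>?N)"
      by (intro nn_integral_cong) (auto simp: indicator_def)
    finally have "measure ?N (space ?N - A) = 0" by (simp add: measure_def)
    then show ?thesis using N.prob_compl[OF A] by simp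
  qed (use meas in simp)
qed

text \<open>The increment \<open>\<omega> n\<close> drives step \<open>n + 1\<close>, as in \<open>left_walk\<close>.\<close>

primrec orbit :: "(nat \<Rightarrow> 'g) \<Rightarrow> nat \<Rightarrow> 'p \<Rightarrow> 'p" where
  "orbit \<omega> 0 x = x"
| "orbit \<omega> (Suc n) x = act (\<omega> n) (orbit \<omega> n x)"

lemma skew_funpow: "(skew ^^ n) (x, \<omega>) = (orbit \<omega> n x, \<lambda>k. \<omega> (k + n))"
  by (induction n) (auto simp: skew_def)

lemma orbit_measurable [measurable]: "(\<lambda>z. orbit (snd z) n (fst z)) \<in> X \<Otimes>\<^sub>M increments \<rightarrow>\<^sub>M X"
  by (induction n) simp_all

lemma nn_integral_orbit:
  assumes "stationary \<nu>" and [measurable]: "f \<in> borel_measurable X"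
  shows "(\<integral>\<^sup>+x. \<integral>\<^sup>+\<omega>. f (orbit \<omega> n x) \<partial>increments \<partial>\<nu>) = (\<integral>\<^sup>+x. f x \<partial>\<nu>)"
proof -
  note \<nu> = stationaryD[OF assms(1)]
  have [measurable_cong]: "sets \<nu> = sets X" by fact
  have "(\<integral>\<^sup>+z. f (orbit (snd z) n (fst z)) \<partial>(\<nu> \<Otimes>\<^sub>M increments)) = (\<integral>\<^sup>+z. f (fst z) \<partial>(\<nu> \<Otimes>\<^sub>M increments))"
  proof (induction n)
    case (Suc n)
    have "(\<integral>\<^sup>+z. f (orbit (snd z) (Suc n) (fst z)) \<partial>(\<nu> \<Otimes>\<^sub>M increments)) =
        (\<integral>\<^sup>+z. f (orbit (snd (skew z)) n (fst (skew z))) \<partial>(\<nu> \<Otimes>\<^sub>M increments))"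
    proof (rule nn_integral_cong)
      fix z
      have "orbit (snd z) (Suc n) (fst z) = fst ((skew ^^ Suc n) (fst z, snd z))"
        by (simp only: skew_funpow fst_conv)
      also have "\<dots> = fst ((skew ^^ n) (fst (skew z), snd (skew z)))"
        by (simp add: funpow_swap1)
      also have "\<dots> = orbit (snd (skew z)) n (fst (skew z))"
        by (simp only: skew_funpow fst_conv)
      finally show "f (orbit (snd z) (Suc n) (fst z)) = f (orbit (snd (skew z)) n (fst (skew z)))"
        by simp
    qed
    also have "\<dots> = (\<integral>\<^sup>+z. f (orbit (snd z) n (fst z)) \<partial>distr (\<nu> \<Otimes>\<^sub>M increments) (\<nu> \<Otimes>\<^sub>M increments) skew)"
      by (rule nn_integral_distr[symmetric]) measurable
    finally show ?case using Suc by (simp add: distr_skew[OF assms(1)])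
  qed simp
  then show ?thesis
    by (subst (asm) (1 2) increments.nn_integral_fst[symmetric])
      (simp_all add: increments.emeasure_space_1)
qed

text \<open>Birkhoff's theorem for the skew product and the function \<open>(x, \<omega>) \<mapsto> f (x, \<omega> 0)\<close>.\<close>

lemma orbit_averages:
  fixes f :: "'p \<times> 'g \<Rightarrow> real"
  assumes erg: "\<nu> \<in> ergodic_measures \<mu> act X" and f: "integrable (\<nu> \<Otimes>\<^sub>M \<mu>) f"
  shows "AE x in \<nu>. AE \<omega> in increments.
    (\<lambda>n. (\<Sum>k<n. f (orbit \<omega> k x, \<omega> k)) / real n) \<longlonglongrightarrow> (\<integral>x. \<integral>g. f (x, g) \<partial>\<mu> \<partial>\<nu>)"
proof -
  have stat: "stationary \<nu>" using erg by (simp add: ergodic_measures_def)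
  note \<nu> = stationaryD[OF stat]
  have [measurable_cong]: "sets \<nu> = sets X" by fact
  interpret \<nu>: prob_space \<nu> by fact
  interpret N: pair_prob_space \<nu> increments ..
  interpret P: pair_prob_space \<nu> \<mu> ..
  have [measurable]: "f \<in> borel_measurable (\<nu> \<Otimes>\<^sub>M \<mu>)" using f by simp
  let ?p = "\<lambda>z. (fst z, snd z 0) :: 'p \<times> 'g"
  have p_meas: "?p \<in> \<nu> \<Otimes>\<^sub>M increments \<rightarrow>\<^sub>M \<nu> \<Otimes>\<^sub>M \<mu>" by measurable
  have first: "distr increments \<mu> (\<lambda>\<omega>. \<omega> 0) = \<mu>"
    by (rule increments.PiM_component) simp
  have "distr \<nu> \<nu> (\<lambda>x. x) \<Otimes>\<^sub>M distr increments \<mu> (\<lambda>\<omega>. \<omega> 0) =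
      distr (\<nu> \<Otimes>\<^sub>M increments) (\<nu> \<Otimes>\<^sub>M \<mu>) (\<lambda>(x, \<omega>). (x, \<omega> 0))"
    by (rule pair_measure_distr) (simp_all add: first sigma_finite_measure_axioms)
  then have p_distr: "distr (\<nu> \<Otimes>\<^sub>M increments) (\<nu> \<Otimes>\<^sub>M \<mu>) ?p = \<nu> \<Otimes>\<^sub>M \<mu>"
    by (simp add: first distr_id2 split_beta')
  have int: "integrable (\<nu> \<Otimes>\<^sub>M increments) (\<lambda>z. f (?p z))"
    using integrable_distr_eq[OF p_meas, of f] f p_distr by simp
  have "N.expectation (\<lambda>z. f (?p z)) = (\<integral>z. f z \<partial>(\<nu> \<Otimes>\<^sub>M \<mu>))"
    using integral_distr[OF p_meas, of f] p_distr by simp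
  also have "\<dots> = (\<integral>x. \<integral>g. f (x, g) \<partial>\<mu> \<partial>\<nu>)"
    by (rule P.integral_fst'[OF f, symmetric])
  finally have expect: "N.expectation (\<lambda>z. f (?p z)) = (\<integral>x. \<integral>g. f (x, g) \<partial>\<mu> \<partial>\<nu>)" .
  have "AE z in \<nu> \<Otimes>\<^sub>M increments. (\<lambda>n. birkhoff_sum skew (\<lambda>z. f (?p z)) n z / n) \<longlonglongrightarrow>
      (\<integral>x. \<integral>g. f (x, g) \<partial>\<mu> \<partial>\<nu>)"
    unfolding expect[symmetric]
    by (rule N.birkhoff_ergodic) (use skew_ergodic[OF erg] distr_skew[OF stat] int in auto)
  from N.AE_pair[OF this] show ?thesis
    by (simp add: birkhoff_sum_def skew_funpow)
qed

end

section \<open>Equivariant images of ergodic measures\<close>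

text \<open>An equivariant map \<open>\<pi>\<close>, defined on a set \<open>\<Omega>\<close> of full measure only. The action on the quotient is a bare
  function \<open>actQ\<close>; the measurable section \<open>s\<close> makes its Markov operator measurable
  (\<open>markov_measurable\<close>), because for \<open>x\<close> in \<open>\<Omega>\<close> that operator can be computed upstairs.\<close>

locale ergodic_factor = random_action +
  fixes \<nu> :: "'b measure" and \<Omega> :: "'b set" and Q :: "'q measure"
    and \<pi> :: "'b \<Rightarrow> 'q" and s :: "'q \<Rightarrow> 'b" and actQ :: "'a \<Rightarrow> 'q \<Rightarrow> 'q"
  assumes ergodic: "\<nu> \<in> ergodic_measures \<mu> act X"
    and \<Omega>_sets: "\<Omega> \<in> sets X" and \<Omega>_full: "emeasure \<nu> \<Omega> = 1"
    and proj_measurable: "\<pi> \<in> restrict_space X \<Omega> \<rightarrow>\<^sub>M Q"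
    and section_measurable: "s \<in> Q \<rightarrow>\<^sub>M restrict_space X \<Omega>"
    and proj_section: "\<And>y. y \<in> space Q \<Longrightarrow> \<pi> (s y) = y"
    and equivariant: "AE g in \<mu>. \<forall>x\<in>\<Omega>. act g x \<in> \<Omega> \<and> \<pi> (act g x) = actQ g (\<pi> x)"
begin

lemma stationary: "stationary \<nu>"
  using ergodic by (simp add: ergodic_measures_def)

lemmas \<nu> = stationaryD[OF stationary]

sublocale \<nu>: prob_space \<nu> by (rule \<nu>)

lemma \<Omega>_space: "\<Omega> \<inter> space \<nu> = \<Omega>" "\<Omega> \<inter> space X = \<Omega>" "\<Omega> \<inter> space X \<in> sets X"
  "\<Omega> \<inter> space \<nu> \<in> sets \<nu>"
  using sets.sets_into_space[OF \<Omega>_sets] \<nu> \<Omega>_sets by (auto simp: Int_absorb2)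

lemma AE_\<Omega>: "AE x in \<nu>. x \<in> \<Omega>"
  using \<Omega>_full \<Omega>_sets \<nu> by (subst \<nu>.prob_eq_1[symmetric]) (auto simp: measure_def)

lemma sets_restrict: "sets (restrict_space \<nu> \<Omega>) = sets (restrict_space X \<Omega>)"
  by (rule sets_restrict_space_cong) (rule \<nu>)

lemma restrict_prob_space: "prob_space (restrict_space \<nu> \<Omega>)"
  using \<Omega>_full \<Omega>_space by (intro prob_space_restrict_space) auto

lemma restrict_stationary: "restrict_space \<nu> \<Omega> \<in> stationary_measures \<mu> act (restrict_space X \<Omega>)"
proof -
  have "(\<integral>\<^sup>+ x. \<integral>\<^sup>+ g. f (act g x) \<partial>\<mu> \<partial>restrict_space \<nu> \<Omega>) = (\<integral>\<^sup>+ x. f x \<partial>restrict_space \<nu> \<Omega>)"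
    if f: "f \<in> borel_measurable (restrict_space X \<Omega>)" for f :: "'b \<Rightarrow> ennreal"
  proof -
    let ?f = "\<lambda>x. f x * indicator \<Omega> x"
    have "?f \<in> borel_measurable X"
      using f \<Omega>_space by (simp add: borel_measurable_restrict_space_iff_ennreal)
    have "(\<integral>\<^sup>+ x. \<integral>\<^sup>+ g. f (act g x) \<partial>\<mu> \<partial>restrict_space \<nu> \<Omega>) =
        (\<integral>\<^sup>+ x. (\<integral>\<^sup>+ g. f (act g x) \<partial>\<mu>) * indicator \<Omega> x \<partial>\<nu>)"
      using \<Omega>_space by (simp add: nn_integral_restrict_space)
    also have "\<dots> = (\<integral>\<^sup>+ x. \<integral>\<^sup>+ g. ?f (act g x) \<partial>\<mu> \<partial>\<nu>)"
    proof (rule nn_integral_cong_AE, use AE_\<Omega> in eventually_elim)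
      case (elim x)
      then show ?case
        using equivariant by (auto intro!: nn_integral_cong_AE elim!: eventually_mono)
    qed
    also have "\<dots> = (\<integral>\<^sup>+ x. ?f x \<partial>\<nu>)" by (rule \<nu>(4)) fact
    also have "\<dots> = (\<integral>\<^sup>+ x. f x \<partial>restrict_space \<nu> \<Omega>)"
      using \<Omega>_space by (simp add: nn_integral_restrict_space)
    finally show ?thesis .
  qed
  then show ?thesis
    using restrict_prob_space sets_restrict by (simp add: stationary_measures_def)
qed

abbreviation factor :: "'q measure" where
  "factor \<equiv> distr (restrict_space \<nu> \<Omega>) Q \<pi>"

lemma proj_measurable': "\<pi> \<in> restrict_space \<nu> \<Omega> \<rightarrow>\<^sub>M Q"
  using proj_measurable by (simp add: measurable_cong_sets[OF sets_restrict refl])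

lemma factor_prob_space: "prob_space factor"
  by (rule prob_space.prob_space_distr[OF restrict_prob_space proj_measurable'])

lemma nn_integral_factor:
  assumes "f \<in> borel_measurable Q"
  shows "(\<integral>\<^sup>+y. f y \<partial>factor) = (\<integral>\<^sup>+x. f (\<pi> x) * indicator \<Omega> x \<partial>\<nu>)"
  using assms \<Omega>_space by (simp add: nn_integral_distr[OF proj_measurable'] nn_integral_restrict_space)

lemma lift_measurable:
  fixes f :: "'q \<Rightarrow> ennreal"
  assumes "f \<in> borel_measurable Q"
  shows "(\<lambda>x. f (\<pi> x) * indicator \<Omega> x) \<in> borel_measurable X"
  using measurable_compose[OF proj_measurable assms] \<Omega>_space
  by (simp add: borel_measurable_restrict_space_iff_ennreal)

lemma markov_lift:
  fixes f :: "'q \<Rightarrow> ennreal"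
  assumes "x \<in> \<Omega>"
  shows "(\<integral>\<^sup>+g. f (actQ g (\<pi> x)) \<partial>\<mu>) = (\<integral>\<^sup>+g. f (\<pi> (act g x)) * indicator \<Omega> (act g x) \<partial>\<mu>)"
  using assms equivariant by (auto intro!: nn_integral_cong_AE elim!: eventually_mono)

lemma markov_measurable:
  fixes f :: "'q \<Rightarrow> ennreal"
  assumes f: "f \<in> borel_measurable Q"
  shows "(\<lambda>y. \<integral>\<^sup>+g. f (actQ g y) \<partial>\<mu>) \<in> borel_measurable Q"
proof -
  note [measurable] = lift_measurable[OF f]
  have s [measurable]: "s \<in> Q \<rightarrow>\<^sub>M X"
    using section_measurable by (simp add: measurable_restrict_space2_iff)
  have "(\<lambda>y. \<integral>\<^sup>+g. f (\<pi> (act g (s y))) * indicator \<Omega> (act g (s y)) \<partial>\<mu>) \<in> borel_measurable Q"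
    by measurable
  also have "?this \<longleftrightarrow> ?thesis"
  proof (rule measurable_cong)
    fix y assume y: "y \<in> space Q"
    then have "s y \<in> \<Omega>" using section_measurable by (auto simp: measurable_restrict_space2_iff)
    from markov_lift[OF this, of f] show "(\<integral>\<^sup>+g. f (\<pi> (act g (s y))) * indicator \<Omega> (act g (s y)) \<partial>\<mu>) =
        (\<integral>\<^sup>+g. f (actQ g y) \<partial>\<mu>)" by (simp add: proj_section[OF y])
  qed
  finally show ?thesis .
qed

text \<open>The correlation of \<open>k\<close> with the Markov operator applied to \<open>f\<close> is the same below as that of the
  pullbacks, extended by 0 outside \<open>\<Omega>\<close>, above.\<close>

lemma nn_integral_factor_markov:
  fixes f k :: "'q \<Rightarrow> ennreal"
  assumes f: "f \<in> borel_measurable Q" and k: "k \<in> borel_measurable Q"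
  shows "(\<integral>\<^sup>+y. k y * (\<integral>\<^sup>+g. f (actQ g y) \<partial>\<mu>) \<partial>factor) =
    (\<integral>\<^sup>+x. (k (\<pi> x) * indicator \<Omega> x) * (\<integral>\<^sup>+g. f (\<pi> (act g x)) * indicator \<Omega> (act g x) \<partial>\<mu>) \<partial>\<nu>)"
  by (subst nn_integral_factor)
    (use k markov_measurable[OF f] in \<open>auto intro!: nn_integral_cong simp: markov_lift indicator_def\<close>)

lemma factor_stationary: "factor \<in> stationary_measures \<mu> actQ Q"
proof -
  have "(\<integral>\<^sup>+ y. \<integral>\<^sup>+ g. f (actQ g y) \<partial>\<mu> \<partial>factor) = (\<integral>\<^sup>+ y. f y \<partial>factor)"
    if f: "f \<in> borel_measurable Q" for f :: "'q \<Rightarrow> ennreal"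
  proof -
    have "(\<integral>\<^sup>+ y. \<integral>\<^sup>+ g. f (actQ g y) \<partial>\<mu> \<partial>factor) =
      (\<integral>\<^sup>+x. indicator \<Omega> x * (\<integral>\<^sup>+g. f (\<pi> (act g x)) * indicator \<Omega> (act g x) \<partial>\<mu>) \<partial>\<nu>)"
      using nn_integral_factor_markov[OF f, of "\<lambda>_. 1"] by simp
    also have "\<dots> = (\<integral>\<^sup>+x. \<integral>\<^sup>+g. f (\<pi> (act g x)) * indicator \<Omega> (act g x) \<partial>\<mu> \<partial>\<nu>)"
      by (rule nn_integral_cong_AE, use AE_\<Omega> in eventually_elim) simp
    also have "\<dots> = (\<integral>\<^sup>+x. f (\<pi> x) * indicator \<Omega> x \<partial>\<nu>)"
      by (rule \<nu>(4)) (rule lift_measurable[OF f])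
    finally show ?thesis by (simp add: nn_integral_factor[OF f])
  qed
  then show ?thesis
    using factor_prob_space by (simp add: stationary_measures_def)
qed

text \<open>The measure \<open>t N\<close> has a density \<open>h\<close> with values in \<open>[0, 1]\<close> with respect to the image measure.
  Testing the stationarity of \<open>N\<close> against \<open>h\<close> itself gives exactly the correlation that makes the
  pullback of \<open>h\<close> invariant, hence constant by the ergodicity of \<open>\<nu>\<close>.\<close>

lemma dominated_stationary_eq_factor:
  assumes N: "N \<in> stationary_measures \<mu> actQ Q" and t: "0 < t"
    and le: "\<And>A. A \<in> sets Q \<Longrightarrow> t * measure N A \<le> measure factor A"
  shows "N = factor"
proof -
  interpret F: prob_space factor by (rule factor_prob_space)
  have N_prob: "prob_space N" and N_sets: "sets N = sets Q" and N_stat: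
      "f \<in> borel_measurable Q \<Longrightarrow> (\<integral>\<^sup>+ y. \<integral>\<^sup>+ g. f (actQ g y) \<partial>\<mu> \<partial>N) = (\<integral>\<^sup>+ y. f y \<partial>N)"
    for f :: "'q \<Rightarrow> ennreal"
    using N by (auto simp: stationary_measures_def)
  interpret N: prob_space N by fact
  let ?N = "scale_measure (ennreal t) N"
  have le': "emeasure ?N A \<le> emeasure factor A" if "A \<in> sets Q" for A
    using le[OF that] t
    by (simp add: N.emeasure_eq_measure F.emeasure_eq_measure ennreal_mult'[symmetric])
  have "absolutely_continuous factor ?N"
    unfolding absolutely_continuous_def
  proof
    fix A assume A: "A \<in> null_sets factor"
    then have "A \<in> sets Q" "emeasure factor A = 0" by (auto simp: null_sets_def)
    with le'[of A] show "A \<in> null_sets ?N" by (intro null_setsI) (simp_all add: N_sets)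
  qed
  then obtain k where k [measurable]: "k \<in> borel_measurable factor" and dk: "density factor k = ?N"
    using F.Radon_Nikodym[of ?N] by (auto simp: N_sets)
  have k_le: "AE y in factor. k y \<le> 1"
  proof -
    let ?A = "{y \<in> space factor. 1 < k y}"
    have A [measurable]: "?A \<in> sets factor" by measurable
    have "(\<integral>\<^sup>+y. (k y - 1) * indicator ?A y \<partial>factor) =
        (\<integral>\<^sup>+y. k y * indicator ?A y - indicator ?A y \<partial>factor)"
      by (intro nn_integral_cong) (auto simp: indicator_def)
    also have "\<dots> = (\<integral>\<^sup>+y. k y * indicator ?A y \<partial>factor) - (\<integral>\<^sup>+y. indicator ?A y \<partial>factor)"
    proof (rule nn_integral_diff)
      show "(\<integral>\<^sup>+y. indicator ?A y \<partial>factor) \<noteq> \<infinity>"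
        unfolding nn_integral_indicator[OF A] by simp
    qed (auto intro!: AE_I2 split: split_indicator)
    also have "\<dots> = emeasure ?N ?A - emeasure factor ?A"
      by (simp add: dk[symmetric] emeasure_density)
    also have "\<dots> = 0"
      using le'[of ?A] A by (simp add: diff_eq_0_iff_ennreal less_top[symmetric] ennreal_mult_eq_top_iff)
    finally have "AE y in factor. (k y - 1) * indicator ?A y = 0"
      by (subst (asm) nn_integral_0_iff_AE) auto
    then show ?thesis
      using AE_space by eventually_elim (auto simp: indicator_def diff_eq_0_iff_ennreal split: if_splits)
  qed
  define h where "h y = enn2real (min 1 (k y))" for y
  have h_meas [measurable]: "h \<in> borel_measurable Q"
    using k unfolding h_def by simp
  have h01: "0 \<le> h y" "h y \<le> 1" for y
    unfolding h_def by (auto intro!: enn2real_leI)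
  have dh: "density factor (\<lambda>y. ennreal (h y)) = ?N"
    unfolding dk[symmetric]
  proof (rule density_cong)
    have "ennreal (h y) = k y" if "k y \<le> 1" for y
      using that le_less_trans[OF that ennreal_one_less_top] by (simp add: h_def min_absorb2)
    then show "AE y in factor. ennreal (h y) = k y"
      using k_le by (auto elim!: eventually_mono)
  qed auto
  have "(\<integral>\<^sup>+y. ennreal (h y) * (\<integral>\<^sup>+g. ennreal (h (actQ g y)) \<partial>\<mu>) \<partial>factor) =
      (\<integral>\<^sup>+y. (\<integral>\<^sup>+g. ennreal (h (actQ g y)) \<partial>\<mu>) \<partial>?N)"
    unfolding dh[symmetric] using markov_measurable[of "\<lambda>y. ennreal (h y)"]
    by (subst nn_integral_density) auto
  also have "\<dots> = ennreal t * (\<integral>\<^sup>+y. (\<integral>\<^sup>+g. ennreal (h (actQ g y)) \<partial>\<mu>) \<partial>N)"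
    using markov_measurable[of "\<lambda>y. ennreal (h y)"]
    by (intro nn_integral_scale_measure) (simp add: measurable_cong_sets[OF N_sets refl])
  also have "\<dots> = ennreal t * (\<integral>\<^sup>+y. ennreal (h y) \<partial>N)"
    by (subst N_stat) auto
  also have "\<dots> = (\<integral>\<^sup>+y. ennreal (h y) \<partial>?N)"
    by (intro nn_integral_scale_measure[symmetric]) (simp add: measurable_cong_sets[OF N_sets refl])
  also have "\<dots> = (\<integral>\<^sup>+y. ennreal (h y) * ennreal (h y) \<partial>factor)"
    unfolding dh[symmetric] by (subst nn_integral_density) auto
  finally have corr: "(\<integral>\<^sup>+y. ennreal (h y) * (\<integral>\<^sup>+g. ennreal (h (actQ g y)) \<partial>\<mu>) \<partial>factor) =
      (\<integral>\<^sup>+y. ennreal (h y) * ennreal (h y) \<partial>factor)" .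
  define h' where "h' x = h (\<pi> x) * indicator \<Omega> x" for x
  have h'_ennreal: "ennreal (h' x) = ennreal (h (\<pi> x)) * indicator \<Omega> x" for x
    by (simp add: h'_def indicator_def)
  have h'_meas [measurable]: "h' \<in> borel_measurable X"
    unfolding h'_def using measurable_compose[OF proj_measurable h_meas] \<Omega>_space
    by (simp add: borel_measurable_restrict_space_iff mult.commute)
  have h'01: "0 \<le> h' x" "h' x \<le> 1" for x using h01 by (auto simp: h'_def indicator_def)
  have "AE x in \<nu>. AE g in \<mu>. h' (act g x) = h' x"
  proof (rule invariant_of_correlation[OF stationary h'_meas h'01])
    have "(\<integral>\<^sup>+x. \<integral>\<^sup>+g. ennreal (h' x * h' (act g x)) \<partial>\<mu> \<partial>\<nu>) =
        (\<integral>\<^sup>+x. ennreal (h' x) * (\<integral>\<^sup>+g. ennreal (h' (act g x)) \<partial>\<mu>) \<partial>\<nu>)"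
    proof (rule nn_integral_cong)
      fix x assume "x \<in> space \<nu>"
      then have [measurable]: "x \<in> space X" using \<nu> by simp
      show "(\<integral>\<^sup>+g. ennreal (h' x * h' (act g x)) \<partial>\<mu>) =
          ennreal (h' x) * (\<integral>\<^sup>+g. ennreal (h' (act g x)) \<partial>\<mu>)"
        using h'01 by (simp add: ennreal_mult nn_integral_cmult)
    qed
    also have "\<dots> = (\<integral>\<^sup>+y. ennreal (h y) * ennreal (h y) \<partial>factor)"
      unfolding corr[symmetric] h'_ennreal by (rule nn_integral_factor_markov[symmetric]) auto
    also have "\<dots> = (\<integral>\<^sup>+x. ennreal (h (\<pi> x)) * ennreal (h (\<pi> x)) * indicator \<Omega> x \<partial>\<nu>)"
      by (rule nn_integral_factor) simp
    also have "\<dots> = (\<integral>\<^sup>+x. ennreal ((h' x)\<^sup>2) \<partial>\<nu>)"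
      by (rule nn_integral_cong) (auto simp: h'_def indicator_def power2_eq_square ennreal_mult h01)
    finally show "(\<integral>\<^sup>+x. \<integral>\<^sup>+g. ennreal (h' x * h' (act g x)) \<partial>\<mu> \<partial>\<nu>) = (\<integral>\<^sup>+x. ennreal ((h' x)\<^sup>2) \<partial>\<nu>)" .
  qed
  then obtain c where c: "0 \<le> c" and h'_c: "AE x in \<nu>. h' x = c"
    using ergodic_invariant_AE_const[OF ergodic h'_meas h'01] by auto
  have "AE x in restrict_space \<nu> \<Omega>. h (\<pi> x) = c"
    using \<Omega>_space h'_c by (auto simp: AE_restrict_space_iff h'_def elim!: eventually_mono)
  then have h_c: "AE y in factor. h y = c"
    using \<Omega>_space by (subst AE_distr_iff[OF proj_measurable']) auto
  have scaled: "ennreal t * emeasure N A = ennreal c * emeasure factor A" if A: "A \<in> sets Q" for A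
  proof -
    have "ennreal t * emeasure N A = emeasure (density factor (\<lambda>y. ennreal (h y))) A"
      unfolding dh by simp
    also have "\<dots> = (\<integral>\<^sup>+y. ennreal (h y) * indicator A y \<partial>factor)"
      using A by (intro emeasure_density) auto
    also have "\<dots> = (\<integral>\<^sup>+y. ennreal c * indicator A y \<partial>factor)"
      by (rule nn_integral_cong_AE, use h_c in eventually_elim) simp
    also have "\<dots> = ennreal c * emeasure factor A"
      using A by (intro nn_integral_cmult_indicator) auto
    finally show ?thesis .
  qed
  have "c = t"
    using scaled[of "space Q"] N.emeasure_space_1 F.emeasure_space_1 sets_eq_imp_space_eq[OF N_sets] c t
    by simp
  show ?thesis
  proof (rule measure_eqI)
    fix A assume "A \<in> sets N"
    then have "A \<in> sets Q" by (simp add: N_sets)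
    from scaled[OF this] show "emeasure N A = emeasure factor A"
      using t unfolding \<open>c = t\<close> by (simp add: ennreal_mult_cancel_left)
  qed (simp add: N_sets)
qed

lemma factor_ergodic: "factor \<in> ergodic_measures \<mu> actQ Q"
  unfolding ergodic_measures_def
proof (intro CollectI conjI ballI allI impI factor_stationary)
  fix N1 N2 and t :: real
  assume N: "N1 \<in> stationary_measures \<mu> actQ Q" "N2 \<in> stationary_measures \<mu> actQ Q"
    and *: "0 < t \<and> t < 1 \<and>
      (\<forall>A\<in>sets Q. measure factor A = t * measure N1 A + (1 - t) * measure N2 A)"
  show "N1 = factor"
    by (rule dominated_stationary_eq_factor[OF N(1), of t]) (use * in auto)
  show "N2 = factor"
    by (rule dominated_stationary_eq_factor[OF N(2), of "1 - t"]) (use * in auto)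
qed

end

section \<open>Linear algebra and topology over the scalar field\<close>

lemma norm_vec_scale: "norm (c *s w) = norm c * norm (w :: 'k::real_normed_field ^ 'n)"
  by (simp add: norm_vec_def norm_mult L2_set_right_distrib)

lemma scaleR_eq_vec_scale: "r *\<^sub>R v = of_real r *s (v :: 'k::real_normed_field ^ 'n)"
  unfolding vec_eq_iff vector_scaleR_component vector_smult_component
  by (simp add: scaleR_conv_of_real)

lemma vec_subspace_imp_subspace:
  fixes W :: "('k::real_normed_field ^ 'n) set"
  shows "vec.subspace W \<Longrightarrow> subspace W"
  by (simp add: vec.subspace_def subspace_def scaleR_eq_vec_scale)

lemma closed_vec_subspace:
  fixes W :: "('k::{real_normed_field, euclidean_space} ^ 'n) set"
  shows "vec.subspace W \<Longrightarrow> closed W"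
  by (intro closed_subspace vec_subspace_imp_subspace)

lemma continuous_on_matrix_vector_mult [continuous_intros]:
  fixes A :: "'a::topological_space \<Rightarrow> 'k::real_normed_field ^ 'n ^ 'm"
  assumes "continuous_on S A" "continuous_on S v"
  shows "continuous_on S (\<lambda>x. A x *v v x)"
  unfolding matrix_vector_mult_def using assms
  by (intro continuous_intros continuous_on_vec_lambda)

lemma continuous_on_matrix_mult [continuous_intros]:
  fixes A :: "'a::topological_space \<Rightarrow> 'k::real_normed_field ^ 'n ^ 'm"
  assumes "continuous_on S A" "continuous_on S B"
  shows "continuous_on S (\<lambda>x. A x ** B x)"
  unfolding matrix_matrix_mult_def using assms
  by (intro continuous_intros continuous_on_vec_lambda)

lemma borel_measurable_matrix_vector_mult:
  fixes A :: "'a \<Rightarrow> 'k::{real_normed_field, euclidean_space} ^ 'n ^ 'm"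
  assumes "A \<in> borel_measurable M" "v \<in> borel_measurable M"
  shows "(\<lambda>x. A x *v v x) \<in> borel_measurable M"
  by (rule borel_measurable_continuous_Pair[OF assms]) (intro continuous_intros)

lemma borel_measurable_matrix_mult:
  fixes A :: "'a \<Rightarrow> 'k::{real_normed_field, euclidean_space} ^ 'n ^ 'm"
  assumes "A \<in> borel_measurable M" "B \<in> borel_measurable M"
  shows "(\<lambda>x. A x ** B x) \<in> borel_measurable M"
  by (rule borel_measurable_continuous_Pair[OF assms]) (intro continuous_intros)

lemma bounded_linear_matrix_vector_mult:
  fixes A :: "'k::{real_normed_field, euclidean_space} ^ 'n ^ 'm"
  shows "bounded_linear ((*v) A)"
  by (rule linear_conv_bounded_linear[THEN iffD1], rule linearI)
    (simp_all add: matrix_vector_right_distrib scaleR_eq_vec_scale vec.scale)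

lemma ex_projection_matrix:
  fixes W :: "('k::field ^ 'n) set"
  assumes "vec.subspace W"
  obtains q :: "'k ^ 'n ^ 'n" where "\<And>v. v \<in> W \<Longrightarrow> q *v v = v" "\<And>v. q *v v \<in> W"
proof -
  obtain f where f: "range f \<subseteq> W" "Vector_Spaces.linear (*s) (*s) f" "\<And>v. v \<in> W \<Longrightarrow> f v = v"
    using vec.linear_exists_left_inverse_on[OF vec.linear_id assms] by auto
  show thesis
    using f by (intro that[of "matrix f"]) (auto simp: matrix_works)
qed

lemma GL_mult_nonzero: "g \<in> GL \<Longrightarrow> v \<noteq> 0 \<Longrightarrow> g *v v \<noteq> (0 :: 'k::field ^ 'n)"
  unfolding GL_def mem_Collect_eq invertible_def
  by (metis matrix_vector_mul_assoc matrix_vector_mul_lid matrix_vector_mult_0_right)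

lemma GL_subspace_image:
  fixes g :: "'k::field ^ 'n ^ 'n"
  assumes g: "g \<in> GL" and W: "vec.subspace W" and inv: "(\<lambda>v. g *v v) ` W \<subseteq> W"
  shows "(\<lambda>v. g *v v) ` W = W"
proof -
  have inj: "inj_on ((*v) g) S" for S
    using GL_mult_nonzero[OF g]
    by (intro inj_onI) (metis eq_iff_diff_eq_0 matrix_vector_mult_diff_distrib)
  have "vec.dim W = vec.dim ((*v) g ` W)"
    by (rule vec.dim_image_eq[symmetric]) (auto intro: inj)
  then show ?thesis
    using vec.subspace_dim_equal[OF vec.subspace_image[OF W] W inv] by simp
qed

lemma GL_mult_mem_iff:
  fixes g :: "'k::field ^ 'n ^ 'n"
  assumes "g \<in> GL" "vec.subspace W" "(\<lambda>v. g *v v) ` W \<subseteq> W"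
  shows "g *v v \<in> W \<longleftrightarrow> v \<in> W"
proof
  assume "g *v v \<in> W"
  then obtain w where "w \<in> W" "g *v v = g *v w"
    using GL_subspace_image[OF assms] by (metis imageE)
  moreover from this(2) have "g *v (v - w) = 0" by (simp add: matrix_vector_mult_diff_distrib)
  ultimately show "v \<in> W" using GL_mult_nonzero[OF assms(1), of "v - w"] by auto
qed (use assms in auto)

section \<open>The Borel structure of projective spaces\<close>

lemma topspace_quotient_topology [simp]: "topspace (quotient_topology X q) = q ` topspace X"
proof (rule antisym)
  show "topspace (quotient_topology X q) \<subseteq> q ` topspace X"
    using openin_topspace[of "quotient_topology X q"] unfolding openin_quotient_topology by blast
  have "{x \<in> topspace X. q x \<in> q ` topspace X} = topspace X" by auto
  then show "q ` topspace X \<subseteq> topspace (quotient_topology X q)"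
    by (intro openin_subset) (simp add: openin_quotient_topology)
qed

lemma space_borel_of [simp]: "space (borel_of X) = topspace X"
  by (simp add: borel_of_def space_measure_of_conv)

lemma sets_borel_of: "sets (borel_of X) = sigma_sets (topspace X) {U. openin X U}"
  unfolding borel_of_def using openin_subset by (intro sets_measure_of) auto

lemma openin_imp_borel_of [intro]: "openin X U \<Longrightarrow> U \<in> sets (borel_of X)"
  by (simp add: sets_borel_of)

lemma measurable_borel_ofI:
  assumes "f \<in> space N \<rightarrow> topspace X"
    and "\<And>U. openin X U \<Longrightarrow> {x \<in> space N. f x \<in> U} \<in> sets N"
  shows "f \<in> N \<rightarrow>\<^sub>M borel_of X"
proof -
  have "f \<in> N \<rightarrow>\<^sub>M sigma (topspace X) {U. openin X U}"
    by (rule measurable_measure_of)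
      (use assms in \<open>auto simp: vimage_def Int_def conj_commute dest: openin_subset\<close>)
  then show ?thesis by (simp add: borel_of_def)
qed

lemma line_eq_range: "line v = range (\<lambda>c. c *s v)"
  by (simp add: line_def vec.span_singleton)

lemma line_scale:
  assumes "c \<noteq> 0"
  shows "line (c *s v) = line v"
proof -
  have "b *s v \<in> range (\<lambda>a. a *s (c *s v))" for b
    using assms by (intro image_eqI[of _ _ "b / c"]) simp_all
  moreover have "a *s (c *s v) \<in> range (\<lambda>b. b *s v)" for a
    by (intro image_eqI[of _ _ "a * c"]) simp_all
  ultimately show ?thesis unfolding line_eq_range by blast
qed

lemma mem_line: "v \<in> line v"
  by (simp add: line_def vec.span_base)

lemma proj_act_line: "proj_act g (line v) = line (g *v v)"
  unfolding proj_act_def line_eq_range by (auto simp: vec.scale image_iff)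

lemma space_proj_borel: "space proj_borel = proj UNIV"
  by (simp add: proj_borel_def proj_def Compl_eq_Diff_UNIV)

lemma proj_cases:
  assumes "L \<in> space proj_borel"
  obtains v where "v \<noteq> 0" "L = line v"
  using assms by (auto simp: space_proj_borel proj_def)

lemma line_in_space: "v \<noteq> 0 \<Longrightarrow> line v \<in> space proj_borel"
  by (auto simp: space_proj_borel proj_def)

lemma line_subset_subspace: "vec.subspace W \<Longrightarrow> v \<in> W \<Longrightarrow> line v \<subseteq> W"
  by (auto simp: line_eq_range vec.subspace_scale)

lemma line_mem_proj_iff:
  assumes "vec.subspace W" "v \<noteq> 0"
  shows "line v \<in> proj W \<longleftrightarrow> v \<in> W"
  using assms line_subset_subspace mem_line[of v] unfolding proj_def by fastforce

lemma openin_proj: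
  "openin (quotient_topology (top_of_set (- {0})) line) U \<longleftrightarrow>
    U \<subseteq> proj UNIV \<and> open {v :: 'k::{real_normed_field, euclidean_space} ^ 'n. v \<noteq> 0 \<and> line v \<in> U}"
proof -
  have "open (- {0} :: ('k ^ 'n) set)" by (intro open_Compl closed_singleton)
  moreover have "{x \<in> topspace (top_of_set (- {0})). line x \<in> U} = {v :: 'k ^ 'n. v \<noteq> 0 \<and> line v \<in> U}"
    by auto
  ultimately show ?thesis
    by (auto simp: openin_quotient_topology proj_def Compl_eq_Diff_UNIV openin_open_eq)
qed

lemma line_measurable:
  fixes f :: "'a \<Rightarrow> 'k::{real_normed_field, euclidean_space} ^ 'n"
  assumes [measurable]: "f \<in> borel_measurable N" and "\<And>x. x \<in> space N \<Longrightarrow> f x \<noteq> 0"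
  shows "(\<lambda>x. line (f x)) \<in> N \<rightarrow>\<^sub>M proj_borel"
  unfolding proj_borel_def
proof (rule measurable_borel_ofI)
  show "(\<lambda>x. line (f x)) \<in> space N \<rightarrow> topspace (quotient_topology (top_of_set (- {0})) line)"
    using assms by auto
  fix U :: "('k ^ 'n) set set" assume "openin (quotient_topology (top_of_set (- {0})) line) U"
  then have [measurable]: "{v. v \<noteq> 0 \<and> line v \<in> U} \<in> sets borel" by (simp add: openin_proj)
  have "{x \<in> space N. line (f x) \<in> U} = {x \<in> space N. f x \<in> {v. v \<noteq> 0 \<and> line v \<in> U}}"
    using assms by auto
  also have "\<dots> \<in> sets N" by measurable
  finally show "{x \<in> space N. line (f x) \<in> U} \<in> sets N" .
qed

text \<open>Normalising one coordinate to 1 is a continuous choice of a vector on each line of the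
  corresponding affine chart; finitely many charts cover the projective space.\<close>

lemma ex_measurable_section:
  "\<exists>s \<in> borel_measurable (proj_borel :: ('k::{real_normed_field, euclidean_space} ^ 'n) set measure).
     \<forall>L\<in>space proj_borel. s L \<noteq> 0 \<and> line (s L) = L"
proof -
  define chart :: "'n \<Rightarrow> ('k ^ 'n) set set" where "chart j = {line v | v. v $ j \<noteq> 0}" for j
  define normalised :: "'n \<Rightarrow> ('k ^ 'n) set \<Rightarrow> 'k ^ 'n"
    where "normalised j L = (THE u. u \<in> L \<and> u $ j = 1)" for j L
  have normalised: "normalised j (line v) = (1 / v $ j) *s v" if "v $ j \<noteq> 0" for v j
    unfolding normalised_def using that by (intro the_equality) (auto simp: line_eq_range eq_divide_eq)
  have line_chart: "line v \<in> chart j \<longleftrightarrow> v $ j \<noteq> 0" for v j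
  proof
    assume "line v \<in> chart j"
    then obtain u where "line v = line u" "u $ j \<noteq> 0" by (auto simp: chart_def)
    then obtain c where "u = c *s v" using mem_line[of u] by (auto simp: line_eq_range)
    with \<open>u $ j \<noteq> 0\<close> show "v $ j \<noteq> 0" by auto
  qed (auto simp: chart_def)
  have openin_chart: "{L \<in> chart j. normalised j L \<in> S} \<in> sets proj_borel" if "open S" for j S
  proof -
    have cont: "continuous_on {v :: 'k ^ 'n. v $ j \<noteq> 0} (\<lambda>v. (1 / v $ j) *s v)"
      unfolding vector_scalar_mult_def by (intro continuous_intros continuous_on_vec_lambda) auto
    have "open {v :: 'k ^ 'n. v $ j \<noteq> 0}"
      by (intro open_Collect_neq continuous_intros)
    from continuous_open_preimage[OF cont this \<open>open S\<close>]
    have "open {v :: 'k ^ 'n. v $ j \<noteq> 0 \<and> (1 / v $ j) *s v \<in> S}"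
      by (simp add: Int_def vimage_def)
    also have "{v :: 'k ^ 'n. v $ j \<noteq> 0 \<and> (1 / v $ j) *s v \<in> S} =
        {v. v \<noteq> 0 \<and> line v \<in> {L \<in> chart j. normalised j L \<in> S}}"
      by (auto simp: line_chart normalised)
    finally have "openin (quotient_topology (top_of_set (- {0})) line) {L \<in> chart j. normalised j L \<in> S}"
      unfolding openin_proj by (force simp: chart_def proj_def)
    then show ?thesis unfolding proj_borel_def by (rule openin_imp_borel_of)
  qed
  have "\<exists>s\<in>borel_measurable proj_borel. \<forall>j\<in>J. \<forall>L\<in>chart j. s L \<noteq> 0 \<and> line (s L) = L"
    if "finite J" for J
    using that
  proof (induction J)
    case empty
    show ?case by (intro bexI[of _ "\<lambda>_. 0"]) auto
  next
    case (insert j J)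
    then obtain s where s [measurable]: "s \<in> borel_measurable proj_borel"
      and s_J: "\<And>j L. j \<in> J \<Longrightarrow> L \<in> chart j \<Longrightarrow> s L \<noteq> 0 \<and> line (s L) = L" by blast
    let ?s = "\<lambda>L. if L \<in> chart j then normalised j L else s L"
    show ?case
    proof (intro bexI ballI)
      show "?s \<in> borel_measurable proj_borel"
      proof (rule borel_measurableI)
        fix S :: "('k ^ 'n) set" assume S: "open S"
        have [measurable]: "{L \<in> chart j. normalised j L \<in> S} \<in> sets proj_borel"
          "chart j \<in> sets proj_borel"
          using openin_chart[OF S, of j] openin_chart[OF open_UNIV, of j] by auto
        have [measurable]: "S \<in> sets borel" using S by auto
        have "?s -` S \<inter> space proj_borel =
            {L \<in> chart j. normalised j L \<in> S} \<union> ({L \<in> space proj_borel. s L \<in> S} - chart j)"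
          using sets.sets_into_space[of "chart j" proj_borel] by (auto split: if_splits)
        also have "\<dots> \<in> sets proj_borel" by measurable
        finally show "?s -` S \<inter> space proj_borel \<in> sets proj_borel" .
      qed
      fix i L assume i: "i \<in> insert j J" "L \<in> chart i"
      show "?s L \<noteq> 0 \<and> line (?s L) = L"
      proof (cases "L \<in> chart j")
        case True
        then obtain v where v: "L = line v" "v $ j \<noteq> 0" by (auto simp: chart_def)
        then have "v \<noteq> 0" by auto
        with v show ?thesis using True by (simp add: normalised line_scale)
      next
        case False
        then show ?thesis using s_J[of i L] i by auto
      qed
    qed
  qed
  from this[of UNIV] obtain s where s: "s \<in> borel_measurable proj_borel"
    "\<And>j L. L \<in> chart j \<Longrightarrow> s L \<noteq> 0 \<and> line (s L) = L" by auto
  have "s L \<noteq> 0 \<and> line (s L) = L" if L: "L \<in> space proj_borel" for L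
  proof -
    from L obtain v where v: "v \<noteq> 0" "L = line v" by (rule proj_cases)
    then obtain j where "v $ j \<noteq> 0" by (auto simp: vec_eq_iff)
    then show ?thesis using s(2)[of L j] v by (simp add: line_chart)
  qed
  with s(1) show ?thesis by blast
qed

text \<open>A measurable choice of a nonzero vector on each line, which reduces measurability questions on
  the projective space to questions about vectors.\<close>

definition rep :: "('k::{real_normed_field, euclidean_space} ^ 'n) set \<Rightarrow> 'k ^ 'n" where
  "rep = (SOME s. s \<in> borel_measurable proj_borel \<and> (\<forall>L\<in>space proj_borel. s L \<noteq> 0 \<and> line (s L) = L))"

lemma
  shows rep_measurable [measurable]: "rep \<in> borel_measurable proj_borel"
    and rep: "L \<in> space proj_borel \<Longrightarrow> rep L \<noteq> 0 \<and> line (rep L) = L"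
proof -
  note * = someI_ex[OF ex_measurable_section[unfolded Bex_def], folded rep_def]
  show "rep \<in> borel_measurable proj_borel"
    "L \<in> space proj_borel \<Longrightarrow> rep L \<noteq> 0 \<and> line (rep L) = L" using * by blast+
qed

lemma mem_proj_iff_rep:
  assumes "vec.subspace W" "L \<in> space proj_borel"
  shows "L \<in> proj W \<longleftrightarrow> rep L \<in> W"
  using line_mem_proj_iff[OF assms(1), of "rep L"] rep[OF assms(2)] by simp

lemma proj_sets:
  fixes W :: "('k::{real_normed_field, euclidean_space} ^ 'n) set"
  assumes "vec.subspace W"
  shows "proj W \<in> sets proj_borel"
proof -
  have [measurable]: "W \<in> sets borel" using closed_vec_subspace[OF assms] by auto
  have "proj W = {L \<in> space proj_borel. rep L \<in> W}"
    using mem_proj_iff_rep[OF assms] by (auto simp: space_proj_borel proj_def)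
  also have "\<dots> \<in> sets proj_borel" by measurable
  finally show ?thesis .
qed

lemma log_expansion_eq_rep:
  assumes "L \<in> space proj_borel"
  shows "log_expansion g L = ln (norm (g *v rep L) / norm (rep L))"
  using log_expansion_line[of "rep L" g] rep[OF assms] by simp

lemma random_action_proj:
  fixes \<mu> :: "('k::{real_normed_field, euclidean_space} ^ 'n ^ 'n) measure"
  assumes "prob_space \<mu>" and sets: "sets \<mu> = sets (restrict_space borel GL)"
  shows "random_action \<mu> proj_borel proj_act"
proof -
  interpret prob_space \<mu> by fact
  have space: "space \<mu> = GL" using sets_eq_imp_space_eq[OF sets] by (simp add: space_restrict_space)
  have id [measurable]: "(\<lambda>g. g) \<in> \<mu> \<rightarrow>\<^sub>M borel"
    by (simp add: measurable_cong_sets[OF sets refl] measurable_restrict_space1)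
  have "(\<lambda>z. snd z *v rep (fst z)) \<in> borel_measurable (proj_borel \<Otimes>\<^sub>M \<mu>)"
    by (intro borel_measurable_matrix_vector_mult measurable_compose[OF measurable_snd id]) measurable
  then have "(\<lambda>z. line (snd z *v rep (fst z))) \<in> proj_borel \<Otimes>\<^sub>M \<mu> \<rightarrow>\<^sub>M proj_borel"
    by (rule line_measurable) (auto simp: space_pair_measure space dest: GL_mult_nonzero[OF _ conjunct1[OF rep]])
  also have "?this \<longleftrightarrow> (\<lambda>(x, g). proj_act g x) \<in> proj_borel \<Otimes>\<^sub>M \<mu> \<rightarrow>\<^sub>M proj_borel"
  proof (rule measurable_cong)
    fix z :: "('k ^ 'n) set \<times> ('k ^ 'n ^ 'n)" assume "z \<in> space (proj_borel \<Otimes>\<^sub>M \<mu>)"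
    then have "line (rep (fst z)) = fst z"
      by (intro rep[THEN conjunct2]) (auto simp: space_pair_measure)
    with proj_act_line[of "snd z" "rep (fst z)"]
    show "line (snd z *v rep (fst z)) = (case z of (x, g) \<Rightarrow> proj_act g x)"
      by (simp add: split_beta')
  qed
  finally show ?thesis by unfold_locales
qed

subsection \<open>Quotients\<close>

lemma coset_eq_iff:
  assumes W: "vec.subspace W"
  shows "coset W a = coset W b \<longleftrightarrow> a - b \<in> W"
proof
  assume eq: "coset W a = coset W b"
  have "a \<in> coset W a" using vec.subspace_0[OF W] by (auto simp: coset_def image_iff intro!: bexI[of _ 0])
  then obtain w where "w \<in> W" "a = b + w" unfolding eq by (auto simp: coset_def)
  then show "a - b \<in> W" by simp
next
  assume ab: "a - b \<in> W"
  have "a + w = b + ((a - b) + w)" "b + w = a + (w - (a - b))" for w by auto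
  then show "coset W a = coset W b"
    unfolding coset_def using vec.subspace_add[OF W ab] vec.subspace_diff[OF W _ ab]
    by (metis (no_types, lifting) image_eqI image_subsetI subset_antisym)
qed

lemma quot_line_cong:
  assumes W: "vec.subspace W" and "a - b \<in> W"
  shows "quot_line W a = quot_line W b"
proof -
  have "coset W (c *s a) = coset W (c *s b)" for c
    using vec.subspace_scale[OF W assms(2), of c] by (simp add: coset_eq_iff[OF W] vec.scale_right_diff_distrib)
  then show ?thesis by (simp add: quot_line_def line_eq_range image_image)
qed

lemma proj_act_coset:
  assumes W: "(\<lambda>v. g *v v) ` W = W"
  shows "proj_act g (coset W v) = coset W (g *v v)"
proof -
  have "proj_act g (coset W v) = (\<lambda>w. g *v v + w) ` ((\<lambda>v. g *v v) ` W)"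
    by (simp add: proj_act_def coset_def image_image matrix_vector_right_distrib)
  then show ?thesis by (simp add: W coset_def)
qed

text \<open>The projection along \<open>W\<close> onto a complement of \<open>W\<close> kills the differences inside a coset,
  so it maps the union of the cosets that make up a point of the quotient to a single line.\<close>

definition quot_section :: "'k::field ^ 'n ^ 'n \<Rightarrow> ('k ^ 'n) set set \<Rightarrow> ('k ^ 'n) set" where
  "quot_section q y = (\<lambda>u. u - q *v u) ` \<Union> y"

text \<open>The matrix \<open>q\<close> is a projection onto \<open>W\<close>, so \<open>v - q v\<close> is the projection along \<open>W\<close> to a complement.\<close>

locale quotient_flag =
  fixes V' W :: "('k::{real_normed_field, euclidean_space} ^ 'n) set" and q :: "'k ^ 'n ^ 'n"
  assumes V': "vec.subspace V'" and W: "vec.subspace W" and W_sub: "W \<subseteq> V'"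
    and q_W: "\<And>v. v \<in> W \<Longrightarrow> q *v v = v" and q_range: "\<And>v. q *v v \<in> W"
begin

abbreviation \<Omega> :: "('k ^ 'n) set set" where "\<Omega> \<equiv> proj V' - proj W"

abbreviation Q :: "('k ^ 'n) set set measure" where "Q \<equiv> quot_proj_borel V' W"

lemma \<Omega>_sets: "\<Omega> \<in> sets proj_borel"
  using proj_sets[OF V'] proj_sets[OF W] by auto

lemma line_mem_\<Omega>: "v \<noteq> 0 \<Longrightarrow> line v \<in> \<Omega> \<longleftrightarrow> v \<in> V' - W"
  using line_mem_proj_iff[OF V'] line_mem_proj_iff[OF W] by auto

lemma \<Omega>_cases:
  assumes "L \<in> \<Omega>"
  obtains v where "v \<in> V' - W" "v \<noteq> 0" "L = line v"
  using assms line_mem_\<Omega> by (auto simp: proj_def)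

lemma space_Q: "space Q = quot_line W ` (V' - W)"
  by (simp add: quot_proj_borel_def)

lemma complement_nonzero: "v \<notin> W \<Longrightarrow> v - q *v v \<noteq> 0"
  using q_range[of v] by auto

lemma complement_mem: "v \<in> V' - W \<Longrightarrow> v - q *v v \<in> V' - W"
  using q_range[of v] W_sub vec.subspace_diff[OF V', of v "q *v v"] vec.subspace_add[OF W, of "v - q *v v" "q *v v"]
  by auto

lemma quot_section_quot_line: "quot_section q (quot_line W v) = line (v - q *v v)"
proof -
  have *: "(c *s v + w) - q *v (c *s v + w) = c *s (v - q *v v)" if "w \<in> W" for c w
    using q_W[OF that] by (simp add: matrix_vector_right_distrib vec.scale vec.scale_right_diff_distrib)
  have "quot_section q (quot_line W v) = (\<Union>c. (\<lambda>w. (c *s v + w) - q *v (c *s v + w)) ` W)"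
    unfolding quot_section_def quot_line_def line_eq_range coset_def image_Union image_image ..
  also have "\<dots> = (\<Union>c. (\<lambda>w. c *s (v - q *v v)) ` W)"
    using * by (intro SUP_cong image_cong refl)
  also have "\<dots> = line (v - q *v v)"
    using vec.subspace_0[OF W] by (auto simp: line_eq_range)
  finally show ?thesis .
qed

lemma quot_proj_measurable: "(\<lambda>L. coset W ` L) \<in> restrict_space proj_borel \<Omega> \<rightarrow>\<^sub>M Q"
  unfolding quot_proj_borel_def
proof (rule measurable_borel_ofI)
  have space: "space (restrict_space proj_borel \<Omega>) = \<Omega>"
    using sets.sets_into_space[OF \<Omega>_sets] by (auto simp: space_restrict_space)
  have rep_\<Omega>: "rep L \<in> V' - W" "coset W ` L = quot_line W (rep L)" if "L \<in> \<Omega>" for L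
    using that rep[of L] sets.sets_into_space[OF \<Omega>_sets] line_mem_\<Omega>[of "rep L"] by (auto simp: quot_line_def)
  show "(\<lambda>L. coset W ` L) \<in> space (restrict_space proj_borel \<Omega>) \<rightarrow>
      topspace (quotient_topology (top_of_set (V' - W)) (quot_line W))"
    using rep_\<Omega> unfolding space by auto
  fix U assume "openin (quotient_topology (top_of_set (V' - W)) (quot_line W)) U"
  then obtain S where S: "open S" "{v \<in> V' - W. quot_line W v \<in> U} = (V' - W) \<inter> S"
    by (auto simp: openin_quotient_topology openin_open)
  have iff: "coset W ` L \<in> U \<longleftrightarrow> rep L \<in> S" if "L \<in> \<Omega>" for L
  proof -
    have "rep L \<in> {v \<in> V' - W. quot_line W v \<in> U} \<longleftrightarrow> rep L \<in> (V' - W) \<inter> S"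
      by (simp only: S(2))
    then show ?thesis using rep_\<Omega>[OF that] by simp
  qed
  have "{L \<in> \<Omega>. coset W ` L \<in> U} = {L \<in> \<Omega>. rep L \<in> S}"
    by (intro Collect_cong conj_cong refl iff)
  also have "\<dots> = \<Omega> \<inter> {L \<in> space proj_borel. rep L \<in> S}"
    using sets.sets_into_space[OF \<Omega>_sets] by auto
  also have "\<dots> \<in> sets (restrict_space proj_borel \<Omega>)"
  proof -
    have [measurable]: "S \<in> sets borel" using S(1) by (rule borel_open)
    have "{L \<in> space proj_borel. rep L \<in> S} \<in> sets proj_borel" by measurable
    then show ?thesis unfolding sets_restrict_space by (rule imageI)
  qed
  finally show "{L \<in> space (restrict_space proj_borel \<Omega>). coset W ` L \<in> U} \<in> sets (restrict_space proj_borel \<Omega>)"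
    by (simp add: space)
qed

lemma quot_section_measurable: "quot_section q \<in> Q \<rightarrow>\<^sub>M restrict_space proj_borel \<Omega>"
proof (rule measurable_restrict_space2)
  show "quot_section q \<in> space Q \<rightarrow> \<Omega>"
  proof
    fix y assume "y \<in> space Q"
    then obtain v where v: "v \<in> V' - W" "y = quot_line W v" by (auto simp: space_Q)
    then show "quot_section q y \<in> \<Omega>"
      using complement_mem[of v] complement_nonzero[of v] line_mem_\<Omega>[of "v - q *v v"]
      by (simp add: quot_section_quot_line)
  qed
  show "quot_section q \<in> Q \<rightarrow>\<^sub>M proj_borel"
    unfolding proj_borel_def
  proof (rule measurable_borel_ofI)
    show "quot_section q \<in> space Q \<rightarrow> topspace (quotient_topology (top_of_set (- {0})) line)"
      using complement_nonzero by (auto simp: space_Q quot_section_quot_line)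
    fix U :: "('k ^ 'n) set set" assume "openin (quotient_topology (top_of_set (- {0})) line) U"
    then have U: "open {v. v \<noteq> 0 \<and> line v \<in> U}" by (simp add: openin_proj)
    have "continuous_on (V' - W) (\<lambda>v. v - q *v v)" by (intro continuous_intros)
    from continuous_openin_preimage_gen[OF this U]
    have "openin (top_of_set (V' - W)) ((V' - W) \<inter> (\<lambda>v. v - q *v v) -` {v. v \<noteq> 0 \<and> line v \<in> U})" .
    also have "(V' - W) \<inter> (\<lambda>v. v - q *v v) -` {v. v \<noteq> 0 \<and> line v \<in> U} =
        {v \<in> V' - W. quot_section q (quot_line W v) \<in> U}"
      using complement_nonzero by (auto simp: quot_section_quot_line)
    finally have "openin (top_of_set (V' - W)) {v \<in> V' - W. quot_section q (quot_line W v) \<in> U}" .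
    moreover have "{v \<in> V' - W. quot_line W v \<in> {y \<in> space Q. quot_section q y \<in> U}} =
        {v \<in> V' - W. quot_section q (quot_line W v) \<in> U}"
      by (auto simp: space_Q)
    ultimately have "openin (quotient_topology (top_of_set (V' - W)) (quot_line W))
        {y \<in> space Q. quot_section q y \<in> U}"
      by (auto simp: openin_quotient_topology space_Q)
    then show "{y \<in> space Q. quot_section q y \<in> U} \<in> sets Q"
      unfolding quot_proj_borel_def by (rule openin_imp_borel_of)
  qed
qed

lemma quot_proj_section: "y \<in> space Q \<Longrightarrow> (\<lambda>L. coset W ` L) (quot_section q y) = y"
proof -
  assume "y \<in> space Q"
  then obtain v where v: "y = quot_line W v" by (auto simp: space_Q)
  have "quot_line W (v - q *v v) = quot_line W v"
    using q_range[of v] vec.subspace_neg[OF W] by (intro quot_line_cong[OF W]) simp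
  then show ?thesis by (simp add: v quot_section_quot_line quot_line_def[of W "v - q *v v"])
qed

lemma quot_section_proj: "v \<notin> W \<Longrightarrow> quot_section q (coset W ` line v) = line (v - q *v v)"
  using quot_section_quot_line by (simp add: quot_line_def)

text \<open>An invertible map that sends a subspace into itself sends it onto itself, by dimension, so it
  preserves the complement of \<open>W\<close> and maps cosets to cosets.\<close>

lemma quot_equivariant:
  assumes g: "g \<in> GL" "(\<lambda>v. g *v v) ` V' \<subseteq> V'" "(\<lambda>v. g *v v) ` W \<subseteq> W" and L: "L \<in> \<Omega>"
  shows "proj_act g L \<in> \<Omega> \<and> coset W ` proj_act g L = quot_proj_act g (coset W ` L)"
proof -
  obtain v where v: "v \<in> V' - W" "v \<noteq> 0" "L = line v" using L by (rule \<Omega>_cases)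
  have "g *v v \<in> V' - W" "g *v v \<noteq> 0"
    using v GL_mult_mem_iff[OF g(1) V' g(2)] GL_mult_mem_iff[OF g(1) W g(3)] GL_mult_nonzero[OF g(1)] by auto
  moreover have "coset W ` proj_act g L = proj_act g ` coset W ` L"
    using proj_act_coset[OF GL_subspace_image[OF g(1) W g(3)]]
    by (simp add: image_image) (simp add: proj_act_def[of g L] image_image)
  ultimately show ?thesis
    using line_mem_\<Omega> by (simp add: v(3) proj_act_line quot_proj_act_def)
qed

end

section \<open>Growth rates of vectors\<close>

lemma eventually_le_exp:
  fixes C e :: real
  assumes "0 < e"
  shows "\<forall>\<^sub>F n in sequentially. C \<le> exp (real n * e)"
proof -
  obtain N :: nat where N: "C / e < real N" using reals_Archimedean2 by blast
  have "C \<le> exp (real n * e)" if "n \<ge> N" for n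
  proof -
    have "C / e \<le> real n" using N that by (meson less_imp_le of_nat_le_iff order_trans)
    then have "C \<le> real n * e" using assms by (simp add: pos_divide_le_eq)
    also have "\<dots> \<le> exp (real n * e)" using exp_ge_add_one_self[of "real n * e"] by linarith
    finally show ?thesis .
  qed
  then show ?thesis by (auto simp: eventually_sequentially)
qed

text \<open>Half of the margin \<open>e\<close> in an exponential rate pays for a constant factor.\<close>

lemma eventually_absorb_factor:
  fixes C b e :: real
  assumes "0 < e"
  shows "\<forall>\<^sub>F n in sequentially. C * exp (real n * (b + e / 2)) \<le> exp (real n * (b + e))"
  using eventually_le_exp[OF half_gt_zero[OF assms], of C]
proof eventually_elim
  case (elim n)
  have "C * exp (real n * (b + e / 2)) \<le> exp (real n * (e / 2)) * exp (real n * (b + e / 2))"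
    by (rule mult_right_mono) (use elim assms in auto)
  also have "\<dots> = exp (real n * (b + e))" by (simp add: exp_add[symmetric] algebra_simps)
  finally show ?case .
qed

locale random_matrix = prob_space \<mu>
  for \<mu> :: "('k::{real_normed_field, euclidean_space} ^ 'n ^ 'n) measure" +
  assumes sets_\<mu>: "sets \<mu> = sets (restrict_space borel GL)"
begin

sublocale random_action \<mu> proj_borel proj_act
  by (rule random_action_proj) (fact prob_space_axioms sets_\<mu>)+

lemma space_\<mu>: "space \<mu> = GL"
  using sets_eq_imp_space_eq[OF sets_\<mu>] by (simp add: space_restrict_space)

lemma borel_measurable_increment [measurable]: "(\<lambda>g. g) \<in> borel_measurable \<mu>"
  by (simp add: measurable_cong_sets[OF sets_\<mu> refl] measurable_restrict_space1)

lemma increments_GL: "\<omega> \<in> space increments \<Longrightarrow> \<omega> n \<in> GL"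
  by (simp add: space_increments space_\<mu>)

lemma left_walk_GL: "\<omega> \<in> space increments \<Longrightarrow> left_walk \<omega> n \<in> GL"
proof (induction n)
  case 0
  show ?case by (auto simp: GL_def invertible_def intro!: exI[of _ "mat 1"])
next
  case (Suc n)
  then show ?case using increments_GL[of \<omega> n] by (simp add: GL_def invertible_mult)
qed

lemma left_walk_nonzero: "\<omega> \<in> space increments \<Longrightarrow> v \<noteq> 0 \<Longrightarrow> left_walk \<omega> n *v v \<noteq> 0"
  by (intro GL_mult_nonzero left_walk_GL)

lemma left_walk_case_nat: "left_walk (case_nat g \<omega>) (Suc n) = left_walk \<omega> n ** g"
proof (induction n)
  case (Suc n)
  have "left_walk (case_nat g \<omega>) (Suc (Suc n)) = \<omega> n ** left_walk (case_nat g \<omega>) (Suc n)"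
    by simp
  also have "\<dots> = left_walk \<omega> (Suc n) ** g"
    unfolding Suc by (simp add: matrix_mul_assoc)
  finally show ?case .
qed simp

lemma orbit_line: "orbit \<omega> n (line v) = line (left_walk \<omega> n *v v)"
  by (induction n) (simp_all add: proj_act_line matrix_vector_mul_assoc)

lemma left_walk_measurable [measurable]: "(\<lambda>\<omega>. left_walk \<omega> n) \<in> borel_measurable increments"
proof (induction n)
  case (Suc n)
  have "(\<lambda>\<omega>. \<omega> n) \<in> increments \<rightarrow>\<^sub>M \<mu>" by (rule measurable_component_singleton) simp
  then have "(\<lambda>\<omega>. \<omega> n) \<in> borel_measurable increments"
    by (rule measurable_compose[OF _ borel_measurable_increment])
  from borel_measurable_matrix_mult[OF this Suc] show ?case unfolding left_walk.simps .
next
  case 0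
  show ?case unfolding left_walk.simps by (rule borel_measurable_const)
qed

text \<open>The limit superior of the exponential growth rate of \<open>v\<close> along \<open>\<omega>\<close> is at most \<open>b\<close>. Bounding
  the norm instead of its logarithm treats \<open>v = 0\<close> correctly, although \<open>ln 0 = 0\<close>.\<close>

definition growth_le :: "(nat \<Rightarrow> 'k ^ 'n ^ 'n) \<Rightarrow> 'k ^ 'n \<Rightarrow> real \<Rightarrow> bool" where
  "growth_le \<omega> v b \<longleftrightarrow>
     (\<forall>e>0. \<forall>\<^sub>F n in sequentially. norm (left_walk \<omega> n *v v) \<le> exp (real n * (b + e)))"

definition slow :: "real \<Rightarrow> ('k ^ 'n) set" where
  "slow b = {v. AE \<omega> in increments. growth_le \<omega> v b}"

lemma growth_leD:
  "growth_le \<omega> v b \<Longrightarrow> 0 < e \<Longrightarrow> \<forall>\<^sub>F n in sequentially. norm (left_walk \<omega> n *v v) \<le> exp (real n * (b + e))"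
  by (simp add: growth_le_def)

lemma growth_le_add:
  assumes "growth_le \<omega> u b" "growth_le \<omega> v b"
  shows "growth_le \<omega> (u + v) b"
  unfolding growth_le_def
proof (intro allI impI)
  fix e :: real assume e: "0 < e"
  from eventually_absorb_factor[OF e, of 2 b] growth_leD[OF assms(1) half_gt_zero[OF e]]
    growth_leD[OF assms(2) half_gt_zero[OF e]]
  show "\<forall>\<^sub>F n in sequentially. norm (left_walk \<omega> n *v (u + v)) \<le> exp (real n * (b + e))"
  proof eventually_elim
    case (elim n)
    then show ?case
      using norm_triangle_ineq[of "left_walk \<omega> n *v u" "left_walk \<omega> n *v v"]
      by (simp add: matrix_vector_right_distrib)
  qed
qed

lemma growth_le_scale:
  assumes "growth_le \<omega> v b"
  shows "growth_le \<omega> (c *s v) b"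
  unfolding growth_le_def
proof (intro allI impI)
  fix e :: real assume e: "0 < e"
  from eventually_absorb_factor[OF e, of "norm c" b] growth_leD[OF assms half_gt_zero[OF e]]
  show "\<forall>\<^sub>F n in sequentially. norm (left_walk \<omega> n *v (c *s v)) \<le> exp (real n * (b + e))"
  proof eventually_elim
    case (elim n)
    have "norm (left_walk \<omega> n *v (c *s v)) = norm c * norm (left_walk \<omega> n *v v)"
      by (simp add: vec.scale norm_vec_scale)
    also have "\<dots> \<le> norm c * exp (real n * (b + e / 2))"
      by (intro mult_left_mono elim(2)) simp
    finally show ?case using elim(1) by simp
  qed
qed

lemma growth_le_mono:
  assumes "growth_le \<omega> v a" "a \<le> b"
  shows "growth_le \<omega> v b"
  unfolding growth_le_def
proof (intro allI impI)
  fix e :: real assume "0 < e"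
  from growth_leD[OF assms(1) this]
  show "\<forall>\<^sub>F n in sequentially. norm (left_walk \<omega> n *v v) \<le> exp (real n * (b + e))"
  proof eventually_elim
    case (elim n)
    moreover have "exp (real n * (a + e)) \<le> exp (real n * (b + e))"
      using assms(2) by (simp add: mult_left_mono)
    ultimately show ?case by linarith
  qed
qed

lemma subspace_slow: "vec.subspace (slow b)"
  unfolding vec.subspace_def
proof (intro conjI ballI allI)
  show "0 \<in> slow b" by (simp add: slow_def growth_le_def)
  fix u v assume "u \<in> slow b" "v \<in> slow b"
  then have "AE \<omega> in increments. growth_le \<omega> u b" "AE \<omega> in increments. growth_le \<omega> v b"
    by (simp_all add: slow_def)
  then have "AE \<omega> in increments. growth_le \<omega> (u + v) b"
    by eventually_elim (rule growth_le_add)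
  then show "u + v \<in> slow b" by (simp add: slow_def)
next
  fix c and v assume "v \<in> slow b"
  then have "AE \<omega> in increments. growth_le \<omega> v b" by (simp add: slow_def)
  then have "AE \<omega> in increments. growth_le \<omega> (c *s v) b"
    by eventually_elim (rule growth_le_scale)
  then show "c *s v \<in> slow b" by (simp add: slow_def)
qed

lemma slow_mono:
  assumes "a \<le> b"
  shows "slow a \<subseteq> slow b"
  unfolding slow_def using growth_le_mono[OF _ assms] by (auto elim!: eventually_mono)

text \<open>Dropping the first of the increments shifts \<open>n\<close> by one, which costs a constant factor.\<close>

lemma growth_le_drop_first:
  assumes "growth_le (case_nat g \<omega>) v b"
  shows "growth_le \<omega> (g *v v) b"
  unfolding growth_le_def
proof (intro allI impI)
  fix e :: real assume e: "0 < e"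
  from growth_leD[OF assms half_gt_zero[OF e]]
  have "\<forall>\<^sub>F n in sequentially.
      norm (left_walk (case_nat g \<omega>) (Suc n) *v v) \<le> exp (real (Suc n) * (b + e / 2))"
    by (subst eventually_sequentially_Suc)
  with eventually_absorb_factor[OF e, of "exp (b + e / 2)" b]
  show "\<forall>\<^sub>F n in sequentially. norm (left_walk \<omega> n *v (g *v v)) \<le> exp (real n * (b + e))"
  proof eventually_elim
    case (elim n)
    have "norm (left_walk \<omega> n *v (g *v v)) = norm (left_walk (case_nat g \<omega>) (Suc n) *v v)"
      unfolding left_walk_case_nat by (simp only: matrix_vector_mul_assoc)
    also have "\<dots> \<le> exp (real (Suc n) * (b + e / 2))" by (rule elim(2))
    also have "\<dots> = exp (b + e / 2) * exp (real n * (b + e / 2))"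
      by (simp add: exp_add[symmetric] algebra_simps)
    finally show ?case using elim(1) by simp
  qed
qed

lemma AE_slow:
  assumes "v \<in> slow b"
  shows "AE g in \<mu>. g *v v \<in> slow b"
proof -
  have "AE \<omega> in increments. growth_le \<omega> v b" using assms by (simp add: slow_def)
  from AE_increments_case_nat[OF this] show ?thesis
    unfolding slow_def mem_Collect_eq
    by eventually_elim (auto elim!: eventually_mono intro: growth_le_drop_first)
qed

text \<open>An almost sure closed condition holds on the support: a violation would hold on a
  neighbourhood, which has positive measure.\<close>

lemma msupport_mem_closed:
  assumes "AE g in \<mu>. g *v v \<in> W" and "closed W" and g: "g \<in> msupport \<mu>"
  shows "g *v v \<in> W"
proof (rule ccontr)
  assume "g *v v \<notin> W"
  have "continuous_on UNIV (\<lambda>g :: 'k ^ 'n ^ 'n. g *v v)" by (intro continuous_intros)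
  then have "open ((\<lambda>g. g *v v) -` (- W))"
    using \<open>closed W\<close> by (intro open_vimage) auto
  moreover from this have U: "(\<lambda>g. g *v v) -` (- W) \<inter> space \<mu> \<in> sets \<mu>"
    using measurable_sets[OF borel_measurable_increment borel_open] by simp
  ultimately have "0 < emeasure \<mu> ((\<lambda>g. g *v v) -` (- W) \<inter> space \<mu>)"
    using g \<open>g *v v \<notin> W\<close> unfolding msupport_def by blast
  moreover have "emeasure \<mu> ((\<lambda>g. g *v v) -` (- W) \<inter> space \<mu>) = 0"
  proof -
    have "(\<lambda>g. g *v v) -` (- W) \<inter> space \<mu> = {g \<in> space \<mu>. \<not> g *v v \<in> W}" by auto
    from AE_iff_measurable[OF U this[symmetric]] assms(1) show ?thesis by simp
  qed
  ultimately show False by simp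
qed

lemma invariant_slow: "invariant_subspace \<mu> (slow b)"
proof -
  have "(\<lambda>v. g *v v) ` slow b \<subseteq> slow b" if "g \<in> gen_semigroup \<mu>" for g
    using that
  proof induction
    case (base g)
    then show ?case
      using msupport_mem_closed[OF AE_slow closed_vec_subspace[OF subspace_slow]] by blast
  next
    case (mult g h)
    then show ?case by (auto simp: matrix_vector_mul_assoc[symmetric])
  qed
  then show ?thesis by (simp add: invariant_subspace_def subspace_slow)
qed

text \<open>A subspace is spanned by the images of the coordinate vectors under a projection onto it, so
  it suffices to control finitely many vectors.\<close>

lemma expand_projection:
  fixes q :: "'k ^ 'n ^ 'n"
  assumes "q *v v = v"
  shows "g *v v = (\<Sum>i\<in>UNIV. v $ i *s (g *v (q *v axis i 1)))"
proof -
  have "g *v v = (g ** q) *v v" by (simp add: matrix_vector_mul_assoc[symmetric] assms)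
  also have "\<dots> = (g ** q) *v (\<Sum>i\<in>UNIV. v $ i *s axis i 1)" by (simp add: basis_expansion)
  also have "\<dots> = (\<Sum>i\<in>UNIV. v $ i *s ((g ** q) *v axis i 1))"
    by (simp only: vec.sum vec.scale)
  finally show ?thesis by (simp add: matrix_vector_mul_assoc)
qed

lemma AE_invariant:
  fixes W :: "('k ^ 'n) set"
  assumes W: "vec.subspace W" and inv: "\<And>v. v \<in> W \<Longrightarrow> AE g in \<mu>. g *v v \<in> W"
  shows "AE g in \<mu>. (\<lambda>v. g *v v) ` W \<subseteq> W"
proof -
  obtain q :: "'k ^ 'n ^ 'n" where q: "\<And>v. v \<in> W \<Longrightarrow> q *v v = v" "\<And>v. q *v v \<in> W"
    using ex_projection_matrix[OF W] by blast
  have "AE g in \<mu>. \<forall>i\<in>UNIV. g *v (q *v axis i 1) \<in> W"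
    by (rule AE_finite_allI) (simp_all add: inv q)
  then show ?thesis
  proof eventually_elim
    case (elim g)
    then show ?case
      by (auto simp: expand_projection[OF q(1), of _ g] intro!: vec.subspace_sum[OF W] vec.subspace_scale[OF W])
  qed
qed

text \<open>The vector has an almost sure exponential growth rate.\<close>

definition growth :: "'k ^ 'n \<Rightarrow> real \<Rightarrow> bool" where
  "growth v a \<longleftrightarrow> (AE \<omega> in increments. (\<lambda>n. ln (norm (left_walk \<omega> n *v v)) / real n) \<longlonglongrightarrow> a)"

lemma growth_bounds:
  assumes lim: "(\<lambda>n. ln (norm (left_walk \<omega> n *v v)) / real n) \<longlonglongrightarrow> a"
    and \<omega>: "\<omega> \<in> space increments" and v: "v \<noteq> 0" and e: "0 < e"
  shows "\<forall>\<^sub>F n in sequentially. exp (real n * (a - e)) \<le> norm (left_walk \<omega> n *v v) \<and>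
    norm (left_walk \<omega> n *v v) \<le> exp (real n * (a + e))"
  using tendstoD[OF lim e] eventually_gt_at_top[of 0]
proof eventually_elim
  case (elim n)
  let ?r = "norm (left_walk \<omega> n *v v)"
  have pos: "0 < ?r" using left_walk_nonzero[OF \<omega> v] by simp
  have "real n * (a - e) \<le> ln ?r" "ln ?r \<le> real n * (a + e)"
    using elim by (auto simp: dist_real_def abs_less_iff pos_divide_less_eq pos_less_divide_eq field_simps)
  then show ?case using pos by (metis exp_le_cancel_iff exp_ln)
qed

lemma growth_imp_slow:
  assumes "growth v a" "v \<noteq> 0"
  shows "v \<in> slow a"
  unfolding slow_def mem_Collect_eq using assms(1)[unfolded growth_def] AE_space
proof eventually_elim
  case (elim \<omega>)
  show ?case
    unfolding growth_le_def
  proof (intro allI impI)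
    fix e :: real assume "0 < e"
    from growth_bounds[OF elim assms(2) this]
    show "\<forall>\<^sub>F n in sequentially. norm (left_walk \<omega> n *v v) \<le> exp (real n * (a + e))"
      by eventually_elim simp
  qed
qed

lemma growth_slow_le:
  assumes "growth v a" "v \<noteq> 0" "v \<in> slow b"
  shows "a \<le> b"
proof (rule ccontr)
  assume "\<not> a \<le> b"
  define e where "e = (a - b) / 3"
  have e: "0 < e" using \<open>\<not> a \<le> b\<close> by (simp add: e_def)
  have "AE \<omega> in increments. growth_le \<omega> v b" using assms(3) by (simp add: slow_def)
  with assms(1)[unfolded growth_def] AE_space have "AE \<omega> in increments. False"
  proof eventually_elim
    case (elim \<omega>)
    from growth_leD[OF elim(3) e] growth_bounds[OF elim(1,2) assms(2) e] eventually_gt_at_top[of 0]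
    have "\<forall>\<^sub>F n in sequentially. False"
    proof eventually_elim
      case (elim n)
      then have "exp (real n * (a - e)) \<le> exp (real n * (b + e))" by linarith
      then have "real n * (a - e) \<le> real n * (b + e)" by simp
      then have "a - e \<le> b + e" using elim(3) by simp
      then show False using e by (simp add: e_def field_simps)
    qed
    then show ?case by simp
  qed
  then show False by (simp add: increments.AE_False)
qed

text \<open>Each exact growth rate is a jump of the increasing family \<open>slow\<close>.\<close>

lemma slow_psubset_of_growth:
  assumes "growth v b" "v \<noteq> 0" "a < b"
  shows "slow a \<subset> slow b"
proof
  show "slow a \<subseteq> slow b" using assms(3) by (intro slow_mono) simp
  have "v \<notin> slow a" using growth_slow_le[OF assms(1,2), of a] assms(3) by linarith
  then show "slow a \<noteq> slow b" using growth_imp_slow[OF assms(1,2)] by blast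
qed

subsection \<open>Top Lyapunov exponents\<close>

lemma norm_ratio_bounded:
  fixes g :: "'k ^ 'n ^ 'n"
  shows "norm (g *v v) / norm v \<le> onorm ((*v) g)"
  by (rule le_onorm[OF bounded_linear_matrix_vector_mult])

lemma onorm_on_bound:
  fixes g :: "'k ^ 'n ^ 'n"
  assumes "v \<in> W"
  shows "norm (g *v v) \<le> onorm_on W g * norm v"
proof (cases "v = 0")
  case False
  have "norm (g *v v) / norm v \<le> onorm_on W g"
    unfolding onorm_on_def using assms False norm_ratio_bounded
    by (intro cSUP_upper bdd_aboveI2) auto
  then show ?thesis using False by (simp add: pos_divide_le_eq)
qed simp

lemma onorm_on_le_sum:
  fixes g :: "'k ^ 'n ^ 'n"
  assumes W: "vec.subspace W" "W \<noteq> {0}" and q: "\<And>v. v \<in> W \<Longrightarrow> q *v v = v"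
  shows "onorm_on W g \<le> (\<Sum>i\<in>UNIV. norm (g *v (q *v axis i 1)))"
  unfolding onorm_on_def
proof (rule cSUP_least)
  show "W - {0} \<noteq> {}" using W vec.subspace_0[OF W(1)] by auto
  fix v assume v: "v \<in> W - {0}"
  have "norm (g *v v) \<le> (\<Sum>i\<in>UNIV. norm (v $ i *s (g *v (q *v axis i 1))))"
    unfolding expand_projection[OF q, of v g, OF DiffD1[OF v]] by (rule norm_sum)
  also have "\<dots> \<le> (\<Sum>i\<in>UNIV. norm v * norm (g *v (q *v axis i 1)))"
    by (intro sum_mono) (simp add: norm_vec_scale Finite_Cartesian_Product.norm_nth_le mult_right_mono)
  also have "\<dots> = norm v * (\<Sum>i\<in>UNIV. norm (g *v (q *v axis i 1)))"
    by (simp add: sum_distrib_left)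
  finally show "norm (g *v v) / norm v \<le> (\<Sum>i\<in>UNIV. norm (g *v (q *v axis i 1)))"
    using v by (simp add: pos_divide_le_eq mult.commute)
qed

lemma onorm_on_pos:
  fixes g :: "'k ^ 'n ^ 'n"
  assumes "g \<in> GL" "v \<in> W" "v \<noteq> 0"
  shows "0 < onorm_on W g"
proof (rule ccontr)
  assume "\<not> 0 < onorm_on W g"
  then have "onorm_on W g * norm v \<le> 0" by (intro mult_nonpos_nonneg) auto
  then have "norm (g *v v) \<le> 0" using onorm_on_bound[OF assms(2), of g] by linarith
  then show False using GL_mult_nonzero[OF assms(1,3)] by simp
qed

lemma top_lyapunov_subset_slow:
  assumes "has_top_lyapunov \<mu> W a"
  shows "W \<subseteq> slow a"
proof
  fix v assume v: "v \<in> W"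
  have lim: "AE \<omega> in increments. (\<lambda>n. ln (onorm_on W (left_walk \<omega> n)) / real n) \<longlonglongrightarrow> a"
    using assms by (simp add: has_top_lyapunov_def)
  show "v \<in> slow a"
  proof (cases "v = 0")
    case False
    have "AE \<omega> in increments. growth_le \<omega> v a"
      unfolding growth_le_def using lim AE_space
    proof (eventually_elim, intro allI impI)
      fix \<omega> and e :: real
      assume lim: "(\<lambda>n. ln (onorm_on W (left_walk \<omega> n)) / real n) \<longlonglongrightarrow> a"
        and \<omega>: "\<omega> \<in> space increments" and e: "0 < e"
      from e have "0 < e / 2" by simp
      from tendstoD[OF lim this] eventually_gt_at_top[of 0] eventually_absorb_factor[OF e, of "norm v" a]
      show "\<forall>\<^sub>F n in sequentially. norm (left_walk \<omega> n *v v) \<le> exp (real n * (a + e))"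
      proof eventually_elim
        case (elim n)
        let ?r = "onorm_on W (left_walk \<omega> n)"
        have pos: "0 < ?r" using onorm_on_pos[OF left_walk_GL[OF \<omega>] v False] .
        have "ln ?r / real n < a + e / 2" using elim(1) unfolding dist_real_def by linarith
        then have "ln ?r \<le> real n * (a + e / 2)"
          using elim(2) by (simp add: pos_divide_less_eq mult.commute)
        then have "?r \<le> exp (real n * (a + e / 2))" using pos by (metis exp_le_cancel_iff exp_ln)
        then have "?r * norm v \<le> norm v * exp (real n * (a + e / 2))"
          by (simp add: mult.commute mult_left_mono)
        with onorm_on_bound[OF v, of "left_walk \<omega> n"] elim(3) show ?case by linarith
      qed
    qed
    then show ?thesis by (simp add: slow_def)
  qed (simp add: vec.subspace_0[OF subspace_slow])
qed

text \<open>The norm on \<open>slow a\<close> is bounded above by finitely many vectors of growth at most \<open>a\<close>, and below by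
  the vector \<open>v\<close>, which grows at the rate \<open>a\<close>.\<close>

lemma slow_top_lyapunov:
  assumes "growth v a" "v \<noteq> 0"
  shows "has_top_lyapunov \<mu> (slow a) a"
proof -
  let ?W = "slow a"
  have v: "v \<in> ?W" by (rule growth_imp_slow[OF assms])
  then have W: "?W \<noteq> {0}" using assms(2) by auto
  obtain q :: "'k ^ 'n ^ 'n" where q: "\<And>v. v \<in> ?W \<Longrightarrow> q *v v = v" "\<And>v. q *v v \<in> ?W"
    using ex_projection_matrix[OF subspace_slow] by blast
  have "AE \<omega> in increments. \<forall>i\<in>UNIV. growth_le \<omega> (q *v axis i 1) a"
    by (rule AE_finite_allI) (use q(2) in \<open>auto simp: slow_def\<close>)
  with assms(1)[unfolded growth_def] AE_space
  have "AE \<omega> in increments. (\<lambda>n. ln (onorm_on ?W (left_walk \<omega> n)) / real n) \<longlonglongrightarrow> a"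
  proof eventually_elim
    case (elim \<omega>)
    show ?case
    proof (rule tendstoI)
      fix e :: real assume "0 < e"
      then have e: "0 < e / 2" "0 < e / 4" by auto
      have "\<forall>\<^sub>F n in sequentially. \<forall>i\<in>UNIV.
          norm (left_walk \<omega> n *v (q *v axis i 1)) \<le> exp (real n * (a + e / 4))"
        using growth_leD[OF bspec[OF elim(3)] e(2)] by (intro eventually_ball_finite) auto
      moreover have "\<forall>\<^sub>F n in sequentially. real CARD('n) * exp (real n * (a + e / 4)) \<le> exp (real n * (a + e / 2))"
        using eventually_absorb_factor[OF e(1), of "real CARD('n)" a] by simp
      moreover have "\<forall>\<^sub>F n in sequentially. norm v * exp (real n * (a - e / 2)) \<le> exp (real n * (a - e / 4))"
      proof -
        have "a - 3 * e / 4 + e / 2 / 2 = a - e / 2" "a - 3 * e / 4 + e / 2 = a - e / 4" by simp_all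
        then show ?thesis
          using eventually_absorb_factor[OF e(1), of "norm v" "a - 3 * e / 4"] by (simp only:)
      qed
      moreover note growth_bounds[OF elim(1,2) assms(2) e(2)] eventually_gt_at_top[of 0]
      ultimately
      show "\<forall>\<^sub>F n in sequentially. dist (ln (onorm_on ?W (left_walk \<omega> n)) / real n) a < e"
      proof eventually_elim
        case (elim n)
        let ?r = "onorm_on ?W (left_walk \<omega> n)"
        have pos: "0 < ?r"
          using onorm_on_pos[OF left_walk_GL v assms(2)] \<open>\<omega> \<in> space increments\<close> by blast
        have "?r \<le> (\<Sum>i\<in>UNIV. norm (left_walk \<omega> n *v (q *v axis i 1)))"
          by (rule onorm_on_le_sum[OF subspace_slow W q(1)])
        also have "\<dots> \<le> (\<Sum>i\<in>(UNIV :: 'n set). exp (real n * (a + e / 4)))"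
          by (rule sum_mono) (use elim(1) in auto)
        also have "\<dots> = real CARD('n) * exp (real n * (a + e / 4))" by simp
        also have "\<dots> \<le> exp (real n * (a + e / 2))" by (rule elim(2))
        finally have "ln ?r \<le> real n * (a + e / 2)"
          using pos by (metis exp_gt_zero ln_exp ln_le_cancel_iff)
        then have "ln ?r / real n \<le> a + e / 2"
          using elim(5) by (simp add: pos_divide_le_eq mult.commute)
        then have upper: "ln ?r / real n < a + e" using \<open>0 < e\<close> by simp
        have "norm v * exp (real n * (a - e / 2)) \<le> norm (left_walk \<omega> n *v v)"
          using elim(3,4) by simp
        also have "\<dots> \<le> norm v * ?r" using onorm_on_bound[OF v] by (simp add: mult.commute)
        finally have "exp (real n * (a - e / 2)) \<le> ?r" using assms(2) by simp
        then have "real n * (a - e / 2) \<le> ln ?r"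
          using pos by (metis exp_gt_zero ln_exp ln_le_cancel_iff)
        then have "a - e / 2 \<le> ln ?r / real n"
          using elim(5) by (simp add: pos_le_divide_eq mult.commute)
        then have "a - e < ln ?r / real n" using \<open>0 < e\<close> by simp
        with upper show ?case by (simp add: dist_real_def abs_less_iff)
      qed
    qed
  qed
  then show ?thesis using W by (simp add: has_top_lyapunov_def)
qed

end

section \<open>The norm cocycle along an ergodic measure\<close>

text \<open>The first moment condition bounds the expansion of every line at once.\<close>

lemma abs_ln_norm_ratio_le:
  fixes g :: "'k::{real_normed_field, euclidean_space} ^ 'n ^ 'n"
  assumes g: "g \<in> GL" and v: "v \<noteq> 0"
  shows "\<bar>ln (norm (g *v v) / norm v)\<bar> \<le>
    ln (max (onorm (\<lambda>v. g *v v)) (onorm (\<lambda>v. matrix_inv g *v v)))"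
proof -
  let ?m = "max (onorm (\<lambda>v. g *v v)) (onorm (\<lambda>v. matrix_inv g *v v))"
  let ?r = "norm (g *v v) / norm v"
  have "matrix_inv g ** g = mat 1"
    using g someI_ex[of "\<lambda>A'. g ** A' = mat 1 \<and> A' ** g = mat 1"]
    unfolding GL_def invertible_def matrix_inv_def by auto
  then have v_eq: "matrix_inv g *v (g *v v) = v" by (simp add: matrix_vector_mul_assoc)
  have gv: "g *v v \<noteq> 0" by (rule GL_mult_nonzero[OF g v])
  then have r: "0 < ?r" using v by simp
  have "?r \<le> ?m"
    using le_onorm[OF bounded_linear_matrix_vector_mult, of g v] by simp
  then have 1: "ln ?r \<le> ln ?m" using r by (subst ln_le_cancel_iff) auto
  have "norm v / norm (g *v v) \<le> ?m"
    using le_onorm[OF bounded_linear_matrix_vector_mult, of "matrix_inv g" "g *v v"] by (simp add: v_eq)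
  moreover have "inverse ?r = norm v / norm (g *v v)" by (rule inverse_divide)
  ultimately have "inverse ?r \<le> ?m" by (simp only:)
  moreover have "0 < inverse ?r" using r by (rule positive_imp_inverse_positive)
  ultimately have "ln (inverse ?r) \<le> ln ?m" by (subst ln_le_cancel_iff) auto
  then have 2: "- ln ?r \<le> ln ?m" unfolding ln_inverse by simp
  from 1 2 show ?thesis by linarith
qed

context random_matrix
begin

text \<open>The cocycle identity: the logarithmic expansions along an orbit telescope.\<close>

lemma sum_log_expansion_orbit:
  assumes \<omega>: "\<omega> \<in> space increments" and v: "v \<noteq> 0"
  shows "(\<Sum>k<n. log_expansion (\<omega> k) (orbit \<omega> k (line v))) =
    ln (norm (left_walk \<omega> n *v v)) - ln (norm v)"
proof (induction n)
  case (Suc n)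
  have nz: "left_walk \<omega> n *v v \<noteq> 0" "left_walk \<omega> (Suc n) *v v \<noteq> 0"
    using left_walk_nonzero[OF \<omega> v] by blast+
  have "log_expansion (\<omega> n) (orbit \<omega> n (line v)) =
      ln (norm (\<omega> n *v (left_walk \<omega> n *v v)) / norm (left_walk \<omega> n *v v))"
    unfolding orbit_line by (rule log_expansion_line[OF nz(1)])
  also have "\<omega> n *v (left_walk \<omega> n *v v) = left_walk \<omega> (Suc n) *v v"
    by (simp add: matrix_vector_mul_assoc)
  finally show ?case
    unfolding sum.lessThan_Suc Suc using nz by (simp add: ln_div del: left_walk.simps)
qed simp

lemma log_expansion_integrable:
  assumes moment: "finite_first_moment \<mu>" and "stationary \<nu>"
  shows "integrable (\<nu> \<Otimes>\<^sub>M \<mu>) (\<lambda>(x, g). log_expansion g x)"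
proof -
  note \<nu> = stationaryD[OF assms(2)]
  have [measurable_cong]: "sets \<nu> = sets proj_borel" by fact
  interpret \<nu>: prob_space \<nu> by fact
  interpret P: pair_prob_space \<nu> \<mu> ..
  let ?l = "\<lambda>g. ln (max (onorm (\<lambda>v. g *v v)) (onorm (\<lambda>v. matrix_inv g *v v)))"
  have l: "integrable \<mu> ?l" using moment by (simp add: finite_first_moment_def)
  have "distr (\<nu> \<Otimes>\<^sub>M \<mu>) \<mu> snd = \<mu>"
  proof (rule measure_eqI)
    fix A assume "A \<in> sets (distr (\<nu> \<Otimes>\<^sub>M \<mu>) \<mu> snd)"
    then have A: "A \<in> sets \<mu>" by simp
    have "snd -` A \<inter> space (\<nu> \<Otimes>\<^sub>M \<mu>) = space \<nu> \<times> A"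
      using sets.sets_into_space[OF A] by (auto simp: space_pair_measure)
    then show "emeasure (distr (\<nu> \<Otimes>\<^sub>M \<mu>) \<mu> snd) A = emeasure \<mu> A"
      using A by (simp add: emeasure_distr emeasure_pair_measure_Times \<nu>.emeasure_space_1)
  qed simp
  then have l': "integrable (\<nu> \<Otimes>\<^sub>M \<mu>) (\<lambda>z. ?l (snd z))"
    using integrable_distr[OF measurable_snd, of \<nu> \<mu> ?l] l by simp
  show ?thesis
  proof (rule Bochner_Integration.integrable_bound[OF l'])
    have [measurable]: "(\<lambda>z. rep (fst z)) \<in> borel_measurable (\<nu> \<Otimes>\<^sub>M \<mu>)"
      by (rule measurable_compose[OF measurable_fst]) measurable
    have [measurable]: "(\<lambda>z. snd z *v rep (fst z)) \<in> borel_measurable (\<nu> \<Otimes>\<^sub>M \<mu>)"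
      by (intro borel_measurable_matrix_vector_mult measurable_compose[OF measurable_snd borel_measurable_increment])
        fact
    have "(\<lambda>z. ln (norm (snd z *v rep (fst z)) / norm (rep (fst z)))) \<in> borel_measurable (\<nu> \<Otimes>\<^sub>M \<mu>)"
      by measurable
    also have "?this \<longleftrightarrow> (\<lambda>(x, g). log_expansion g x) \<in> borel_measurable (\<nu> \<Otimes>\<^sub>M \<mu>)"
      by (rule measurable_cong) (auto simp: space_pair_measure \<nu>(3) log_expansion_eq_rep)
    finally show "(\<lambda>(x, g). log_expansion g x) \<in> borel_measurable (\<nu> \<Otimes>\<^sub>M \<mu>)" .
    show "AE z in \<nu> \<Otimes>\<^sub>M \<mu>. norm (case z of (x, g) \<Rightarrow> log_expansion g x) \<le> norm (?l (snd z))"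
    proof (rule AE_I2)
      fix z assume "z \<in> space (\<nu> \<Otimes>\<^sub>M \<mu>)"
      then have z: "fst z \<in> space proj_borel" "snd z \<in> GL"
        by (auto simp: space_pair_measure \<nu>(3) space_\<mu>)
      from abs_ln_norm_ratio_le[OF z(2), of "rep (fst z)"] rep[OF z(1)]
      show "norm (case z of (x, g) \<Rightarrow> log_expansion g x) \<le> norm (?l (snd z))"
        by (simp add: split_beta' log_expansion_eq_rep[OF z(1)])
    qed
  qed
qed

lemma ergodic_growth:
  assumes moment: "finite_first_moment \<mu>" and erg: "\<nu> \<in> ergodic_measures \<mu> proj_act proj_borel"
  shows "AE x in \<nu>. growth (rep x) (cocycle_average \<mu> \<nu>)"
proof -
  have stat: "stationary \<nu>" using erg by (simp add: ergodic_measures_def)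
  note \<nu> = stationaryD[OF stat]
  have "AE x in \<nu>. AE \<omega> in increments.
      (\<lambda>n. (\<Sum>k<n. log_expansion (\<omega> k) (orbit \<omega> k x)) / real n) \<longlonglongrightarrow> cocycle_average \<mu> \<nu>"
    using orbit_averages[OF erg log_expansion_integrable[OF moment stat]]
    unfolding cocycle_average_def prod.case .
  then show ?thesis using AE_space
  proof eventually_elim
    case (elim x)
    then have x: "rep x \<noteq> 0" "line (rep x) = x" using rep[of x] \<nu>(3) by auto
    have "AE \<omega> in increments.
        (\<lambda>n. ln (norm (left_walk \<omega> n *v rep x)) / real n) \<longlonglongrightarrow> cocycle_average \<mu> \<nu>"
      using elim(1) AE_space
    proof eventually_elim
      case (elim \<omega>)
      have "(\<lambda>n. ln (norm (rep x)) / real n) \<longlonglongrightarrow> 0"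
        by (rule lim_const_over_n)
      from tendsto_add[OF elim(1) this]
      show ?case
        using sum_log_expansion_orbit[OF elim(2) x(1)] by (simp add: x(2) diff_divide_distrib)
    qed
    then show ?case by (simp add: growth_def)
  qed
qed

lemma exponent_attained:
  assumes moment: "finite_first_moment \<mu>" and "a \<in> fkh_exponents \<mu>"
  obtains v where "v \<noteq> 0" "growth v a"
proof -
  obtain \<nu> where erg: "\<nu> \<in> ergodic_measures \<mu> proj_act proj_borel" and a: "a = cocycle_average \<mu> \<nu>"
    using assms(2) by (auto simp: fkh_exponents_def)
  have "stationary \<nu>" using erg by (simp add: ergodic_measures_def)
  note \<nu> = stationaryD[OF this]
  interpret \<nu>: prob_space \<nu> by fact
  have "AE x in \<nu>. x \<in> space proj_borel \<and> growth (rep x) a"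
    using ergodic_growth[OF moment erg] AE_space unfolding a by eventually_elim (simp add: \<nu>(3))
  then obtain x where "x \<in> space proj_borel" "growth (rep x) a"
    using eventually_happens[of _ "ae_filter \<nu>"] \<nu>.ae_filter_bot by blast
  then show thesis using that[of "rep x"] rep[of x] by blast
qed

text \<open>Distinct exponents have slow spaces of distinct dimensions.\<close>

lemma finite_exponents:
  assumes moment: "finite_first_moment \<mu>"
  shows "finite (fkh_exponents \<mu>)"
proof (rule inj_on_finite)
  have less: "vec.dim (slow a) < vec.dim (slow b)" if "b \<in> fkh_exponents \<mu>" "a < b" for a b
  proof -
    obtain v where "v \<noteq> 0" "growth v b" using exponent_attained[OF moment \<open>b \<in> _\<close>] .
    then have "slow a \<subset> slow b" using slow_psubset_of_growth \<open>a < b\<close> by blast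
    then show ?thesis
      by (intro vec.dim_psubset) (simp add: vec.span_eq_iff[THEN iffD2, OF subspace_slow])
  qed
  show "inj_on (\<lambda>a. vec.dim (slow a)) (fkh_exponents \<mu>)"
  proof (rule linorder_inj_onI')
    fix a b assume "a \<in> fkh_exponents \<mu>" "b \<in> fkh_exponents \<mu>" "a < b"
    then show "vec.dim (slow a) \<noteq> vec.dim (slow b)" using less[of b a] by simp
  qed
  show "(\<lambda>a. vec.dim (slow a)) ` fkh_exponents \<mu> \<subseteq> {..CARD('n)}"
    by (auto intro: vec.dim_subset[OF subset_UNIV, unfolded vec_dim_card])
qed simp

lemma fkh_exponent_mem:
  assumes "finite_first_moment \<mu>" and "i \<in> {1..fkh_number \<mu>}"
  shows "fkh_exponent \<mu> i \<in> fkh_exponents \<mu>"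
proof -
  note fin = finite_exponents[OF assms(1)]
  have "fkh_exponent \<mu> i \<in> set (rev (sorted_list_of_set (fkh_exponents \<mu>)))"
    unfolding fkh_exponent_def using assms(2) fin by (intro nth_mem) (auto simp: fkh_number_def)
  then show ?thesis using fin by simp
qed

lemma fkh_exponent_Suc_less:
  assumes "finite_first_moment \<mu>" and "i \<in> {1..fkh_number \<mu>}" "i + 1 \<in> {1..fkh_number \<mu>}"
  shows "fkh_exponent \<mu> (i + 1) < fkh_exponent \<mu> i"
proof -
  let ?l = "sorted_list_of_set (fkh_exponents \<mu>)"
  note fin = finite_exponents[OF assms(1)]
  have len: "length ?l = fkh_number \<mu>" using fin by (simp add: fkh_number_def)
  have sorted: "sorted_wrt (<) ?l" using fin by simp
  have "fkh_exponent \<mu> (i + 1) = ?l ! (fkh_number \<mu> - Suc i)"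
    unfolding fkh_exponent_def using assms len by (subst rev_nth) auto
  moreover have "fkh_exponent \<mu> i = ?l ! (fkh_number \<mu> - i)"
    unfolding fkh_exponent_def using assms len by (subst rev_nth) auto
  moreover have "?l ! (fkh_number \<mu> - Suc i) < ?l ! (fkh_number \<mu> - i)"
    by (rule sorted_wrt_nth_less[OF sorted]) (use assms len in auto)
  ultimately show ?thesis by simp
qed

lemma ex_fkh_index:
  assumes "finite_first_moment \<mu>" and "a \<in> fkh_exponents \<mu>"
  obtains i where "i \<in> {1..fkh_number \<mu>}" "fkh_exponent \<mu> i = a"
proof -
  let ?l = "rev (sorted_list_of_set (fkh_exponents \<mu>))"
  note fin = finite_exponents[OF assms(1)]
  have "a \<in> set ?l" using fin assms(2) by simp
  then obtain j where j: "j < length ?l" "?l ! j = a" unfolding in_set_conv_nth by blast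
  have "length ?l = fkh_number \<mu>" using fin by (simp add: fkh_number_def)
  then show thesis using j by (intro that[of "Suc j"]) (auto simp: fkh_exponent_def)
qed

lemma fkh_space_eq_slow:
  assumes moment: "finite_first_moment \<mu>" and i: "i \<in> {1..fkh_number \<mu>}"
  shows "fkh_space \<mu> i = slow (fkh_exponent \<mu> i)"
proof -
  obtain v where "v \<noteq> 0" "growth v (fkh_exponent \<mu> i)"
    using exponent_attained[OF moment fkh_exponent_mem[OF moment i]] .
  then have "has_top_lyapunov \<mu> (slow (fkh_exponent \<mu> i)) (fkh_exponent \<mu> i)"
    using slow_top_lyapunov by blast
  then have "(GREATEST W. invariant_subspace \<mu> W \<and> has_top_lyapunov \<mu> W (fkh_exponent \<mu> i)) =
      slow (fkh_exponent \<mu> i)"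
    using invariant_slow top_lyapunov_subset_slow by (intro Greatest_equality) auto
  then show ?thesis unfolding fkh_space_def using i by (simp only: if_True)
qed

text \<open>The facts about the next FKH space that the rest of the proof uses; they also cover the last
  index, where the next space is 0 and \<open>b\<close> is arbitrary.\<close>

lemma fkh_space_Suc:
  assumes moment: "finite_first_moment \<mu>" and i: "i \<in> {1..fkh_number \<mu>}"
  shows "\<exists>b < fkh_exponent \<mu> i. fkh_space \<mu> (i + 1) \<subseteq> slow b"
    and "vec.subspace (fkh_space \<mu> (i + 1))"
    and "AE g in \<mu>. (\<lambda>v. g *v v) ` fkh_space \<mu> (i + 1) \<subseteq> fkh_space \<mu> (i + 1)"
    and "fkh_space \<mu> (i + 1) \<subseteq> fkh_space \<mu> i"
proof -
  have "(\<exists>b < fkh_exponent \<mu> i. fkh_space \<mu> (i + 1) \<subseteq> slow b) \<and> vec.subspace (fkh_space \<mu> (i + 1)) \<and>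
    (AE g in \<mu>. (\<lambda>v. g *v v) ` fkh_space \<mu> (i + 1) \<subseteq> fkh_space \<mu> (i + 1)) \<and>
    fkh_space \<mu> (i + 1) \<subseteq> fkh_space \<mu> i"
  proof (cases "i + 1 \<in> {1..fkh_number \<mu>}")
    case True
    have less: "fkh_exponent \<mu> (i + 1) < fkh_exponent \<mu> i"
      by (rule fkh_exponent_Suc_less[OF moment i True])
    show ?thesis
      unfolding fkh_space_eq_slow[OF moment True] fkh_space_eq_slow[OF moment i]
      using less slow_mono[of "fkh_exponent \<mu> (i + 1)" "fkh_exponent \<mu> i"]
        AE_invariant[OF subspace_slow AE_slow] subspace_slow by auto
  next
    case False
    then have zero: "fkh_space \<mu> (i + 1) = {0}" unfolding fkh_space_def by (simp only: if_False)
    have "{0} \<subseteq> slow b" for b using vec.subspace_0[OF subspace_slow] by simp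
    moreover have "\<exists>b. b < fkh_exponent \<mu> i" by (rule lt_ex)
    ultimately show ?thesis
      unfolding zero fkh_space_eq_slow[OF moment i] using vec.subspace_single_0 by auto
  qed
  then show "\<exists>b < fkh_exponent \<mu> i. fkh_space \<mu> (i + 1) \<subseteq> slow b"
    "vec.subspace (fkh_space \<mu> (i + 1))"
    "AE g in \<mu>. (\<lambda>v. g *v v) ` fkh_space \<mu> (i + 1) \<subseteq> fkh_space \<mu> (i + 1)"
    "fkh_space \<mu> (i + 1) \<subseteq> fkh_space \<mu> i" by blast+
qed

end

section \<open>Uniqueness of lifts\<close>

text \<open>The distance of the direction of \<open>v\<close> from a closed cone \<open>C\<close>. It depends on the line of \<open>v\<close> only, it is
  Lipschitz in \<open>v\<close> relative to \<open>norm v\<close>, and it vanishes exactly on \<open>C\<close>. Closed sets of lines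
  correspond to closed cones, so functions of these distances separate measures. The scalars form an
  arbitrary normed field, so this takes the place of a metric built from a Hermitian form.\<close>

definition cone_dist :: "('k::{real_normed_field, euclidean_space} ^ 'n) set \<Rightarrow> 'k ^ 'n \<Rightarrow> real" where
  "cone_dist C v = infdist v C / norm v"

definition is_cone :: "('k::{real_normed_field, euclidean_space} ^ 'n) set \<Rightarrow> bool" where
  "is_cone C \<longleftrightarrow> 0 \<in> C \<and> (\<forall>c. \<forall>v\<in>C. c *s v \<in> C)"

lemma infdist_cone_scale_le:
  assumes C: "is_cone C" and c: "c \<noteq> 0"
  shows "infdist (c *s v) C \<le> norm c * infdist v C"
proof -
  have ne: "C \<noteq> {}" using C by (auto simp: is_cone_def)
  have "infdist (c *s v) C / norm c \<le> (INF a\<in>C. dist v a)"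
  proof (rule cINF_greatest[OF ne])
    fix a assume "a \<in> C"
    then have "c *s a \<in> C" using C by (auto simp: is_cone_def)
    then have "infdist (c *s v) C \<le> dist (c *s v) (c *s a)" by (rule infdist_le)
    also have "\<dots> = norm c * dist v a"
      by (simp only: dist_norm vec.scale_right_diff_distrib[symmetric] norm_vec_scale)
    finally show "infdist (c *s v) C / norm c \<le> dist v a"
      using c by (simp add: pos_divide_le_eq mult.commute)
  qed
  then show ?thesis
    using c ne by (simp add: infdist_notempty pos_divide_le_eq mult.commute)
qed

lemma cone_dist_scale:
  assumes C: "is_cone C" and c: "c \<noteq> 0"
  shows "cone_dist C (c *s v) = cone_dist C v"
proof -
  have "infdist (inverse c *s (c *s v)) C \<le> norm (inverse c) * infdist (c *s v) C"
    using c by (intro infdist_cone_scale_le[OF C]) simp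
  then have "infdist v C \<le> inverse (norm c) * infdist (c *s v) C"
    using c by (simp add: norm_inverse)
  then have "norm c * infdist v C \<le> norm c * (inverse (norm c) * infdist (c *s v) C)"
    by (rule mult_left_mono) simp
  also have "\<dots> = infdist (c *s v) C" using c by (simp add: mult.assoc[symmetric])
  finally have "norm c * infdist v C \<le> infdist (c *s v) C" .
  with infdist_cone_scale_le[OF C c, of v] have "infdist (c *s v) C = norm c * infdist v C" by simp
  then show ?thesis using c by (simp add: cone_dist_def norm_vec_scale)
qed

lemma cone_dist_nonneg: "0 \<le> cone_dist C v"
  by (simp add: cone_dist_def infdist_nonneg)

text \<open>With \<open>d(v) = infdist v C\<close>, the numerator of the difference is
  \<open>d(u + w) (|u| - |u + w|) + |u + w| (d(u + w) - d(u))\<close>. Since \<open>0 \<in> C\<close>, we have \<open>d(u + w) \<le> |u + w|\<close>, so both terms are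
  at most \<open>|u + w| |w|\<close>.\<close>

lemma cone_dist_add_le:
  assumes C: "is_cone C" and u: "u \<noteq> 0" and uw: "u + w \<noteq> 0"
  shows "\<bar>cone_dist C (u + w) - cone_dist C u\<bar> \<le> 2 * (norm w / norm u)"
proof -
  let ?v = "u + w"
  have pos: "0 < norm u" "0 < norm ?v" using u uw by auto
  have iv: "0 \<le> infdist ?v C" "infdist ?v C \<le> norm ?v"
    using infdist_nonneg infdist_le[of 0 C ?v] C by (auto simp: is_cone_def)
  have "\<bar>infdist ?v C - infdist u C\<bar> \<le> norm w"
    using infdist_triangle_abs[of ?v C u] by (simp add: dist_norm)
  then have "norm ?v * \<bar>infdist ?v C - infdist u C\<bar> \<le> norm ?v * norm w"
    by (intro mult_left_mono) auto
  moreover have "\<bar>norm u - norm ?v\<bar> \<le> norm w"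
    using norm_triangle_ineq3[of u ?v] by simp
  then have "infdist ?v C * \<bar>norm u - norm ?v\<bar> \<le> norm ?v * norm w"
    using iv by (intro mult_mono) auto
  moreover define d where "d = infdist ?v C * (norm u - norm ?v) + norm ?v * (infdist ?v C - infdist u C)"
  moreover have "\<bar>d\<bar> \<le> infdist ?v C * \<bar>norm u - norm ?v\<bar> + norm ?v * \<bar>infdist ?v C - infdist u C\<bar>"
    using abs_triangle_ineq[of "infdist ?v C * (norm u - norm ?v)" "norm ?v * (infdist ?v C - infdist u C)"] iv
    by (simp add: abs_mult d_def)
  ultimately have d: "\<bar>d\<bar> \<le> 2 * (norm ?v * norm w)" by linarith
  have "cone_dist C ?v - cone_dist C u = d / (norm u * norm ?v)"
    using u uw by (simp add: cone_dist_def d_def field_simps)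
  then have "\<bar>cone_dist C ?v - cone_dist C u\<bar> = \<bar>d\<bar> / (norm u * norm ?v)"
    by (simp only: abs_divide abs_mult abs_norm_cancel)
  also have "\<dots> \<le> 2 * (norm ?v * norm w) / (norm u * norm ?v)"
    by (rule divide_right_mono[OF d]) simp
  also have "\<dots> = 2 * (norm w / norm u)" using pos by simp
  finally show ?thesis .
qed

text \<open>Lipschitz functions that decrease to the indicator of \<open>C\<close> as \<open>k\<close> grows.\<close>

definition cone_test :: "('k::{real_normed_field, euclidean_space} ^ 'n) set \<Rightarrow> nat \<Rightarrow> 'k ^ 'n \<Rightarrow> real" where
  "cone_test C k v = max 0 (1 - real k * cone_dist C v)"

lemma cone_test_bounds: "0 \<le> cone_test C k v" "cone_test C k v \<le> 1"
  using cone_dist_nonneg[of C v] by (auto simp: cone_test_def)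

lemma cone_test_scale: "is_cone C \<Longrightarrow> c \<noteq> 0 \<Longrightarrow> cone_test C k (c *s v) = cone_test C k v"
  by (simp add: cone_test_def cone_dist_scale)

lemma cone_test_line:
  assumes "is_cone C" "v \<noteq> 0"
  shows "cone_test C k (rep (line v)) = cone_test C k v"
proof -
  have "v \<in> line (rep (line v))"
    using rep[OF line_in_space[OF assms(2)]] mem_line[of v] by simp
  then obtain c where c: "v = c *s rep (line v)" by (auto simp: line_eq_range)
  with assms(2) have "c \<noteq> 0" by auto
  from cone_test_scale[OF assms(1) this, of k "rep (line v)"] show ?thesis by (simp add: c[symmetric])
qed

lemma cone_test_add_le:
  assumes C: "is_cone C" and u: "u \<noteq> 0" and uw: "u + w \<noteq> 0"
  shows "\<bar>cone_test C k (u + w) - cone_test C k u\<bar> \<le> real k * (2 * (norm w / norm u))"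
proof -
  have "\<bar>cone_test C k (u + w) - cone_test C k u\<bar> \<le> \<bar>real k * cone_dist C (u + w) - real k * cone_dist C u\<bar>"
    by (simp add: cone_test_def max_def abs_if)
  also have "\<dots> = real k * \<bar>cone_dist C (u + w) - cone_dist C u\<bar>"
    by (simp add: right_diff_distrib[symmetric] abs_mult)
  also have "\<dots> \<le> real k * (2 * (norm w / norm u))"
    by (intro mult_left_mono cone_dist_add_le assms) simp
  finally show ?thesis .
qed

lemma cone_test_measurable: "(\<lambda>L. cone_test C k (rep L)) \<in> borel_measurable proj_borel"
proof -
  have "(\<lambda>v. infdist v C) \<in> borel_measurable borel"
    by (intro borel_measurable_continuous_onI continuous_intros)
  from measurable_compose[OF rep_measurable this]
  have "(\<lambda>L. infdist (rep L) C) \<in> borel_measurable proj_borel" .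
  moreover have "(\<lambda>L. norm (rep L)) \<in> borel_measurable proj_borel"
    by (rule measurable_compose[OF rep_measurable borel_measurable_norm])
  ultimately show ?thesis unfolding cone_test_def cone_dist_def
    by (intro borel_measurable_max borel_measurable_diff borel_measurable_times borel_measurable_divide
        borel_measurable_const)
qed

lemma cone_test_limit:
  assumes C: "is_cone C" and "closed C" and v: "v \<noteq> 0"
  shows "(\<lambda>k. cone_test C k v) \<longlonglongrightarrow> indicator C v"
proof (cases "v \<in> C")
  case True
  then have "cone_test C k v = 1" for k by (simp add: cone_test_def cone_dist_def infdist_zero)
  then show ?thesis using True by simp
next
  case False
  have "C \<noteq> {}" using C by (auto simp: is_cone_def)
  then have "0 < infdist v C"
    using False \<open>closed C\<close> by (simp add: infdist_pos_not_in_closed)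
  then have d: "0 < cone_dist C v" using v by (simp add: cone_dist_def)
  obtain K :: nat where K: "1 / cone_dist C v < real K" using reals_Archimedean2 by blast
  have "cone_test C k v = 0" if "K \<le> k" for k
  proof -
    have "1 / cone_dist C v < real k" using K that by (meson less_le_trans of_nat_le_iff)
    then have "1 < real k * cone_dist C v" using d by (simp add: pos_divide_less_eq)
    then show ?thesis by (simp add: cone_test_def)
  qed
  then have "\<forall>\<^sub>F k in sequentially. cone_test C k v = indicator C v"
    using False by (auto simp: eventually_sequentially)
  then show ?thesis by (rule tendsto_eventually)
qed

text \<open>In the limit the test functions give the measures of all closed sets, hence of the open sets, which
  form a generator stable under intersections.\<close>

lemma proj_measure_eqI:
  fixes M N :: "('k::{real_normed_field, euclidean_space} ^ 'n) set measure"
  assumes M: "prob_space M" "sets M = sets proj_borel" and N: "prob_space N" "sets N = sets proj_borel"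
    and eq: "\<And>C k. is_cone C \<Longrightarrow> closed C \<Longrightarrow>
      (\<integral>\<^sup>+L. ennreal (cone_test C k (rep L)) \<partial>M) = (\<integral>\<^sup>+L. ennreal (cone_test C k (rep L)) \<partial>N)"
  shows "M = N"
proof -
  interpret M: prob_space M by fact
  interpret N: prob_space N by fact
  let ?T = "quotient_topology (top_of_set (- {0})) line :: ('k ^ 'n) set topology"
  have space: "space M = space proj_borel" "space N = space proj_borel"
    using M N sets_eq_imp_space_eq by blast+
  have limit: "(\<lambda>k. \<integral>\<^sup>+L. ennreal (cone_test C k (rep L)) \<partial>K) \<longlonglongrightarrow> emeasure K {L \<in> space K. rep L \<in> C}"
    if C: "is_cone C" "closed C" and K: "prob_space K" "sets K = sets proj_borel" for C K
  proof -
    interpret K: prob_space K by fact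
    have [measurable_cong]: "sets K = sets proj_borel" by fact
    have space: "space K = space proj_borel" by (rule sets_eq_imp_space_eq) fact
    have C_borel: "C \<in> sets borel" using C(2) by (rule borel_closed)
    have "rep -` C \<inter> space proj_borel \<in> sets proj_borel" by (rule measurable_sets[OF rep_measurable C_borel])
    also have "rep -` C \<inter> space proj_borel = {L \<in> space K. rep L \<in> C}" by (auto simp: space)
    finally have S: "{L \<in> space K. rep L \<in> C} \<in> sets K" by (simp add: K)
    have "(\<lambda>k. \<integral>\<^sup>+L. ennreal (cone_test C k (rep L)) \<partial>K) \<longlonglongrightarrow>
        (\<integral>\<^sup>+L. indicator {L \<in> space K. rep L \<in> C} L \<partial>K)"
    proof (rule nn_integral_dominated_convergence[where w = "\<lambda>_. 1"])
      show "(\<lambda>L. ennreal (cone_test C k (rep L))) \<in> borel_measurable K" for k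
        using measurable_compose[OF cone_test_measurable measurable_ennreal]
        by (simp add: measurable_cong_sets[OF K(2) refl])
      show "AE L in K. (\<lambda>k. ennreal (cone_test C k (rep L))) \<longlonglongrightarrow> indicator {L \<in> space K. rep L \<in> C} L"
      proof (rule AE_I2)
        fix L assume L: "L \<in> space K"
        then have "rep L \<noteq> 0" using rep[of L] space by simp
        from tendsto_ennrealI[OF cone_test_limit[OF C this]] L
        show "(\<lambda>k. ennreal (cone_test C k (rep L))) \<longlonglongrightarrow> indicator {L \<in> space K. rep L \<in> C} L"
          by (cases "rep L \<in> C") (simp_all add: indicator_def)
      qed
    qed (use S cone_test_bounds in \<open>auto simp: K.emeasure_space_1 intro!: AE_I2\<close>)
    also have "(\<integral>\<^sup>+L. indicator {L \<in> space K. rep L \<in> C} L \<partial>K) = emeasure K {L \<in> space K. rep L \<in> C}"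
      by (rule nn_integral_indicator[OF S])
    finally show ?thesis .
  qed
  have closed_eq: "emeasure M {L \<in> space M. rep L \<in> C} = emeasure N {L \<in> space N. rep L \<in> C}"
    if C: "is_cone C" "closed C" for C
    using limit[OF C M] limit[OF C N] unfolding eq[OF C] by (rule LIMSEQ_unique)
  show ?thesis
  proof (rule measure_eqI_generator_eq[where E = "{U. openin ?T U}" and \<Omega> = "topspace ?T"
        and A = "\<lambda>_. topspace ?T"])
    show "Int_stable {U. openin ?T U}" by (auto simp: Int_stable_def)
    show "{U. openin ?T U} \<subseteq> Pow (topspace ?T)" using openin_subset by blast
    show "sets M = sigma_sets (topspace ?T) {U. openin ?T U}"
      "sets N = sigma_sets (topspace ?T) {U. openin ?T U}"
      unfolding M(2) N(2) proj_borel_def sets_borel_of by (rule refl)+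
    show "range (\<lambda>_. topspace ?T) \<subseteq> {U. openin ?T U}" by (simp del: topspace_quotient_topology)
    show "(\<Union>i. topspace ?T) = topspace ?T" by simp
    show "emeasure M (topspace ?T) \<noteq> \<infinity>" by (simp add: M.emeasure_eq_measure)
    fix U assume "U \<in> {U. openin ?T U}"
    then have U: "openin ?T U" by simp
    then have U_sets: "U \<in> sets proj_borel" unfolding proj_borel_def by (rule openin_imp_borel_of)
    define C where "C = - {v :: 'k ^ 'n. v \<noteq> 0 \<and> line v \<in> U}"
    have "closed C" using U by (simp add: C_def openin_proj closed_Compl)
    moreover have "is_cone C"
      unfolding is_cone_def C_def by (auto simp: line_scale)
    ultimately have "emeasure M {L \<in> space M. rep L \<in> C} = emeasure N {L \<in> space N. rep L \<in> C}"
      by (intro closed_eq)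
    also have "{L \<in> space M. rep L \<in> C} = space M - U" unfolding C_def by (auto simp: space rep)
    also have "{L \<in> space N. rep L \<in> C} = space N - U" unfolding C_def by (auto simp: space rep)
    finally have "measure M (space M - U) = measure N (space N - U)"
      by (simp add: measure_def)
    then have "measure M U = measure N U"
      using M.prob_compl[of U] N.prob_compl[of U] U_sets M N by simp
    then show "emeasure M U = emeasure N U"
      by (simp add: M.emeasure_eq_measure N.emeasure_eq_measure)
  qed
qed

context random_matrix
begin

text \<open>Almost surely \<open>v\<close> grows at least at the rate \<open>a\<close>. Quantifying over a sequence of margins
  \<open>1 / (m + 1)\<close> makes the set of lines with this property measurable (\<open>fast_measurable\<close>), so that the property
  passes from a measure to its image and back.\<close>

definition fast :: "'k ^ 'n \<Rightarrow> real \<Rightarrow> bool" where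
  "fast v a \<longleftrightarrow> (AE \<omega> in increments. \<forall>m::nat. \<forall>\<^sub>F n in sequentially.
     exp (real n * (a - 1 / real (Suc m))) \<le> norm (left_walk \<omega> n *v v))"

lemma fast_of_scale:
  assumes c: "c \<noteq> 0" and "fast (c *s v) a"
  shows "fast v a"
  unfolding fast_def using assms(2)[unfolded fast_def]
proof (eventually_elim, intro allI)
  fix \<omega> and m :: nat
  assume *: "\<forall>m::nat. \<forall>\<^sub>F n in sequentially.
    exp (real n * (a - 1 / real (Suc m))) \<le> norm (left_walk \<omega> n *v (c *s v))"
  define e where "e = 1 / real (Suc m) - 1 / real (Suc (Suc m))"
  have e: "0 < e" unfolding e_def by (simp add: frac_less2)
  from *[rule_format, of "Suc m"] eventually_le_exp[OF e, of "norm c"]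
  show "\<forall>\<^sub>F n in sequentially. exp (real n * (a - 1 / real (Suc m))) \<le> norm (left_walk \<omega> n *v v)"
  proof eventually_elim
    case (elim n)
    have "norm c * exp (real n * (a - 1 / real (Suc m))) \<le> exp (real n * e) * exp (real n * (a - 1 / real (Suc m)))"
      by (intro mult_right_mono elim) simp
    also have "\<dots> = exp (real n * (a - 1 / real (Suc (Suc m))))"
      unfolding exp_add[symmetric] e_def by (simp only: distrib_left[symmetric]) simp
    also have "\<dots> \<le> norm c * norm (left_walk \<omega> n *v v)"
      using elim(1) by (simp only: vec.scale norm_vec_scale)
    finally show ?case using c by simp
  qed
qed

lemma growth_imp_fast:
  assumes "growth v a" "v \<noteq> 0"
  shows "fast v a"
  unfolding fast_def using assms(1)[unfolded growth_def] AE_space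
proof eventually_elim
  case (elim \<omega>)
  show ?case
  proof
    fix m :: nat
    have "0 < 1 / real (Suc m)" by simp
    from growth_bounds[OF elim assms(2) this]
    show "\<forall>\<^sub>F n in sequentially. exp (real n * (a - 1 / real (Suc m))) \<le> norm (left_walk \<omega> n *v v)"
      by eventually_elim blast
  qed
qed

lemma fast_diff_slow:
  assumes v: "fast v a" and w: "w \<in> slow b" and "b < a"
  shows "fast (v - w) a"
proof -
  have "AE \<omega> in increments. growth_le \<omega> w b" using w by (simp add: slow_def)
  with v[unfolded fast_def] show ?thesis unfolding fast_def
  proof (eventually_elim, intro allI)
    fix \<omega> and m :: nat
    assume v: "\<forall>m::nat. \<forall>\<^sub>F n in sequentially. exp (real n * (a - 1 / real (Suc m))) \<le> norm (left_walk \<omega> n *v v)"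
      and w: "growth_le \<omega> w b"
    obtain p where p: "1 / real (Suc p) < (a - b) / 2"
      using nat_approx_posE[of "(a - b) / 2"] \<open>b < a\<close> by auto
    \<comment> \<open>The rate \<open>s\<close> of \<open>v\<close> exceeds, by at least \<open>e\<close>, both the rate \<open>(a + b) / 2\<close> that bounds \<open>w\<close> and the
      rate that is to be shown.\<close>
    define M where "M = max p (Suc m)"
    define s where "s = a - 1 / real (Suc M)"
    have "1 / real (Suc M) \<le> 1 / real (Suc p)" by (simp add: M_def frac_le)
    with p have s1: "(a + b) / 2 < s" unfolding s_def by argo
    have "1 / real (Suc M) \<le> 1 / real (Suc (Suc m))" unfolding M_def by (intro frac_le) auto
    also have "\<dots> < 1 / real (Suc m)" by (simp add: frac_less2)
    finally have s2: "a - 1 / real (Suc m) < s" unfolding s_def by simp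
    define e where "e = min (s - (a + b) / 2) (s - (a - 1 / real (Suc m)))"
    have e: "0 < e" using s1 s2 by (simp add: e_def)
    have e1: "e \<le> s - (a + b) / 2" and e2: "e \<le> s - (a - 1 / real (Suc m))" by (simp_all add: e_def)
    have "0 < (a - b) / 2" using \<open>b < a\<close> by simp
    from growth_leD[OF w this] v[rule_format, of M] eventually_le_exp[OF e, of 2]
    show "\<forall>\<^sub>F n in sequentially. exp (real n * (a - 1 / real (Suc m))) \<le> norm (left_walk \<omega> n *v (v - w))"
    proof eventually_elim
      case (elim n)
      have half: "exp (real n * t) \<le> exp (real n * s) / 2" if "t \<le> s - e" for t
      proof -
        have "2 * exp (real n * t) \<le> exp (real n * e) * exp (real n * t)"
          by (intro mult_right_mono elim) simp
        also have "\<dots> = exp (real n * (e + t))" by (simp add: exp_add[symmetric] algebra_simps)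
        also have "\<dots> \<le> exp (real n * s)" using that by (simp add: mult_left_mono)
        finally show ?thesis by simp
      qed
      have "exp (real n * (b + (a - b) / 2)) \<le> exp (real n * s) / 2"
        by (rule half) (use e1 in argo)
      moreover have "exp (real n * (a - 1 / real (Suc m))) \<le> exp (real n * s) / 2"
        by (rule half) (use e2 in argo)
      moreover have "norm (left_walk \<omega> n *v v) \<le> norm (left_walk \<omega> n *v (v - w)) + norm (left_walk \<omega> n *v w)"
        using norm_triangle_ineq[of "left_walk \<omega> n *v (v - w)" "left_walk \<omega> n *v w"]
        by (simp add: matrix_vector_mult_diff_distrib)
      ultimately show ?case using elim(1,2) unfolding s_def[symmetric] by linarith
    qed
  qed
qed

lemma slow_fast_ratio:
  assumes u: "fast u a" and w: "w \<in> slow b" and "b < a"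
  shows "AE \<omega> in increments. (\<lambda>n. norm (left_walk \<omega> n *v w) / norm (left_walk \<omega> n *v u)) \<longlonglongrightarrow> 0"
proof -
  have "AE \<omega> in increments. growth_le \<omega> w b" using w by (simp add: slow_def)
  with u[unfolded fast_def] show ?thesis
  proof eventually_elim
    case (elim \<omega>)
    define e where "e = (a - b) / 3"
    have e: "0 < e" using \<open>b < a\<close> by (simp add: e_def)
    obtain p where p: "1 / real (Suc p) < e" using nat_approx_posE[OF e] by auto
    have "(\<lambda>n. exp (- e) ^ n) \<longlonglongrightarrow> 0" using e by (intro LIMSEQ_power_zero) simp
    then have lim: "(\<lambda>n. exp (- (real n * e))) \<longlonglongrightarrow> 0"
      by (simp add: exp_of_nat_mult[symmetric] mult.commute)
    from growth_leD[OF elim(2) e] elim(1)[rule_format, of p]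
    have "\<forall>\<^sub>F n in sequentially. norm (left_walk \<omega> n *v w) / norm (left_walk \<omega> n *v u) \<le> exp (- (real n * e))"
    proof eventually_elim
      case (elim n)
      have "exp (real n * (a - e)) \<le> exp (real n * (a - 1 / real (Suc p)))"
        using p by (simp add: mult_left_mono)
      with elim(2) have u: "exp (real n * (a - e)) \<le> norm (left_walk \<omega> n *v u)" by linarith
      have "norm (left_walk \<omega> n *v w) / norm (left_walk \<omega> n *v u) \<le> exp (real n * (b + e)) / exp (real n * (a - e))"
        using elim(1) u by (intro frac_le) auto
      also have "\<dots> = exp (- (real n * e))"
        unfolding exp_diff[symmetric] by (simp add: e_def field_simps)
      finally show ?case .
    qed
    then show ?case
      by (intro tendsto_sandwich[OF _ _ tendsto_const lim]) auto
  qed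
qed

lemma fast_measurable: "{L \<in> space proj_borel. fast (rep L) a} \<in> sets proj_borel"
proof -
  let ?P = "proj_borel \<Otimes>\<^sub>M increments"
  define r where "r n z = norm (left_walk (snd z) n *v rep (fst z))" for n and z :: "('k ^ 'n) set \<times> (nat \<Rightarrow> 'k ^ 'n ^ 'n)"
  let ?Q = "\<lambda>z. \<forall>m::nat. \<exists>N. \<forall>n\<ge>N. exp (real n * (a - 1 / real (Suc m))) \<le> r n z"
  have [measurable]: "r n \<in> borel_measurable ?P" for n
    unfolding r_def by (intro measurable_compose[OF _ borel_measurable_norm] borel_measurable_matrix_vector_mult
        measurable_compose[OF measurable_snd left_walk_measurable]
        measurable_compose[OF measurable_fst rep_measurable])
  define B where "B = {z \<in> space ?P. \<not> ?Q z}"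
  have B: "B \<in> sets ?P" unfolding B_def by measurable
  have [measurable]: "(\<lambda>L. emeasure increments (Pair L -` B)) \<in> borel_measurable proj_borel"
    by (rule increments.measurable_emeasure_Pair[OF B])
  have "fast (rep L) a \<longleftrightarrow> emeasure increments (Pair L -` B) = 0" if L: "L \<in> space proj_borel" for L
  proof -
    have "Pair L -` B \<in> sets increments" by (rule sets_Pair1[OF B])
    moreover have "Pair L -` B = {\<omega> \<in> space increments. \<not> ?Q (L, \<omega>)}"
      using L by (auto simp: B_def space_pair_measure)
    ultimately show ?thesis
      unfolding fast_def eventually_sequentially using AE_iff_measurable[of "Pair L -` B" increments "\<lambda>\<omega>. ?Q (L, \<omega>)"]
      by (simp only: r_def fst_conv snd_conv)
  qed
  then have "{L \<in> space proj_borel. fast (rep L) a} = {L \<in> space proj_borel. emeasure increments (Pair L -` B) = 0}"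
    by blast
  also have "\<dots> \<in> sets proj_borel" by measurable
  finally show ?thesis .
qed

text \<open>The ratio of \<open>L\<^sub>n w\<close> to \<open>L\<^sub>n u\<close> tends to 0 exponentially and bounds the difference of the test
  functions.\<close>

lemma orbits_merge:
  fixes C :: "('k ^ 'n) set"
  assumes C: "is_cone C" and u: "u \<noteq> 0" "fast u a" and w: "w \<in> slow b" and "b < a" and uw: "u + w \<noteq> 0"
  shows "AE \<omega> in increments.
    (\<lambda>n. cone_test C k (rep (orbit \<omega> n (line (u + w)))) - cone_test C k (rep (orbit \<omega> n (line u)))) \<longlonglongrightarrow> 0"
  using slow_fast_ratio[OF u(2) w \<open>b < a\<close>] AE_space
proof eventually_elim
  case (elim \<omega>)
  let ?L = "\<lambda>n. left_walk \<omega> n"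
  have "(\<lambda>n. real k * (2 * (norm (?L n *v w) / norm (?L n *v u)))) \<longlonglongrightarrow> real k * (2 * 0)"
    by (intro tendsto_mult tendsto_const elim(1))
  then have lim: "(\<lambda>n. real k * (2 * (norm (?L n *v w) / norm (?L n *v u)))) \<longlonglongrightarrow> 0" by simp
  show ?case
  proof (rule Lim_null_comparison[OF always_eventually lim], rule allI)
    fix n
    have nz: "?L n *v u \<noteq> 0" "?L n *v (u + w) \<noteq> 0"
      using left_walk_nonzero[OF elim(2) u(1)] left_walk_nonzero[OF elim(2) uw] by auto
    have "norm (cone_test C k (rep (orbit \<omega> n (line (u + w)))) - cone_test C k (rep (orbit \<omega> n (line u)))) =
        \<bar>cone_test C k (?L n *v u + ?L n *v w) - cone_test C k (?L n *v u)\<bar>"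
      unfolding orbit_line cone_test_line[OF C nz(1)] cone_test_line[OF C nz(2)]
      by (simp add: matrix_vector_right_distrib)
    also have "\<dots> \<le> real k * (2 * (norm (?L n *v w) / norm (?L n *v u)))"
      using nz by (intro cone_test_add_le[OF C]) (simp_all add: matrix_vector_right_distrib)
    finally show "norm (cone_test C k (rep (orbit \<omega> n (line (u + w)))) - cone_test C k (rep (orbit \<omega> n (line u)))) \<le>
      real k * (2 * (norm (?L n *v w) / norm (?L n *v u)))" .
  qed
qed

text \<open>By stationarity the integral of \<open>f\<close> is that of \<open>f\<close> along the orbit at any time \<open>n\<close>; the hypothesis
  allows to start the orbit at \<open>r x\<close> instead of \<open>x\<close>, up to an error that vanishes by dominated
  convergence.\<close>

lemma stationary_integral_limit:
  fixes f :: "('k ^ 'n) set \<Rightarrow> real" and r :: "('k ^ 'n) set \<Rightarrow> ('k ^ 'n) set"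
  assumes stat: "stationary \<nu>"
    and f [measurable]: "f \<in> borel_measurable proj_borel" and f01: "\<And>x. 0 \<le> f x" "\<And>x. f x \<le> 1"
    and r [measurable]: "r \<in> proj_borel \<rightarrow>\<^sub>M proj_borel"
    and merge: "AE x in \<nu>. AE \<omega> in increments. (\<lambda>n. f (orbit \<omega> n x) - f (orbit \<omega> n (r x))) \<longlonglongrightarrow> 0"
  shows "(\<lambda>n. \<integral>\<^sup>+x. \<integral>\<^sup>+\<omega>. ennreal (f (orbit \<omega> n (r x))) \<partial>increments \<partial>\<nu>) \<longlonglongrightarrow> (\<integral>\<^sup>+x. ennreal (f x) \<partial>\<nu>)"
proof -
  note \<nu> = stationaryD[OF stat]
  have [measurable_cong]: "sets \<nu> = sets proj_borel" by fact
  interpret \<nu>: prob_space \<nu> by fact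
  let ?A = "\<integral>\<^sup>+x. ennreal (f x) \<partial>\<nu>"
  let ?B = "\<lambda>n. \<integral>\<^sup>+x. \<integral>\<^sup>+\<omega>. ennreal (f (orbit \<omega> n (r x))) \<partial>increments \<partial>\<nu>"
  define d where "d n x \<omega> = \<bar>f (orbit \<omega> n x) - f (orbit \<omega> n (r x))\<bar>" for n x \<omega>
  let ?E = "\<lambda>n. \<integral>\<^sup>+x. \<integral>\<^sup>+\<omega>. ennreal (d n x \<omega>) \<partial>increments \<partial>\<nu>"
  have d01: "0 \<le> d n x \<omega>" "d n x \<omega> \<le> 1" for n x \<omega>
    using f01[of "orbit \<omega> n x"] f01[of "orbit \<omega> n (r x)"] by (auto simp: d_def abs_le_iff)
  have fo [measurable]: "(\<lambda>z. f (orbit (snd z) n (fst z))) \<in> borel_measurable (proj_borel \<Otimes>\<^sub>M increments)" for n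
    by (rule measurable_compose[OF orbit_measurable f])
  have r_pair: "(\<lambda>z. (r (fst z), snd z)) \<in> proj_borel \<Otimes>\<^sub>M increments \<rightarrow>\<^sub>M proj_borel \<Otimes>\<^sub>M increments"
    by measurable
  have fr [measurable]: "(\<lambda>z. f (orbit (snd z) n (r (fst z)))) \<in> borel_measurable (proj_borel \<Otimes>\<^sub>M increments)" for n
    using measurable_compose[OF r_pair fo[of n]] by simp
  have dm [measurable]: "(\<lambda>z. d n (fst z) (snd z)) \<in> borel_measurable (proj_borel \<Otimes>\<^sub>M increments)" for n
    unfolding d_def by measurable
  have slice: "(\<lambda>\<omega>. h x \<omega>) \<in> borel_measurable increments"
    if "(\<lambda>z. h (fst z) (snd z)) \<in> borel_measurable (proj_borel \<Otimes>\<^sub>M increments)" "x \<in> space \<nu>"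
    for h :: "_ \<Rightarrow> _ \<Rightarrow> real" and x
    using measurable_compose[OF measurable_Pair1'[of x proj_borel increments] that(1)] that(2) \<nu>(3) by simp
  have int_meas: "(\<lambda>x. \<integral>\<^sup>+\<omega>. ennreal (h x \<omega>) \<partial>increments) \<in> borel_measurable \<nu>"
    if "(\<lambda>z. h (fst z) (snd z)) \<in> borel_measurable (proj_borel \<Otimes>\<^sub>M increments)" for h :: "_ \<Rightarrow> _ \<Rightarrow> real"
    using increments.borel_measurable_nn_integral_fst[OF measurable_compose[OF that measurable_ennreal]]
    by (simp add: measurable_cong_sets[OF \<nu>(2) refl])
  have A: "?A = (\<integral>\<^sup>+x. \<integral>\<^sup>+\<omega>. ennreal (f (orbit \<omega> n x)) \<partial>increments \<partial>\<nu>)" for n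
    by (rule nn_integral_orbit[OF stat, symmetric]) (rule measurable_compose[OF f measurable_ennreal])
  have E_lim: "?E \<longlonglongrightarrow> 0"
  proof -
    have "?E \<longlonglongrightarrow> (\<integral>\<^sup>+x. 0 \<partial>\<nu>)"
    proof (rule nn_integral_dominated_convergence[where w = "\<lambda>_. 1"])
      show "AE x in \<nu>. (\<lambda>n. \<integral>\<^sup>+\<omega>. ennreal (d n x \<omega>) \<partial>increments) \<longlonglongrightarrow> 0"
        using merge AE_space
      proof eventually_elim
        case (elim x)
        have "(\<lambda>n. \<integral>\<^sup>+\<omega>. ennreal (d n x \<omega>) \<partial>increments) \<longlonglongrightarrow> (\<integral>\<^sup>+\<omega>. 0 \<partial>increments)"
        proof (rule nn_integral_dominated_convergence[where w = "\<lambda>_. 1"])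
          show "(\<lambda>\<omega>. ennreal (d n x \<omega>)) \<in> borel_measurable increments" for n
            by (rule measurable_compose[OF slice[OF dm elim(2)] measurable_ennreal])
          show "AE \<omega> in increments. (\<lambda>n. ennreal (d n x \<omega>)) \<longlonglongrightarrow> 0"
            using elim(1)
          proof eventually_elim
            case (elim \<omega>)
            from tendsto_ennrealI[OF tendsto_rabs_zero[OF elim]] show ?case by (simp add: d_def)
          qed
        qed (use d01 in \<open>auto simp: increments.emeasure_space_1 intro!: AE_I2\<close>)
        then show ?case by simp
      qed
      show "AE x in \<nu>. (\<integral>\<^sup>+\<omega>. ennreal (d n x \<omega>) \<partial>increments) \<le> 1" for n
      proof (rule AE_I2)
        fix x
        have "(\<integral>\<^sup>+\<omega>. ennreal (d n x \<omega>) \<partial>increments) \<le> (\<integral>\<^sup>+\<omega>. 1 \<partial>increments)"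
          using d01 by (intro nn_integral_mono) simp
        then show "(\<integral>\<^sup>+\<omega>. ennreal (d n x \<omega>) \<partial>increments) \<le> 1"
          by (simp add: increments.emeasure_space_1)
      qed
    qed (use int_meas[OF dm] in \<open>auto simp: \<nu>.emeasure_space_1\<close>)
    then show ?thesis by simp
  qed
  have compare: "(\<integral>\<^sup>+x. \<integral>\<^sup>+\<omega>. ennreal (h1 x \<omega>) \<partial>increments \<partial>\<nu>) \<le>
      (\<integral>\<^sup>+x. \<integral>\<^sup>+\<omega>. ennreal (h2 x \<omega>) \<partial>increments \<partial>\<nu>) + ?E n"
    if h: "(\<lambda>z. h2 (fst z) (snd z)) \<in> borel_measurable (proj_borel \<Otimes>\<^sub>M increments)"
      and le: "\<And>x \<omega>. h1 x \<omega> \<le> h2 x \<omega> + d n x \<omega>" and pos: "\<And>x \<omega>. 0 \<le> h2 x \<omega>"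
    for h1 h2 :: "_ \<Rightarrow> _ \<Rightarrow> real" and n
  proof -
    have "(\<integral>\<^sup>+x. \<integral>\<^sup>+\<omega>. ennreal (h1 x \<omega>) \<partial>increments \<partial>\<nu>) \<le>
        (\<integral>\<^sup>+x. (\<integral>\<^sup>+\<omega>. ennreal (h2 x \<omega>) \<partial>increments) + (\<integral>\<^sup>+\<omega>. ennreal (d n x \<omega>) \<partial>increments) \<partial>\<nu>)"
    proof (rule nn_integral_mono)
      fix x assume x: "x \<in> space \<nu>"
      have "(\<integral>\<^sup>+\<omega>. ennreal (h1 x \<omega>) \<partial>increments) \<le> (\<integral>\<^sup>+\<omega>. ennreal (h2 x \<omega>) + ennreal (d n x \<omega>) \<partial>increments)"
        using le pos d01 by (intro nn_integral_mono) (simp add: ennreal_plus[symmetric] ennreal_leI del: ennreal_plus)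
      also have "\<dots> = (\<integral>\<^sup>+\<omega>. ennreal (h2 x \<omega>) \<partial>increments) + (\<integral>\<^sup>+\<omega>. ennreal (d n x \<omega>) \<partial>increments)"
        by (intro nn_integral_add measurable_compose[OF slice[OF h x] measurable_ennreal]
            measurable_compose[OF slice[OF dm x] measurable_ennreal])
      finally show "(\<integral>\<^sup>+\<omega>. ennreal (h1 x \<omega>) \<partial>increments) \<le>
        (\<integral>\<^sup>+\<omega>. ennreal (h2 x \<omega>) \<partial>increments) + (\<integral>\<^sup>+\<omega>. ennreal (d n x \<omega>) \<partial>increments)" .
    qed
    also have "\<dots> = (\<integral>\<^sup>+x. \<integral>\<^sup>+\<omega>. ennreal (h2 x \<omega>) \<partial>increments \<partial>\<nu>) + ?E n"
      by (intro nn_integral_add int_meas h dm)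
    finally show ?thesis .
  qed
  have upper: "?B n \<le> ?A + ?E n" for n
    unfolding A[of n] by (rule compare[OF fo]) (use f01 in \<open>auto simp: d_def\<close>)
  have lower: "?A \<le> ?B n + ?E n" for n
    unfolding A[of n] by (rule compare[OF fr]) (use f01 in \<open>auto simp: d_def\<close>)
  have A_fin: "?A \<noteq> \<top>"
  proof -
    have "?A \<le> (\<integral>\<^sup>+x. 1 \<partial>\<nu>)" using f01 by (intro nn_integral_mono) simp
    then show ?thesis by (auto simp: \<nu>.emeasure_space_1 top_unique)
  qed
  show ?thesis
  proof (rule tendsto_sandwich)
    show "\<forall>\<^sub>F n in sequentially. ?B n \<le> ?A + ?E n" using upper by simp
    show "\<forall>\<^sub>F n in sequentially. ?A - ?E n \<le> ?B n"
      using lower A_fin by (auto simp: ennreal_minus_le_iff add.commute intro!: always_eventually)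
    show "(\<lambda>n. ?A + ?E n) \<longlonglongrightarrow> ?A" using tendsto_add[OF tendsto_const E_lim] by simp
    have "(\<lambda>n. ?A - ?E n) \<longlonglongrightarrow> ?A - 0"
      by (rule tendsto_diff_ennreal[OF tendsto_const E_lim A_fin]) simp
    then show "(\<lambda>n. ?A - ?E n) \<longlonglongrightarrow> ?A" by simp
  qed
qed

text \<open>Let \<open>r\<close> send a line to its projection along \<open>W\<close>. It factors through the quotient, so \<open>\<nu>1\<close> and \<open>\<nu>2\<close> have
  the same image under \<open>r\<close>. Orbits of \<open>x\<close> and \<open>r x\<close> merge, so the integrals of the test functions
  against \<open>\<nu>1\<close> and \<open>\<nu>2\<close> are limits of one and the same sequence. The growth rate is assumed for \<open>\<nu>1\<close>
  only; it passes to \<open>r x\<close>, hence to the common image, hence to \<open>\<nu>2\<close>.\<close>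

lemma lift_unique:
  assumes flag: "quotient_flag V' W q" and W: "W \<subseteq> slow b" and "b < a"
    and \<nu>1: "stationary \<nu>1" "emeasure \<nu>1 (proj V' - proj W) = 1"
    and \<nu>2: "stationary \<nu>2" "emeasure \<nu>2 (proj V' - proj W) = 1"
    and growth: "AE x in \<nu>1. growth (rep x) a"
    and eq: "distr (restrict_space \<nu>1 (proj V' - proj W)) (quot_proj_borel V' W) (\<lambda>L. coset W ` L) =
      distr (restrict_space \<nu>2 (proj V' - proj W)) (quot_proj_borel V' W) (\<lambda>L. coset W ` L)"
  shows "\<nu>1 = \<nu>2"
proof -
  interpret flag: quotient_flag V' W q by fact
  note s1 = stationaryD[OF \<nu>1(1)] and s2 = stationaryD[OF \<nu>2(1)]
  \<comment> \<open>The set \<open>\<Omega>\<close> has full measure; the identity outside keeps \<open>r\<close> measurable on the whole space.\<close>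
  define r where "r x = (if x \<in> flag.\<Omega> then quot_section q (coset W ` x) else x)" for x
  have on_\<Omega>: "(\<lambda>x. quot_section q (coset W ` x)) \<in> restrict_space proj_borel flag.\<Omega> \<rightarrow>\<^sub>M proj_borel"
    using measurable_compose[OF flag.quot_proj_measurable flag.quot_section_measurable]
    by (simp add: measurable_restrict_space2_iff)
  have "{x \<in> space proj_borel. x \<in> flag.\<Omega>} = flag.\<Omega>"
    using sets.sets_into_space[OF flag.\<Omega>_sets] by blast
  then have "{x \<in> space proj_borel. x \<in> flag.\<Omega>} \<in> sets proj_borel"
    using flag.\<Omega>_sets by (simp only:)
  note If_iff = measurable_If_restrict_space_iff[OF this]
  have r_meas: "r \<in> proj_borel \<rightarrow>\<^sub>M proj_borel"
    unfolding r_def If_iff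
  proof
    show "(\<lambda>x. quot_section q (coset W ` x)) \<in> restrict_space proj_borel {x. x \<in> flag.\<Omega>} \<rightarrow>\<^sub>M proj_borel"
      using on_\<Omega> by (simp only: Collect_mem_eq)
    show "(\<lambda>x. x) \<in> restrict_space proj_borel {x. x \<notin> flag.\<Omega>} \<rightarrow>\<^sub>M proj_borel"
      by (rule measurable_restrict_space1[OF measurable_ident_sets[OF refl]])
  qed
  have r_line: "\<exists>c. c \<noteq> 0 \<and> rep x - q *v rep x = c *s rep (r x)" "r x = line (rep x - q *v rep x)"
      "rep x - q *v rep x \<noteq> 0"
    if x: "x \<in> flag.\<Omega>" for x
  proof -
    have x': "rep x \<noteq> 0" "line (rep x) = x"
      using rep[of x] x sets.sets_into_space[OF flag.\<Omega>_sets] by auto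
    then have "rep x \<notin> W" using x flag.line_mem_\<Omega>[of "rep x"] by simp
    from flag.quot_section_proj[OF this] x x'(2) show *: "r x = line (rep x - q *v rep x)"
      by (simp add: r_def)
    show nz: "rep x - q *v rep x \<noteq> 0" by (rule flag.complement_nonzero) fact
    have "rep x - q *v rep x \<in> line (rep (r x))"
      using rep[OF line_in_space[OF nz]] mem_line[of "rep x - q *v rep x"] by (simp add: *)
    then obtain c where "rep x - q *v rep x = c *s rep (r x)" by (auto simp: line_eq_range)
    with nz show "\<exists>c. c \<noteq> 0 \<and> rep x - q *v rep x = c *s rep (r x)" by auto
  qed
  have full: "AE x in \<nu>. x \<in> flag.\<Omega>" if "stationary \<nu>" "emeasure \<nu> flag.\<Omega> = 1" for \<nu>
  proof -
    interpret \<nu>: prob_space \<nu> by (rule stationaryD[OF that(1)])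
    show ?thesis
      using that stationaryD(2)[OF that(1)] flag.\<Omega>_sets
      by (subst \<nu>.prob_eq_1[symmetric]) (auto simp: measure_def)
  qed
  have distr_r: "distr \<nu> proj_borel r =
      distr (distr (restrict_space \<nu> flag.\<Omega>) flag.Q (\<lambda>L. coset W ` L)) proj_borel (quot_section q)"
    if \<nu>: "stationary \<nu>" "emeasure \<nu> flag.\<Omega> = 1" for \<nu>
  proof (rule measure_eqI)
    note s = stationaryD[OF \<nu>(1)]
    fix A assume "A \<in> sets (distr \<nu> proj_borel r)"
    then have A: "A \<in> sets proj_borel" by simp
    have sets_r: "sets (restrict_space \<nu> flag.\<Omega>) = sets (restrict_space proj_borel flag.\<Omega>)"
      by (rule sets_restrict_space_cong) (rule s)
    have \<Omega>: "flag.\<Omega> \<in> sets \<nu>" "flag.\<Omega> \<inter> space \<nu> \<in> sets \<nu>" using flag.\<Omega>_sets s by auto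
    have p_meas: "(\<lambda>L. coset W ` L) \<in> restrict_space \<nu> flag.\<Omega> \<rightarrow>\<^sub>M flag.Q"
      using flag.quot_proj_measurable by (simp add: measurable_cong_sets[OF sets_r refl])
    have q_meas: "quot_section q \<in> flag.Q \<rightarrow>\<^sub>M proj_borel"
      using flag.quot_section_measurable by (simp add: measurable_restrict_space2_iff)
    have r_\<nu>: "r \<in> \<nu> \<rightarrow>\<^sub>M proj_borel" using r_meas by (simp add: measurable_cong_sets[OF s(2) refl])
    have "emeasure (distr \<nu> proj_borel r) A = (\<integral>\<^sup>+x. indicator A (r x) \<partial>\<nu>)"
      using A nn_integral_distr[OF r_\<nu>, of "indicator A"] by simp
    also have "\<dots> = (\<integral>\<^sup>+x. indicator A (quot_section q (coset W ` x)) * indicator flag.\<Omega> x \<partial>\<nu>)"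
      by (rule nn_integral_cong_AE, use full[OF \<nu>] in eventually_elim) (simp add: r_def)
    also have "\<dots> = (\<integral>\<^sup>+x. indicator A (quot_section q (coset W ` x)) \<partial>restrict_space \<nu> flag.\<Omega>)"
      using \<Omega> by (simp add: nn_integral_restrict_space)
    also have "\<dots> = (\<integral>\<^sup>+x. indicator A x \<partial>distr (distr (restrict_space \<nu> flag.\<Omega>) flag.Q (\<lambda>L. coset W ` L)) proj_borel (quot_section q))"
      unfolding distr_distr[OF q_meas p_meas] comp_def
      using A by (subst nn_integral_distr[OF measurable_compose[OF p_meas q_meas]]) simp_all
    finally show "emeasure (distr \<nu> proj_borel r) A =
      emeasure (distr (distr (restrict_space \<nu> flag.\<Omega>) flag.Q (\<lambda>L. coset W ` L)) proj_borel (quot_section q)) A"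
      using A by simp
  qed simp
  have distr_eq: "distr \<nu>1 proj_borel r = distr \<nu>2 proj_borel r"
    unfolding distr_r[OF \<nu>1] distr_r[OF \<nu>2] eq ..
  have r_\<nu>1: "r \<in> \<nu>1 \<rightarrow>\<^sub>M proj_borel" and r_\<nu>2: "r \<in> \<nu>2 \<rightarrow>\<^sub>M proj_borel"
    using r_meas by (simp_all add: measurable_cong_sets[OF s1(2) refl] measurable_cong_sets[OF s2(2) refl])
  have fast1: "AE x in \<nu>1. fast (rep (r x)) a"
    using growth full[OF \<nu>1] AE_space
  proof eventually_elim
    case (elim x)
    have "rep x \<noteq> 0" using rep[of x] elim(3) s1(3) by simp
    then have "fast (rep x) a" by (rule growth_imp_fast[OF elim(1)])
    then have "fast (rep x - q *v rep x) a"
      using flag.q_range[of "rep x"] W by (intro fast_diff_slow[OF _ _ \<open>b < a\<close>]) auto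
    then show ?case using r_line(1)[OF elim(2)] fast_of_scale by auto
  qed
  have fast2: "AE x in \<nu>2. fast (rep (r x)) a"
  proof -
    have "AE y in distr \<nu>1 proj_borel r. fast (rep y) a"
      using fast1 by (simp only: AE_distr_iff[OF r_\<nu>1 fast_measurable])
    then show ?thesis
      by (simp only: distr_eq AE_distr_iff[OF r_\<nu>2 fast_measurable])
  qed
  have limit: "(\<lambda>n. \<integral>\<^sup>+y. \<integral>\<^sup>+\<omega>. ennreal (cone_test C k (rep (orbit \<omega> n y))) \<partial>increments \<partial>distr \<nu> proj_borel r)
      \<longlonglongrightarrow> (\<integral>\<^sup>+x. ennreal (cone_test C k (rep x)) \<partial>\<nu>)"
    if \<nu>: "stationary \<nu>" "emeasure \<nu> flag.\<Omega> = 1" and fast: "AE x in \<nu>. fast (rep (r x)) a" and C: "is_cone C"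
    for \<nu> C k
  proof -
    note s = stationaryD[OF \<nu>(1)]
    have r_\<nu>: "r \<in> \<nu> \<rightarrow>\<^sub>M proj_borel" using r_meas by (simp add: measurable_cong_sets[OF s(2) refl])
    have "AE x in \<nu>. AE \<omega> in increments.
        (\<lambda>n. cone_test C k (rep (orbit \<omega> n x)) - cone_test C k (rep (orbit \<omega> n (r x)))) \<longlonglongrightarrow> 0"
      using fast full[OF \<nu>] AE_space
    proof eventually_elim
      case (elim x)
      have x: "rep x \<noteq> 0" "line (rep x) = x" using rep[of x] elim(3) s(3) by auto
      obtain c where c: "c \<noteq> 0" "rep x - q *v rep x = c *s rep (r x)" using r_line(1)[OF elim(2)] by blast
      have "r x \<in> space proj_borel"
        unfolding r_line(2)[OF elim(2)] by (rule line_in_space[OF r_line(3)[OF elim(2)]])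
      then have rx: "line (rep (r x)) = r x" "rep (r x) \<noteq> 0" using rep[of "r x"] by simp_all
      let ?w = "inverse c *s (q *v rep x)"
      have sum: "rep (r x) + ?w = inverse c *s rep x"
      proof -
        have "inverse c *s rep x = inverse c *s (c *s rep (r x) + q *v rep x)"
          unfolding c(2)[symmetric] by simp
        also have "\<dots> = rep (r x) + ?w" using c(1) by (simp add: vec.scale_right_distrib)
        finally show ?thesis by simp
      qed
      have "?w \<in> slow b"
        using flag.q_range[of "rep x"] W by (intro vec.subspace_scale[OF subspace_slow]) auto
      moreover have "rep (r x) + ?w \<noteq> 0" unfolding sum using c(1) x(1) by simp
      ultimately have "AE \<omega> in increments.
        (\<lambda>n. cone_test C k (rep (orbit \<omega> n (line (rep (r x) + ?w)))) - cone_test C k (rep (orbit \<omega> n (line (rep (r x)))))) \<longlonglongrightarrow> 0"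
        by (intro orbits_merge[OF C rx(2) elim(1) _ \<open>b < a\<close>])
      moreover have "line (inverse c *s rep x) = x" using line_scale[of "inverse c" "rep x"] c(1) x(2) by simp
      ultimately show ?case unfolding sum rx(1) by simp
    qed
    then have "(\<lambda>n. \<integral>\<^sup>+x. \<integral>\<^sup>+\<omega>. ennreal (cone_test C k (rep (orbit \<omega> n (r x)))) \<partial>increments \<partial>\<nu>)
        \<longlonglongrightarrow> (\<integral>\<^sup>+x. ennreal (cone_test C k (rep x)) \<partial>\<nu>)"
      by (rule stationary_integral_limit[OF \<nu>(1) cone_test_measurable cone_test_bounds r_meas])
    also have "(\<lambda>n. \<integral>\<^sup>+x. \<integral>\<^sup>+\<omega>. ennreal (cone_test C k (rep (orbit \<omega> n (r x)))) \<partial>increments \<partial>\<nu>) =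
        (\<lambda>n. \<integral>\<^sup>+y. \<integral>\<^sup>+\<omega>. ennreal (cone_test C k (rep (orbit \<omega> n y))) \<partial>increments \<partial>distr \<nu> proj_borel r)"
    proof
      fix n
      have "(\<lambda>z. ennreal (cone_test C k (rep (orbit (snd z) n (fst z))))) \<in> borel_measurable (proj_borel \<Otimes>\<^sub>M increments)"
        by (rule measurable_compose[OF measurable_compose[OF orbit_measurable cone_test_measurable] measurable_ennreal])
      from increments.borel_measurable_nn_integral_fst[OF this]
      have "(\<lambda>y. \<integral>\<^sup>+\<omega>. ennreal (cone_test C k (rep (orbit \<omega> n y))) \<partial>increments) \<in> borel_measurable proj_borel"
        by simp
      then show "(\<integral>\<^sup>+x. \<integral>\<^sup>+\<omega>. ennreal (cone_test C k (rep (orbit \<omega> n (r x)))) \<partial>increments \<partial>\<nu>) =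
        (\<integral>\<^sup>+y. \<integral>\<^sup>+\<omega>. ennreal (cone_test C k (rep (orbit \<omega> n y))) \<partial>increments \<partial>distr \<nu> proj_borel r)"
        by (subst nn_integral_distr[OF r_\<nu>]) simp_all
    qed
    finally show ?thesis .
  qed
  show ?thesis
  proof (rule proj_measure_eqI)
    fix C :: "('k ^ 'n) set" and k assume C: "is_cone C" "closed C"
    show "(\<integral>\<^sup>+L. ennreal (cone_test C k (rep L)) \<partial>\<nu>1) = (\<integral>\<^sup>+L. ennreal (cone_test C k (rep L)) \<partial>\<nu>2)"
      using limit[OF \<nu>1 fast1 C(1), of k] limit[OF \<nu>2 fast2 C(1), of k]
      unfolding distr_eq by (rule LIMSEQ_unique)
  qed (use s1 s2 in auto)
qed

text \<open>A lift lives on a subspace of the projective space; viewed on the whole space it is still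
  stationary.\<close>

lemma stationary_extend:
  assumes \<Omega>: "\<Omega> \<in> sets proj_borel"
    and \<nu>': "\<nu>' \<in> stationary_measures \<mu> proj_act (restrict_space proj_borel \<Omega>)"
  shows "stationary (distr \<nu>' proj_borel (\<lambda>x. x))" (is "stationary ?\<nu>")
    and "emeasure (distr \<nu>' proj_borel (\<lambda>x. x)) \<Omega> = 1"
    and "restrict_space (distr \<nu>' proj_borel (\<lambda>x. x)) \<Omega> = \<nu>'"
proof -
  have sets: "sets \<nu>' = sets (restrict_space proj_borel \<Omega>)" and "prob_space \<nu>'"
    and stat: "f \<in> borel_measurable (restrict_space proj_borel \<Omega>) \<Longrightarrow>
      (\<integral>\<^sup>+ x. \<integral>\<^sup>+ g. f (proj_act g x) \<partial>\<mu> \<partial>\<nu>') = (\<integral>\<^sup>+ x. f x \<partial>\<nu>')" for f :: "_ \<Rightarrow> ennreal"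
    using \<nu>' by (auto simp: stationary_measures_def)
  interpret \<nu>': prob_space \<nu>' by fact
  have space: "space \<nu>' = \<Omega>"
    using sets_eq_imp_space_eq[OF sets] sets.sets_into_space[OF \<Omega>] by (auto simp: space_restrict_space)
  have id: "(\<lambda>x. x) \<in> \<nu>' \<rightarrow>\<^sub>M proj_borel"
    by (simp add: measurable_cong_sets[OF sets refl] measurable_restrict_space1)
  have "(\<integral>\<^sup>+ x. \<integral>\<^sup>+ g. f (proj_act g x) \<partial>\<mu> \<partial>?\<nu>) = (\<integral>\<^sup>+ x. f x \<partial>?\<nu>)"
    if f [measurable]: "f \<in> borel_measurable proj_borel" for f :: "_ \<Rightarrow> ennreal"
  proof -
    have "(\<lambda>x. \<integral>\<^sup>+ g. f (proj_act g x) \<partial>\<mu>) \<in> borel_measurable proj_borel" by measurable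
    then have "(\<integral>\<^sup>+ x. \<integral>\<^sup>+ g. f (proj_act g x) \<partial>\<mu> \<partial>?\<nu>) = (\<integral>\<^sup>+ x. \<integral>\<^sup>+ g. f (proj_act g x) \<partial>\<mu> \<partial>\<nu>')"
      by (subst nn_integral_distr[OF id]) simp_all
    also have "\<dots> = (\<integral>\<^sup>+ x. f x \<partial>\<nu>')" by (rule stat) (rule measurable_restrict_space1[OF f])
    also have "\<dots> = (\<integral>\<^sup>+ x. f x \<partial>?\<nu>)" using f by (subst nn_integral_distr[OF id]) simp_all
    finally show ?thesis .
  qed
  then show "stationary ?\<nu>"
    using \<nu>'.prob_space_distr[OF id] by (simp add: stationary_measures_def)
  have emeasure: "emeasure ?\<nu> A = emeasure \<nu>' A" if "A \<in> sets proj_borel" "A \<subseteq> \<Omega>" for A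
    using that by (simp add: emeasure_distr[OF id] space Int_absorb2)
  show "emeasure ?\<nu> \<Omega> = 1"
    using emeasure[OF \<Omega>] \<nu>'.emeasure_space_1 by (simp add: space)
  show "restrict_space ?\<nu> \<Omega> = \<nu>'"
  proof (rule measure_eqI)
    show sets': "sets (restrict_space ?\<nu> \<Omega>) = sets \<nu>'"
      unfolding sets by (rule sets_restrict_space_cong) simp
    fix A assume "A \<in> sets (restrict_space ?\<nu> \<Omega>)"
    then have A: "A \<in> sets proj_borel" "A \<subseteq> \<Omega>"
      using \<Omega> sets.sets_into_space[OF \<Omega>] by (auto simp: sets_restrict_space_iff Int_absorb2)
    have "emeasure (restrict_space ?\<nu> \<Omega>) A = emeasure ?\<nu> A"
      using \<Omega> A by (intro emeasure_restrict_space) auto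
    then show "emeasure (restrict_space ?\<nu> \<Omega>) A = emeasure \<nu>' A"
      using emeasure[OF A] by simp
  qed
qed

end

theorem corollary1p3:
  fixes \<mu> :: "('k::{real_normed_field, euclidean_space} ^ 'n ^ 'n) measure"
    and \<nu> :: "('k ^ 'n) set measure"
  assumes "prob_space \<mu>"
    and "sets \<mu> = sets (restrict_space borel GL)"
    and "finite_first_moment \<mu>"
    and "\<nu> \<in> ergodic_measures \<mu> proj_act proj_borel"
  shows "\<exists>i \<in> {1..fkh_number \<mu>}.
           emeasure \<nu> (proj (fkh_space \<mu> i) - proj (fkh_space \<mu> (i + 1))) = 1 \<and>
           (\<exists>\<nu>bar \<in> ergodic_measures \<mu> quot_proj_act
                      (quot_proj_borel (fkh_space \<mu> i) (fkh_space \<mu> (i + 1))).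
              lifts \<mu> (fkh_space \<mu> i) (fkh_space \<mu> (i + 1)) \<nu>bar =
                {restrict_space \<nu> (proj (fkh_space \<mu> i) - proj (fkh_space \<mu> (i + 1)))})"
proof -
  interpret prob_space \<mu> by fact
  interpret random_matrix \<mu> by unfold_locales fact
  note moment = assms(3) and erg = assms(4)
  define a where "a = cocycle_average \<mu> \<nu>"
  have "a \<in> fkh_exponents \<mu>" using erg by (auto simp: fkh_exponents_def a_def)
  then obtain i where i: "i \<in> {1..fkh_number \<mu>}" and exponent: "fkh_exponent \<mu> i = a"
    using ex_fkh_index[OF moment] by blast
  have V'_eq: "fkh_space \<mu> i = slow a" using fkh_space_eq_slow[OF moment i] exponent by simp
  define W where "W = fkh_space \<mu> (i + 1)"
  note W_facts = fkh_space_Suc[OF moment i, folded W_def, unfolded exponent V'_eq]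
  obtain b where b: "b < a" "W \<subseteq> slow b" using W_facts(1) by blast
  obtain q :: "'k ^ 'n ^ 'n" where q: "\<And>v. v \<in> W \<Longrightarrow> q *v v = v" "\<And>v. q *v v \<in> W"
    using ex_projection_matrix[OF W_facts(2)] by blast
  interpret flag: quotient_flag "slow a" W q
    by unfold_locales (fact subspace_slow W_facts q)+
  have stat: "stationary \<nu>" using erg by (simp add: ergodic_measures_def)
  note s = stationaryD[OF stat]
  interpret \<nu>: prob_space \<nu> by fact
  have growth: "AE x in \<nu>. growth (rep x) a" unfolding a_def by (rule ergodic_growth[OF moment erg])
  then have "AE x in \<nu>. x \<in> flag.\<Omega>" using AE_space
  proof eventually_elim
    case (elim x)
    then have x: "rep x \<noteq> 0" "line (rep x) = x" using rep[of x] s(3) by auto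
    have "rep x \<in> slow a" by (rule growth_imp_slow[OF elim(1) x(1)])
    moreover have "rep x \<notin> W" using growth_slow_le[OF elim(1) x(1), of b] b by auto
    ultimately show ?case using flag.line_mem_\<Omega>[OF x(1)] x(2) by simp
  qed
  then have full: "emeasure \<nu> flag.\<Omega> = 1"
    using flag.\<Omega>_sets s(2) by (subst (asm) \<nu>.prob_eq_1[symmetric]) (auto simp: \<nu>.emeasure_eq_measure)
  have "AE g in \<mu>. (\<lambda>v. g *v v) ` slow a \<subseteq> slow a"
    by (rule AE_invariant[OF subspace_slow AE_slow])
  then have equivariant: "AE g in \<mu>. \<forall>x\<in>flag.\<Omega>. proj_act g x \<in> flag.\<Omega> \<and> coset W ` proj_act g x = quot_proj_act g (coset W ` x)"
    using W_facts(3) AE_space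
  proof eventually_elim
    case (elim g)
    show ?case using flag.quot_equivariant[OF _ elim(1,2)] elim(3) space_\<mu> by blast
  qed
  interpret factor: ergodic_factor \<mu> proj_borel proj_act \<nu> flag.\<Omega> flag.Q "\<lambda>L. coset W ` L"
      "quot_section q" quot_proj_act
    by unfold_locales
      (fact erg flag.\<Omega>_sets full flag.quot_proj_measurable flag.quot_section_measurable flag.quot_proj_section equivariant)+
  have "lifts \<mu> (slow a) W factor.factor = {restrict_space \<nu> flag.\<Omega>}"
  proof (intro equalityI subsetI)
    fix \<nu>' assume "\<nu>' \<in> lifts \<mu> (slow a) W factor.factor"
    then have \<nu>': "\<nu>' \<in> stationary_measures \<mu> proj_act (restrict_space proj_borel flag.\<Omega>)"
      and push: "distr \<nu>' flag.Q (\<lambda>L. coset W ` L) = factor.factor" by (auto simp: lifts_def)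
    note ext = stationary_extend[OF flag.\<Omega>_sets \<nu>']
    have "\<nu> = distr \<nu>' proj_borel (\<lambda>x. x)"
    proof (rule lift_unique[OF flag.quotient_flag_axioms b(2) b(1) stat full ext(1,2) growth])
      show "distr (restrict_space \<nu> flag.\<Omega>) flag.Q (\<lambda>L. coset W ` L) =
        distr (restrict_space (distr \<nu>' proj_borel (\<lambda>x. x)) flag.\<Omega>) flag.Q (\<lambda>L. coset W ` L)"
        unfolding ext(3) push ..
    qed
    then show "\<nu>' \<in> {restrict_space \<nu> flag.\<Omega>}" using ext(3) by simp
  next
    fix \<nu>' assume "\<nu>' \<in> {restrict_space \<nu> flag.\<Omega>}"
    then show "\<nu>' \<in> lifts \<mu> (slow a) W factor.factor"
      using factor.restrict_stationary by (simp add: lifts_def)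
  qed
  with full factor.factor_ergodic i show ?thesis
    unfolding V'_eq[symmetric] W_def by blast
qed

end
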